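(* Let $d \ge 1$ be an integer and let $q \in (0,\infty)$ be real (not necessarily an integer). **(i) (Ornstein--Zernike decay).** There exist constants $c_{a,q,\hat x}>0$, depending only on $a\in(0,\infty)$, $q$, the direction $\hat x = x/|x|_a$ of $x \in \mathbb{Z}^d\setminus\{0\}$, and the dimension $d$, such that the following holds. Let $(a_n)_{n\ge 1}$ be any bounded sequence in $(0,\infty)$ with $a_n n \to \infty$ as $n \to\infty$ (this includes in particular the case of a constant sequence $a_n=a\in(0,\infty)$). Then for every $x \in \mathbb{Z}^d\setminus\{0\}$, as $n\to\infty$, $$ C_{a_n}^{(q)}(nx) \sim c_{a_n,q,\hat x}\, \frac{m_{a_n}^{(d-1-2q)/2}}{(n|x|_{a_n})^{(d+1-2q)/2}}\; e^{-m_{a_n} n |x|_{a_n}}, $$ where on the right-hand side $\hat x = x/|x|_{a_n}$. Moreover, the ratio of the left- and right-hand sides converges to $1$ uniformly in $x\in \mathbb{Z}^d\setminus\{0\}$, and the constants have the explicit $\hat x$-independent limit $$ \lim_{a\to 0} c_{a,q,\hat x} = c_{0,q} := \frac{d^q}{(2\pi)^{(d-1)/2}\,\Gamma(q)} . $$ **(ii) (Critical decay).** Let $a_n = s/n$ with $s\in[0,\infty)$, and assume $d>2q$ if $s=0$. Then for every fixed $x \in \mathbb{Z}^d\setminus\{0\}$, as $n \to\infty$, $$ C_{a_n}^{(q)}(nx) \sim \frac{1}{n^{d-2q}}\, G_s^{(q)}(x). $$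
   Context: $f(n)\sim g(n)$ means $\lim_{n\to\infty} f(n)/g(n)=1$. **Lattice Green function.** For $x\in\mathbb{Z}^d$, $q>0$, $a\ge 0$ (with $d>2q$ when $a=0$), $$ C_a^{(q)}(x) = \int_{[-\pi,\pi]^d} \frac{e^{ik\cdot x}}{(a^2+1-\hat D(k))^q}\,\frac{dk}{(2\pi)^d}, \qquad \hat D(k)=\frac1d\sum_{j=1}^d \cos k_j . $$ **Mass.** For $a\ge0$, $m_a\ge 0$ is the unique nonnegative solution of $\cosh m_a = 1+da^2$. **Anisotropic norm.** For nonzero $x\in\mathbb{R}^d$ and $a \ge 0$, $u_a(x)\ge 0$ is the unique solution $u \ge 0$ of $\frac1d\sum_{i=1}^d \sqrt{1+x_i^2u^2} = 1+a^2$. For $a>0$, $|0|_a=0$ and for nonzero $x\in\mathbb{R}^d$, $$ |x|_a = \frac{1}{m_a}\sum_{i=1}^d x_i\,\mathrm{arcsinh}(x_i u_a(x)). $$ **Continuum Green function.** For $x\in\mathbb{R}^d\setminus\{0\}$, $$ G_1^{(q)}(x) = \frac{2d^q}{\Gamma(q)(2\pi)^{d/2}} \Big(\frac{\sqrt{2d}}{\|x\|_2}\Big)^{(d-2q)/2} K_{(d-2q)/2}(\sqrt{2d}\,\|x\|_2), $$ where $K_\alpha$ is the modified Bessel function of the second kind; for $s>0$, $G_s^{(q)}(x) = s^{d-2q}G_1^{(q)}(sx)$; and for $s=0$ and $d>2q$, $$ G_0^{(q)}(x) = \frac{d^q\,\Gamma(\frac{d-2q}{2})}{2^q\pi^{d/2}\Gamma(q)}\,\frac{1}{\|x\|_2^{d-2q}}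 . $$ *)

theory Defs
  imports "HOL-Analysis.Analysis" "HOL-Library.Landau_Symbols"
begin

text \<open>The dimension \<open>d \<ge> 1\<close> is \<^term>\<open>CARD('n)\<close>, and points of \<open>\<int>\<^sup>d\<close> are regarded as the
  points of \<^typ>\<open>real^'n\<close> with integer coordinates.\<close>

definition int_lattice :: "(real^'n::finite) set" where
  "int_lattice = {x. \<forall>i. x $ i \<in> \<int>}"

definition D_hat :: "real^'n::finite \<Rightarrow> real" where
  "D_hat k = (\<Sum>j\<in>UNIV. cos (k $ j)) / real CARD('n)"

text \<open>The base \<open>a\<^sup>2 + 1 - D_hat k\<close> is nonnegative, so the real power is unproblematic; for \<open>a = 0\<close> it
  vanishes on the cube only at \<open>k = 0\<close>, where the integrand gets the junk value 0.\<close>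

definition lattice_green :: "real \<Rightarrow> real \<Rightarrow> real^'n::finite \<Rightarrow> complex" where
  "lattice_green a q x =
     (LINT k : cbox (\<chi> i. - pi) (\<chi> i. pi) | lborel.
        cis (k \<bullet> x) / of_real ((a\<^sup>2 + 1 - D_hat k) powr q)) / of_real ((2 * pi) ^ CARD('n))"

text \<open>The mass depends on the dimension, which is passed as a natural number.\<close>

definition mass :: "nat \<Rightarrow> real \<Rightarrow> real" where
  "mass d a = (THE m. m \<ge> 0 \<and> cosh m = 1 + real d * a\<^sup>2)"

lemma mass_ex1: "\<exists>!m::real. m \<ge> 0 \<and> cosh m = 1 + real d * a\<^sup>2"
proof (rule ex1I)
  show "arcosh (1 + real d * a\<^sup>2) \<ge> 0 \<and> cosh (arcosh (1 + real d * a\<^sup>2)) = 1 + real d * a\<^sup>2"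
    by simp
  show "m = arcosh (1 + real d * a\<^sup>2)" if "m \<ge> 0 \<and> cosh m = 1 + real d * a\<^sup>2" for m
    using that by (metis arcosh_cosh_real)
qed

text \<open>Meaningful for \<open>x \<noteq> 0\<close> only.\<close>

definition u_par :: "real \<Rightarrow> real^'n::finite \<Rightarrow> real" where
  "u_par a x =
     (THE u. u \<ge> 0 \<and> (\<Sum>i\<in>UNIV. sqrt (1 + (x $ i)\<^sup>2 * u\<^sup>2)) / real CARD('n) = 1 + a\<^sup>2)"

lemma u_par_ex1:
  fixes x :: "real^'n::finite"
  assumes "x \<noteq> 0"
  shows "\<exists>!u. u \<ge> 0 \<and> (\<Sum>i\<in>UNIV. sqrt (1 + (x $ i)\<^sup>2 * u\<^sup>2)) / real CARD('n) = 1 + a\<^sup>2"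
proof -
  define f where "f = (\<lambda>u. (\<Sum>i\<in>UNIV. sqrt (1 + (x $ i)\<^sup>2 * u\<^sup>2)) / real CARD('n))"
  obtain j where j: "x $ j \<noteq> 0"
    using assms by (metis vec_eq_iff zero_index)
  have mono: "f u < f v" if "0 \<le> u" "u < v" for u v
  proof -
    have uv: "u\<^sup>2 < v\<^sup>2" using that by (simp add: power_strict_mono)
    have "(\<Sum>i\<in>UNIV. sqrt (1 + (x $ i)\<^sup>2 * u\<^sup>2)) < (\<Sum>i\<in>UNIV. sqrt (1 + (x $ i)\<^sup>2 * v\<^sup>2))"
    proof (rule sum_strict_mono_ex1)
      show "\<forall>i\<in>UNIV. sqrt (1 + (x $ i)\<^sup>2 * u\<^sup>2) \<le> sqrt (1 + (x $ i)\<^sup>2 * v\<^sup>2)"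
        using uv by (simp add: mult_left_mono)
      show "\<exists>i\<in>UNIV. sqrt (1 + (x $ i)\<^sup>2 * u\<^sup>2) < sqrt (1 + (x $ i)\<^sup>2 * v\<^sup>2)"
        using uv j by (intro bexI[of _ j]) simp_all
    qed simp
    then show ?thesis by (simp add: f_def divide_strict_right_mono)
  qed
  define b where "b = real CARD('n) * (1 + a\<^sup>2) / \<bar>x $ j\<bar>"
  have b0: "b \<ge> 0" by (simp add: b_def)
  have "real CARD('n) * (1 + a\<^sup>2) = sqrt ((x $ j)\<^sup>2 * b\<^sup>2)"
    using j by (simp add: b_def real_sqrt_mult)
  also have "\<dots> \<le> sqrt (1 + (x $ j)\<^sup>2 * b\<^sup>2)" by simp
  also have "\<dots> \<le> (\<Sum>i\<in>UNIV. sqrt (1 + (x $ i)\<^sup>2 * b\<^sup>2))"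
    by (rule member_le_sum) simp_all
  finally have fb: "1 + a\<^sup>2 \<le> f b"
    by (simp add: f_def field_simps)
  have "continuous_on {0..b} f"
    unfolding f_def by (intro continuous_intros) simp
  moreover have "f 0 \<le> 1 + a\<^sup>2" by (simp add: f_def)
  ultimately obtain u where u: "0 \<le> u" "f u = 1 + a\<^sup>2"
    using IVT'[of f 0 "1 + a\<^sup>2" b] fb b0 by blast
  have "v = u" if "v \<ge> 0" "f v = 1 + a\<^sup>2" for v
    using mono[of u v] mono[of v u] u that by (cases u v rule: linorder_cases) auto
  then show ?thesis
    using u unfolding f_def by blast
qed

text \<open>The norm \<open>|x|\<^sub>a\<close>, for \<open>a > 0\<close>.\<close>

definition aniso_norm :: "real \<Rightarrow> real^'n::finite \<Rightarrow> real" where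
  "aniso_norm a x =
     (if x = 0 then 0
      else (\<Sum>i\<in>UNIV. x $ i * arsinh (x $ i * u_par a x)) / mass CARD('n) a)"

text \<open>The modified Bessel function of the second kind of real order \<open>\<alpha>\<close> at a real argument \<open>z > 0\<close>,
  given by its classical integral, which for \<open>z > 0\<close> converges for every real \<open>\<alpha>\<close> (including the
  integer orders).\<close>

definition bessel_K :: "real \<Rightarrow> real \<Rightarrow> real" where
  "bessel_K \<alpha> z = (LINT t : {0..} | lborel. exp (- z * cosh t) * cosh (\<alpha> * t))"

definition green_one :: "real \<Rightarrow> real^'n::finite \<Rightarrow> real" where
  "green_one q x =
     (let d = real CARD('n) in
        2 * d powr q / (Gamma q * (2 * pi) powr (d / 2))
        * (sqrt (2 * d) / norm x) powr ((d - 2 * q) / 2)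
        * bessel_K ((d - 2 * q) / 2) (sqrt (2 * d) * norm x))"

text \<open>The continuum Green function for \<open>s \<ge> 0\<close> and \<open>x \<noteq> 0\<close>, where the case \<open>s = 0\<close> is meant for
  \<open>d > 2q\<close> only.\<close>

definition continuum_green :: "real \<Rightarrow> real \<Rightarrow> real^'n::finite \<Rightarrow> real" where
  "continuum_green s q x =
     (let d = real CARD('n) in
        if s = 0
        then d powr q * Gamma ((d - 2 * q) / 2) / (2 powr q * pi powr (d / 2) * Gamma q)
             * (1 / norm x powr (d - 2 * q))
        else s powr (d - 2 * q) * green_one q (s *\<^sub>R x))"

end

theory Submission
  imports Defs "HOL-Probability.Distributions" "HOL-Real_Asymp.Real_Asymp"
begin

text \<open>With \<open>g(\<nu>,t) = e\<^sup>-\<^sup>t I\<^sub>\<nu>(t)\<close>, the Gamma integral for the power and Tonelli give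
  \<open>C\<^sub>a(x) = d\<^sup>q / \<Gamma>(q) \<integral> t\<^sup>q\<^sup>-\<^sup>1 exp (- a\<^sup>2 d t) \<Prod>\<^sub>i g(x\<^sub>i,t) dt\<close>. Moving the contour in the integral for
  \<open>g\<close> through the saddle point gives \<open>g(\<nu>,t) \<approx> e\<^sup>\<psi> / sqrt (2 \<pi> w)\<close> with \<open>w = sqrt (\<nu>\<^sup>2 + t\<^sup>2)\<close> and
  \<open>\<psi> = w - t - \<nu> arsinh (\<nu> / t)\<close>, uniformly in \<open>\<nu> \<in> \<int>\<close> as \<open>w \<rightarrow> \<infinity>\<close>.
  The resulting phase is stationary at \<open>t = T = 1 / u\<^sub>a(x)\<close>, with value \<open>- m\<^sub>a |x|\<^sub>a\<close> there. In the
  variable \<open>t = T e\<^sup>y\<close> its increment lies, for every \<open>y\<close>, between \<open>- M (cosh y - 1)\<close> and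
  \<open>- M (e\<^sup>y - 1 - y)\<close>, where \<open>M\<close> is the curvature, so the Laplace method is a dominated convergence
  argument that needs only \<open>T \<rightarrow> \<infinity>\<close> and \<open>M \<rightarrow> \<infinity>\<close>; as \<open>T\<close> is at least of order \<open>n\<close> and \<open>M\<close> at least of order
  \<open>a\<^sub>n n\<close> for all nonzero lattice points simultaneously, part (i) holds uniformly. In part (ii) the
  substitution \<open>t = n\<^sup>2 r\<close> turns the integrand into the heat kernel integrand of the continuum Green
  function in the limit, again under domination.\<close>

section \<open>Debye asymptotics of scaled Bessel functions\<close>

text \<open>The obstacle is uniformity. The coordinates of \<open>n x\<close> may be zero, fixed or
  of any size compared with \<open>t\<close>, so no expansion at fixed order, or at a fixed ratio of
  order and argument, covers all factors. The contour through the saddle gives an exact identity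
  whose correction factor depends on the order only through \<open>w\<close> and a phase controlled
  by \<open>|\<nu>| \<le> w\<close>; divergence of \<open>w\<close> alone sends it to 1, and it is
  always bounded by 3. The Laplace limit is therefore proved along arbitrary sequences of parameters
  and points, and uniformity over the lattice follows by contradiction along a bad sequence. The
  prefactors are homogeneous in \<open>x\<close>, so the Ornstein-Zernike constant can be the exact
  normalised saddle prefactor: the claimed leading term then equals the saddle value identically,
  and only a normalised integral remains to be estimated. In part (ii) no single point dominates the
  integral. There the obstacle is small \<open>r\<close>, where each factor is only of order
  \<open>r powr (-1/2)\<close> uniformly in \<open>n\<close>; one nonzero coordinate has to supply a
  compensating power of \<open>r\<close>.\<close>

definition scaled_bessel_I :: "real \<Rightarrow> real \<Rightarrow> real" where
  "scaled_bessel_I \<nu> t = (LINT \<theta>:{-pi..pi}|lborel. exp (- t * (1 - cos \<theta>)) * cos (\<nu> * \<theta>)) / (2 * pi)"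

definition debye_radius :: "real \<Rightarrow> real \<Rightarrow> real" where
  "debye_radius \<nu> t = sqrt (\<nu>\<^sup>2 + t\<^sup>2)"

definition debye_exponent :: "real \<Rightarrow> real \<Rightarrow> real" where
  "debye_exponent \<nu> t = debye_radius \<nu> t - t - \<nu> * arsinh (\<nu> / t)"

text \<open>For integer order, the quotient of \<open>scaled_bessel_I\<close> by its Debye leading
  term, written as an integral along the shifted contour; the factor
  \<open>sqrt (w / (2 pi))\<close> makes its limit 1.\<close>

definition debye_ratio :: "real \<Rightarrow> real \<Rightarrow> real" where
  "debye_ratio \<nu> t = sqrt (debye_radius \<nu> t / (2 * pi)) *
     (LINT \<theta>:{-pi..pi}|lborel. exp (- debye_radius \<nu> t * (1 - cos \<theta>)) * cos (\<nu> * (\<theta> - sin \<theta>)))"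

text \<open>Differentiating under the integral in the height \<open>s\<close> produces
  \<open>\<i>\<close> times the \<open>\<theta>\<close>-derivative of \<open>g\<close>; its integral
  is a difference of endpoint values, which is zero by \<open>per\<close>.\<close>

lemma periodic_contour_shift:
  fixes g :: "complex \<Rightarrow> complex" and s0 s1 :: real
  assumes deriv: "\<And>z. (g has_field_derivative g' z) (at z)"
    and cont: "continuous_on UNIV g'"
    and per: "\<And>s::real. g (of_real pi + \<i> * of_real s) = g (- of_real pi + \<i> * of_real s)"
  shows "integral {-pi..pi} (\<lambda>\<theta>. g (of_real \<theta> + \<i> * of_real s0))
       = integral {-pi..pi} (\<lambda>\<theta>. g (of_real \<theta> + \<i> * of_real s1))"
proof -
  define F where "F = (\<lambda>s::real. integral (cbox (-pi) pi) (\<lambda>\<theta>. g (of_real \<theta> + \<i> * of_real s)))"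
  have contg: "continuous_on S g" for S
    using deriv by (meson DERIV_continuous continuous_at_imp_continuous_on)
  have "(F has_vector_derivative 0) (at s)" for s
  proof -
    have "(F has_vector_derivative
        integral (cbox (-pi) pi) (\<lambda>\<theta>. g' (of_real \<theta> + \<i> * of_real s) * \<i>)) (at s within UNIV)"
      unfolding F_def
    proof (rule leibniz_rule_vector_derivative)
      fix s \<theta> :: real
      have "((\<lambda>s. of_real \<theta> + \<i> * of_real s) has_vector_derivative \<i>) (at s)"
        by (auto intro!: derivative_eq_intros simp: has_vector_derivative_def scaleR_conv_of_real)
      from field_vector_diff_chain_at[OF this deriv]
      show "((\<lambda>s. g (of_real \<theta> + \<i> * of_real s)) has_vector_derivative
          g' (of_real \<theta> + \<i> * of_real s) * \<i>) (at s within UNIV)"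
        by (simp add: o_def mult.commute)
    next
      show "(\<lambda>\<theta>. g (of_real \<theta> + \<i> * of_real s)) integrable_on cbox (- pi) pi" for s :: real
        by (intro integrable_continuous continuous_on_compose2[OF contg[of UNIV]] continuous_intros) auto
      show "continuous_on (UNIV \<times> cbox (- pi) pi)
          (\<lambda>(x, t). g' (of_real t + \<i> * of_real x) * \<i>)"
        unfolding case_prod_unfold
        by (intro continuous_intros continuous_on_compose2[OF cont]) auto
    qed auto
    moreover have "((\<lambda>\<theta>. g' (of_real \<theta> + \<i> * of_real s)) has_integral
        g (of_real pi + \<i> * of_real s) - g (of_real (-pi) + \<i> * of_real s)) {-pi..pi}"
    proof (rule fundamental_theorem_of_calculus)
      fix \<theta> :: real
      have "((\<lambda>\<theta>. of_real \<theta> + \<i> * of_real s) has_vector_derivative 1) (at \<theta>)"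
        by (auto intro!: derivative_eq_intros simp: has_vector_derivative_def scaleR_conv_of_real)
      from field_vector_diff_chain_at[OF this deriv]
      show "((\<lambda>\<theta>. g (of_real \<theta> + \<i> * of_real s)) has_vector_derivative
          g' (of_real \<theta> + \<i> * of_real s)) (at \<theta> within {-pi..pi})"
        by (simp add: o_def has_vector_derivative_at_within)
    qed simp
    then have "integral {-pi..pi} (\<lambda>\<theta>. g' (of_real \<theta> + \<i> * of_real s)) = 0"
      by (simp add: per integral_unique)
    ultimately show ?thesis by simp
  qed
  then have "F s0 = F s1"
    by (metis has_vector_derivative_zero_constant[of UNIV F] has_vector_derivative_at_within convex_UNIV UNIV_I)
  then show ?thesis by (simp add: F_def)
qed

lemma set_lebesgue_integral_Icc_eq_integral:
  fixes f :: "real \<Rightarrow> real"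
  assumes "continuous_on {a..b} f"
  shows "(LINT x:{a..b}|lborel. f x) = integral {a..b} f"
  by (rule set_borel_integral_eq_integral(2)[OF borel_integrable_atLeastAtMost'[OF assms]])

text \<open>The contour of integration is moved to height \<open>s = arsinh (\<nu> / t)\<close>, through the saddle point of
  \<open>t cos z + i \<nu> z\<close>.\<close>

lemma scaled_bessel_I_saddle:
  assumes \<nu>: "\<nu> \<in> \<int>" and t: "t > 0"
  shows "scaled_bessel_I \<nu> t = exp (debye_exponent \<nu> t) *
     (LINT \<theta>:{-pi..pi}|lborel. exp (- debye_radius \<nu> t * (1 - cos \<theta>)) * cos (\<nu> * (\<theta> - sin \<theta>))) / (2 * pi)"
proof -
  define w where "w = debye_radius \<nu> t"
  define s where "s = arsinh (\<nu> / t)"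
  define g :: "complex \<Rightarrow> complex" where "g = (\<lambda>z. exp (of_real t * cos z + \<i> * of_real \<nu> * z))"
  define g' where "g' = (\<lambda>z. g z * (- of_real t * sin z + \<i> * of_real \<nu>))"
  have shift: "integral {-pi..pi} (\<lambda>\<theta>. g (of_real \<theta> + \<i> * of_real 0))
       = integral {-pi..pi} (\<lambda>\<theta>. g (of_real \<theta> + \<i> * of_real s))"
  proof (rule periodic_contour_shift[where g' = g'])
    show "(g has_field_derivative g' z) (at z)" for z
      unfolding g_def g'_def by (auto intro!: derivative_eq_intros)
    show "continuous_on UNIV g'"
      unfolding g_def g'_def by (intro continuous_intros)
    show "g (of_real pi + \<i> * of_real s) = g (- of_real pi + \<i> * of_real s)" for s :: real
    proof -
      \<comment> \<open>Integrality of the order enters here: a shift by \<open>2 pi\<close>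
        multiplies \<open>exp (\<i> \<nu> z)\<close> by
        \<open>exp (2 pi \<i> \<nu>) = 1\<close>.\<close>
      obtain k :: int where k: "\<nu> = of_int k" using \<nu> by (auto elim: Ints_cases)
      have "\<i> * of_real \<nu> * (of_real pi + \<i> * of_real s)
          = \<i> * of_real \<nu> * (- of_real pi + \<i> * of_real s) + of_int k * (of_real (2 * pi) * \<i>)"
        by (simp add: k algebra_simps)
      moreover have "cos (of_real pi + \<i> * of_real s) = cos (- of_real pi + \<i> * of_real s)"
        by (simp add: cos_add cos_diff)
      moreover have "exp (of_int k * (of_real (2 * pi) * \<i>)) = (1::complex)"
        using exp_integer_2pi[of "of_int k"] by (simp add: algebra_simps)
      ultimately show ?thesis
        by (simp only: g_def exp_add mult_1_right)
    qed
  qed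
  \<comment> \<open>With \<open>t cosh s = w\<close> and \<open>t sinh s = \<nu>\<close> the
    exponent at height \<open>s\<close> has real part \<open>w cos \<theta> - \<nu> s\<close> and
    imaginary part \<open>\<nu> (\<theta> - sin \<theta>)\<close>, which is only cubic at the
    saddle.\<close>
  have ch: "t * cosh s = w"
    using t by (simp add: s_def w_def debye_radius_def cosh_arsinh_real power_divide
        real_sqrt_divide add_divide_distrib[symmetric] field_simps)
  have sh: "t * sinh s = \<nu>" using t by (simp add: s_def)
  have Re0: "Re (g (of_real \<theta>)) = exp (t * cos \<theta>) * cos (\<nu> * \<theta>)" for \<theta> :: real
    by (simp add: g_def Re_exp Re_cos Im_cos)
  have Re1: "Re (g (of_real \<theta> + \<i> * of_real s)) = exp (w * cos \<theta> - \<nu> * s) * cos (\<nu> * (\<theta> - sin \<theta>))" for \<theta> :: real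
  proof -
    have "cos (of_real \<theta> + \<i> * of_real s) = of_real (cos \<theta> * cosh s) - \<i> * of_real (sin \<theta> * sinh s)"
      by (simp add: complex_eq_iff Re_cos Im_cos cosh_def sinh_def field_simps)
    then have "of_real t * cos (of_real \<theta> + \<i> * of_real s) + \<i> * of_real \<nu> * (of_real \<theta> + \<i> * of_real s)
      = Complex (cos \<theta> * (t * cosh s) - \<nu> * s) (\<nu> * \<theta> - (t * sinh s) * sin \<theta>)"
      by (simp add: complex_eq_iff algebra_simps)
    then show ?thesis
      unfolding ch sh by (simp only: g_def Re_exp complex.sel) (simp add: algebra_simps)
  qed
  have contg: "continuous_on S g" for S unfolding g_def by (intro continuous_intros)
  have int: "(\<lambda>\<theta>. g (of_real \<theta> + \<i> * of_real s)) integrable_on {-pi..pi}" for s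
    by (intro integrable_continuous_real continuous_on_compose2[OF contg[of UNIV]] continuous_intros) auto
  have ReI: "Re (integral {-pi..pi} (\<lambda>\<theta>. g (of_real \<theta> + \<i> * of_real s)))
      = integral {-pi..pi} (\<lambda>\<theta>. Re (g (of_real \<theta> + \<i> * of_real s)))" for s
    using integral_linear[OF int bounded_linear_Re] by (simp add: o_def)
  have main: "integral {-pi..pi} (\<lambda>\<theta>. exp (t * cos \<theta>) * cos (\<nu> * \<theta>))
     = integral {-pi..pi} (\<lambda>\<theta>. exp (w * cos \<theta> - \<nu> * s) * cos (\<nu> * (\<theta> - sin \<theta>)))"
    using arg_cong[OF shift, of Re] unfolding ReI by (simp add: Re0 Re1)
  have "(LINT \<theta>:{-pi..pi}|lborel. exp (- t * (1 - cos \<theta>)) * cos (\<nu> * \<theta>))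
      = integral {-pi..pi} (\<lambda>\<theta>. exp (- t * (1 - cos \<theta>)) * cos (\<nu> * \<theta>))"
    by (intro set_lebesgue_integral_Icc_eq_integral continuous_intros)
  also have "\<dots> = integral {-pi..pi} (\<lambda>\<theta>. exp (-t) * (exp (t * cos \<theta>) * cos (\<nu> * \<theta>)))"
    by (simp add: mult.assoc[symmetric] exp_add[symmetric]) (simp add: algebra_simps)
  also have "\<dots> = exp (-t) * integral {-pi..pi} (\<lambda>\<theta>. exp (w * cos \<theta> - \<nu> * s) * cos (\<nu> * (\<theta> - sin \<theta>)))"
    by (simp only: integral_mult_right main)
  also have "\<dots> = integral {-pi..pi} (\<lambda>\<theta>. exp (-t) * (exp (w * cos \<theta> - \<nu> * s) * cos (\<nu> * (\<theta> - sin \<theta>))))"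
    by (simp only: integral_mult_right)
  also have "\<dots> = integral {-pi..pi} (\<lambda>\<theta>. exp (w - t - \<nu> * s) * (exp (- w * (1 - cos \<theta>)) * cos (\<nu> * (\<theta> - sin \<theta>))))"
    by (simp add: mult.assoc[symmetric] exp_add[symmetric]) (simp add: algebra_simps)
  also have "\<dots> = exp (debye_exponent \<nu> t) * integral {-pi..pi} (\<lambda>\<theta>. exp (- w * (1 - cos \<theta>)) * cos (\<nu> * (\<theta> - sin \<theta>)))"
    by (simp add: debye_exponent_def w_def s_def)
  also have "integral {-pi..pi} (\<lambda>\<theta>. exp (- w * (1 - cos \<theta>)) * cos (\<nu> * (\<theta> - sin \<theta>)))
     = (LINT \<theta>:{-pi..pi}|lborel. exp (- w * (1 - cos \<theta>)) * cos (\<nu> * (\<theta> - sin \<theta>)))"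
    by (intro set_lebesgue_integral_Icc_eq_integral[symmetric] continuous_intros)
  finally show ?thesis by (simp add: scaled_bessel_I_def w_def)
qed

lemma debye_radius_pos: "t > 0 \<Longrightarrow> debye_radius \<nu> t > 0"
  by (simp add: debye_radius_def add_nonneg_pos)

lemma scaled_bessel_I_eq_debye:
  assumes "\<nu> \<in> \<int>" "t > 0"
  shows "scaled_bessel_I \<nu> t =
    debye_ratio \<nu> t * exp (debye_exponent \<nu> t) / sqrt (2 * pi * debye_radius \<nu> t)"
proof -
  have *: "sqrt (r / (2 * pi)) / sqrt (2 * pi * r) = 1 / (2 * pi)" if "r > 0" for r
  proof -
    have "sqrt (2 * pi * r) = 2 * pi * sqrt (r / (2 * pi))"
      using that by (intro real_sqrt_unique) (auto simp: power_mult_distrib power2_eq_square)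
    with that show ?thesis by simp
  qed
  show ?thesis
    unfolding scaled_bessel_I_saddle[OF assms] debye_ratio_def
    using *[OF debye_radius_pos[OF assms(2), of \<nu>]]
    by (simp add: field_simps)
qed

section \<open>Gaussian domination and the uniform limit of the correction factor\<close>

lemma one_minus_cos_lower:
  assumes "\<bar>x\<bar> \<le> pi"
  shows "x\<^sup>2 / 18 \<le> 1 - cos x"
proof -
  \<comment> \<open>\<open>sin y \<ge> y - y^3 / 6\<close> and \<open>y \<le> 2\<close> give the
    slope 1/3; then \<open>1 - cos x = 2 (sin (x / 2))^2\<close> gives
    \<open>2 (x / 6)^2 = x^2 / 18\<close>. In \<open>debye_ratio_le\<close> this becomes the bound
    \<open>sqrt (18 pi) / sqrt (2 pi) = 3\<close>.\<close>
  have sin_lower: "y / 3 \<le> sin y" if "0 \<le> y" "y \<le> pi / 2" for y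
  proof -
    have y2: "y \<le> 2" using that pi_half_less_two by linarith
    have "\<bar>sin y - (\<Sum>m<3. sin_coeff m * y ^ m)\<bar> \<le> inverse (fact 3) * \<bar>y\<bar> ^ 3"
      by (rule Maclaurin_sin_bound)
    then have "\<bar>sin y - y\<bar> \<le> y ^ 3 / 6"
      using that by (simp add: eval_nat_numeral sin_coeff_def field_simps)
    moreover have "y ^ 3 \<le> 4 * y"
    proof -
      have "y * (y * y) \<le> y * (2 * 2)" using that y2 by (intro mult_left_mono mult_mono) auto
      then show ?thesis by (simp add: eval_nat_numeral)
    qed
    ultimately show ?thesis by linarith
  qed
  define y where "y = \<bar>x\<bar> / 2"
  have "y / 3 \<le> sin y" using assms by (intro sin_lower) (auto simp: y_def)
  then have "(y / 3)\<^sup>2 \<le> (sin y)\<^sup>2" by (intro power_mono) (auto simp: y_def)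
  moreover have "cos x = 1 - 2 * (sin y)\<^sup>2"
    using cos_double_sin[of y] by (simp add: y_def)
  ultimately show ?thesis by (simp add: y_def power2_eq_square)
qed

lemma gauss_has_bochner_integral:
  assumes "c > 0"
  shows "has_bochner_integral lborel (\<lambda>x::real. exp (- (x\<^sup>2 / c))) (sqrt (c * pi))"
proof -
  have "has_bochner_integral lborel (normal_density 0 (sqrt (c / 2))) 1"
    using assms by (simp add: has_bochner_integral_iff)
  from has_bochner_integral_mult_right[OF this, of "sqrt (c * pi)"]
  show ?thesis using assms by (simp add: normal_density_def mult.commute)
qed

text \<open>Stretching the angle by \<open>sqrt w\<close> brings the concentration at the saddle to
  unit scale, where one majorant serves all parameters.\<close>

lemma debye_ratio_rescaled:
  fixes \<nu> t :: real
  assumes t: "t > 0"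
  defines "w \<equiv> debye_radius \<nu> t"
  shows "debye_ratio \<nu> t = (LINT \<phi>|lborel. indicator {-pi..pi} (\<phi> / sqrt w) *
     (exp (- w * (1 - cos (\<phi> / sqrt w))) * cos (\<nu> * (\<phi> / sqrt w - sin (\<phi> / sqrt w))))) / sqrt (2 * pi)"
proof -
  have w: "w > 0" using t by (simp add: w_def debye_radius_pos)
  let ?f = "\<lambda>\<theta>. indicator {-pi..pi} \<theta> * (exp (- w * (1 - cos \<theta>)) * cos (\<nu> * (\<theta> - sin \<theta>)))"
  have "(LINT \<theta>|lborel. ?f \<theta>) = \<bar>1 / sqrt w\<bar> *\<^sub>R (LINT \<phi>|lborel. ?f (0 + (1 / sqrt w) * \<phi>))"
    by (rule lborel_integral_real_affine) (use w in simp)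
  then have "sqrt w * (LINT \<theta>|lborel. ?f \<theta>) = (LINT \<phi>|lborel. ?f (\<phi> / sqrt w))"
    using w by (simp add: field_simps)
  then show ?thesis
    by (simp add: debye_ratio_def set_lebesgue_integral_def real_sqrt_divide real_sqrt_mult w_def[symmetric] field_simps)
qed

text \<open>The oscillating factor is bounded by 1, so the majorant is the same for all orders and
  all \<open>w\<close>.\<close>

lemma debye_integrand_bound:
  assumes "w > 0"
  shows "norm (indicator {-pi..pi} (\<phi> / sqrt w) *
     (exp (- w * (1 - cos (\<phi> / sqrt w))) * cos c)) \<le> exp (- (\<phi>\<^sup>2 / 18))"
proof (cases "\<phi> / sqrt w \<in> {-pi..pi}")
  case True
  have "w * ((\<phi> / sqrt w)\<^sup>2 / 18) \<le> w * (1 - cos (\<phi> / sqrt w))"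
    using True assms by (intro mult_left_mono one_minus_cos_lower) auto
  then have "- w * (1 - cos (\<phi> / sqrt w)) \<le> - (\<phi>\<^sup>2 / 18)"
    using assms by (simp add: power_divide)
  then have "exp (- w * (1 - cos (\<phi> / sqrt w))) * \<bar>cos c\<bar> \<le> exp (- (\<phi>\<^sup>2 / 18)) * 1"
    by (intro mult_mono) auto
  then show ?thesis using True by (simp add: abs_mult)
qed simp

lemma debye_ratio_le:
  assumes t: "t > 0"
  shows "\<bar>debye_ratio \<nu> t\<bar> \<le> 3"
proof -
  define w where "w = debye_radius \<nu> t"
  have w: "w > 0" using t by (simp add: w_def debye_radius_pos)
  have g: "has_bochner_integral lborel (\<lambda>x::real. exp (- (x\<^sup>2 / 18))) (sqrt (18 * pi))"
    by (rule gauss_has_bochner_integral) simp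
  have "\<bar>LINT \<phi>|lborel. indicator {-pi..pi} (\<phi> / sqrt w) *
     (exp (- w * (1 - cos (\<phi> / sqrt w))) * cos (\<nu> * (\<phi> / sqrt w - sin (\<phi> / sqrt w))))\<bar>
     \<le> (LINT \<phi>|lborel. exp (- (\<phi>\<^sup>2 / 18)))"
    (is "\<bar>integral\<^sup>L _ ?f\<bar> \<le> _")
  proof -
    have "norm (integral\<^sup>L lborel ?f) \<le> integral\<^sup>L lborel (\<lambda>x. norm (?f x))"
      by (rule integral_norm_bound)
    also have "\<dots> \<le> (LINT \<phi>|lborel. exp (- (\<phi>\<^sup>2 / 18)))"
    proof (rule integral_mono')
      show "integrable lborel (\<lambda>x::real. exp (- (x\<^sup>2 / 18)))"
        using g by (simp add: has_bochner_integral_iff)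
    qed (use debye_integrand_bound[OF w] in auto)
    finally show ?thesis by simp
  qed
  also have "\<dots> = sqrt (18 * pi)" using g by (rule has_bochner_integral_integral_eq)
  also have "\<dots> = 3 * sqrt (2 * pi)"
    using real_sqrt_mult[of 9 "2 * pi"] by simp
  finally show ?thesis
    unfolding debye_ratio_rescaled[OF t] w_def[symmetric] by (simp add: field_simps abs_divide)
qed

text \<open>Order and argument may vary in any proportion: \<open>|\<nu>| \<le> w\<close>, and
  \<open>w (\<phi> / sqrt w - sin (\<phi> / sqrt w))\<close> is of order
  \<open>\<phi>^3 / sqrt w\<close>, so the phase dies out as soon as \<open>w\<close>
  diverges.\<close>

lemma debye_ratio_tendsto:
  fixes \<nu> t :: "nat \<Rightarrow> real"
  assumes t: "\<And>k. t k > 0"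
    and lim: "filterlim (\<lambda>k. debye_radius (\<nu> k) (t k)) at_top sequentially"
  shows "(\<lambda>k. debye_ratio (\<nu> k) (t k)) \<longlonglongrightarrow> 1"
proof -
  define w where "w = (\<lambda>k. debye_radius (\<nu> k) (t k))"
  have w: "w k > 0" for k using t by (simp add: w_def debye_radius_pos)
  have limw: "filterlim w at_top sequentially" using lim by (simp add: w_def)
  have nu: "\<bar>\<nu> k\<bar> \<le> w k" for k
    unfolding w_def debye_radius_def by (rule real_le_rsqrt) simp
  have g2: "has_bochner_integral lborel (\<lambda>x::real. exp (- (x\<^sup>2 / 2))) (sqrt (2 * pi))"
    by (rule gauss_has_bochner_integral) simp
  have g18: "has_bochner_integral lborel (\<lambda>x::real. exp (- (x\<^sup>2 / 18))) (sqrt (18 * pi))"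
    by (rule gauss_has_bochner_integral) simp
  have "(\<lambda>k. LINT \<phi>|lborel. indicator {-pi..pi} (\<phi> / sqrt (w k)) *
     (exp (- w k * (1 - cos (\<phi> / sqrt (w k)))) * cos (\<nu> k * (\<phi> / sqrt (w k) - sin (\<phi> / sqrt (w k))))))
     \<longlonglongrightarrow> (LINT \<phi>|lborel. exp (- (\<phi>\<^sup>2 / 2)))"
  proof (rule integral_dominated_convergence)
    show "integrable lborel (\<lambda>x::real. exp (- (x\<^sup>2 / 18)))"
      using g18 by (simp add: has_bochner_integral_iff)
    show "AE \<phi> in lborel. norm (indicator {-pi..pi} (\<phi> / sqrt (w k)) *
     (exp (- w k * (1 - cos (\<phi> / sqrt (w k)))) * cos (\<nu> k * (\<phi> / sqrt (w k) - sin (\<phi> / sqrt (w k))))))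
     \<le> exp (- (\<phi>\<^sup>2 / 18))" for k
      using debye_integrand_bound[OF w] by auto
    show "AE \<phi> in lborel. (\<lambda>k. indicator {-pi..pi} (\<phi> / sqrt (w k)) *
     (exp (- w k * (1 - cos (\<phi> / sqrt (w k)))) * cos (\<nu> k * (\<phi> / sqrt (w k) - sin (\<phi> / sqrt (w k))))))
     \<longlonglongrightarrow> exp (- (\<phi>\<^sup>2 / 2))"
    proof (rule AE_I2)
      fix \<phi> :: real
      have "((\<lambda>m. \<phi> / sqrt m) \<longlongrightarrow> 0) at_top" by real_asymp
      then have "\<forall>\<^sub>F m in at_top. \<phi> / sqrt m \<in> {-pi<..<pi}"
        by (rule topological_tendstoD) auto
      then have "\<forall>\<^sub>F m in at_top. indicator {-pi..pi} (\<phi> / sqrt m) = (1::real)"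
        by eventually_elim auto
      then have ind: "(\<lambda>k. indicator {-pi..pi} (\<phi> / sqrt (w k)) :: real) \<longlonglongrightarrow> 1"
        using limw by (intro tendsto_eventually) (rule eventually_compose_filterlim)
      have "((\<lambda>m::real. m * (1 - cos (\<phi> / sqrt m))) \<longlongrightarrow> \<phi> * \<phi> / 2) at_top" by real_asymp
      from filterlim_compose[OF this limw]
      have c: "(\<lambda>k. w k * (1 - cos (\<phi> / sqrt (w k)))) \<longlonglongrightarrow> \<phi> * \<phi> / 2" .
      have "((\<lambda>m::real. m * (\<phi> / sqrt m - sin (\<phi> / sqrt m))) \<longlongrightarrow> 0) at_top" by real_asymp
      from filterlim_compose[OF this limw]
      have s0: "(\<lambda>k. w k * (\<phi> / sqrt (w k) - sin (\<phi> / sqrt (w k)))) \<longlonglongrightarrow> 0" .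
      have s: "(\<lambda>k. \<nu> k * (\<phi> / sqrt (w k) - sin (\<phi> / sqrt (w k)))) \<longlonglongrightarrow> 0"
      proof (rule Lim_null_comparison[OF _ tendsto_rabs_zero[OF s0]], rule always_eventually, rule allI)
        fix k
        have "w k > 0" by (rule w)
        with nu[of k] show "norm (\<nu> k * (\<phi> / sqrt (w k) - sin (\<phi> / sqrt (w k))))
          \<le> \<bar>w k * (\<phi> / sqrt (w k) - sin (\<phi> / sqrt (w k)))\<bar>"
          unfolding abs_mult real_norm_def by (intro mult_right_mono) auto
      qed
      have "(\<lambda>k. indicator {-pi..pi} (\<phi> / sqrt (w k)) *
     (exp (- (w k * (1 - cos (\<phi> / sqrt (w k))))) * cos (\<nu> k * (\<phi> / sqrt (w k) - sin (\<phi> / sqrt (w k))))))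
     \<longlonglongrightarrow> 1 * (exp (- (\<phi> * \<phi> / 2)) * cos 0)"
        by (intro tendsto_intros ind c s)
      then show "(\<lambda>k. indicator {-pi..pi} (\<phi> / sqrt (w k)) *
     (exp (- w k * (1 - cos (\<phi> / sqrt (w k)))) * cos (\<nu> k * (\<phi> / sqrt (w k) - sin (\<phi> / sqrt (w k))))))
     \<longlonglongrightarrow> exp (- (\<phi>\<^sup>2 / 2))"
        by (simp add: power2_eq_square)
    qed
  qed measurable
  also have "(LINT \<phi>|lborel. exp (- (\<phi>\<^sup>2 / 2))) = sqrt (2 * pi)"
    using g2 by (rule has_bochner_integral_integral_eq)
  finally have "(\<lambda>k. (LINT \<phi>|lborel. indicator {-pi..pi} (\<phi> / sqrt (w k)) *
     (exp (- w k * (1 - cos (\<phi> / sqrt (w k)))) * cos (\<nu> k * (\<phi> / sqrt (w k) - sin (\<phi> / sqrt (w k))))))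
     / sqrt (2 * pi)) \<longlonglongrightarrow> sqrt (2 * pi) / sqrt (2 * pi)"
    by (intro tendsto_divide tendsto_const) auto
  then show ?thesis
    by (simp add: debye_ratio_rescaled[OF t] w_def)
qed

lemma scaled_bessel_I_bound:
  assumes "\<nu> \<in> \<int>" "t > 0"
  shows "\<bar>scaled_bessel_I \<nu> t\<bar> \<le> 3 * exp (debye_exponent \<nu> t) / sqrt (2 * pi * debye_radius \<nu> t)"
  unfolding scaled_bessel_I_eq_debye[OF assms] abs_mult abs_divide
  using debye_radius_pos[OF assms(2), of \<nu>] debye_ratio_le[OF assms(2), of \<nu>]
  by (simp add: divide_right_mono mult_right_mono)

section \<open>The exponential substitution and the exponent along
  \<open>t = T exp y\<close>\<close>

lemma exp_substitution:
  fixes f :: "real \<Rightarrow> real"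
  assumes [measurable]: "f \<in> borel_measurable borel"
  shows "set_integrable lborel {0<..} f \<longleftrightarrow> integrable lborel (\<lambda>y. exp y * f (exp y))" (is ?A)
    and "(LINT t:{0<..}|lborel. f t) = (LINT y|lborel. exp y * f (exp y))" (is ?B)
proof -
  have ran: "range exp = {(0::real)<..}"
    by (auto simp: image_iff) (metis exp_ln)
  have abs: "g absolutely_integrable_on S \<longleftrightarrow> set_integrable lborel S g"
    if "g \<in> borel_measurable borel" "S \<in> sets borel" for g :: "real \<Rightarrow> real" and S
    using that unfolding set_integrable_def by (subst integrable_completion) auto
  have "(f absolutely_integrable_on range exp \<longleftrightarrow> (\<lambda>x. \<bar>exp x\<bar> *\<^sub>R f (exp x)) absolutely_integrable_on UNIV)"
    by (rule absolutely_integrable_change_of_variables_real) (auto intro!: derivative_eq_intros simp: inj_on_def)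
  then show A: ?A
    by (simp add: ran abs) (simp add: set_integrable_def)
  show ?B
  proof (cases "set_integrable lborel {0<..} f")
    case True
    have "(\<lambda>x. \<bar>exp x\<bar> * f (exp x)) absolutely_integrable_on UNIV \<and>
           integral UNIV (\<lambda>x. \<bar>exp x\<bar> * f (exp x)) = integral {0<..} f
       \<longleftrightarrow> f absolutely_integrable_on (range exp) \<and> integral (range exp) f = integral {0<..} f"
      by (rule has_absolute_integral_change_of_variables_1') (auto intro!: derivative_eq_intros simp: inj_on_def)
    then have "integral UNIV (\<lambda>x. exp x * f (exp x)) = integral {0<..} f"
      using True by (simp add: ran abs)
    moreover have "set_integrable lborel UNIV (\<lambda>x. exp x * f (exp x))"
      using True A by (simp add: set_integrable_def)
    from set_borel_integral_eq_integral(2)[OF this]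
    have "(LINT y|lborel. exp y * f (exp y)) = integral UNIV (\<lambda>x. exp x * f (exp x))"
      by (simp add: set_lebesgue_integral_def)
    ultimately show ?thesis
      using set_borel_integral_eq_integral(2)[OF True] by simp
  next
    case False
    \<comment> \<open>By the first claim neither side is integrable here, so both integrals have the
      default value 0.\<close>
    with A show ?thesis
      by (simp add: not_integrable_integral_eq set_lebesgue_integral_def set_integrable_def)
  qed
qed

text \<open>Since \<open>t / w + \<nu>^2 / (t w) = w / t\<close>, the order enters the derivative
  only through \<open>w\<close>; this makes the saddle equation the defining equation of
  \<open>u_par\<close>.\<close>

lemma debye_exponent_has_derivative:
  assumes t: "t > 0"
  shows "((\<lambda>t. debye_exponent \<nu> t) has_real_derivative debye_radius \<nu> t / t - 1) (at t)"
proof -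
  define w where "w = sqrt (\<nu>\<^sup>2 + t\<^sup>2)"
  have p: "\<nu>\<^sup>2 + t\<^sup>2 > 0" using t by (simp add: add_nonneg_pos)
  have w: "w > 0" "w\<^sup>2 = \<nu>\<^sup>2 + t\<^sup>2" using p by (auto simp: w_def)
  have "sqrt ((\<nu> / t)\<^sup>2 + 1) = w / t"
    using t by (simp add: w_def power_divide real_sqrt_divide field_simps)
  moreover have "((\<lambda>t. \<nu> / t) has_real_derivative - \<nu> / t\<^sup>2) (at t)"
    using t by (auto intro!: derivative_eq_intros simp: power2_eq_square)
  from DERIV_chain2[OF arsinh_real_has_field_derivative this]
  have "((\<lambda>t. arsinh (\<nu> / t)) has_real_derivative 1 / sqrt ((\<nu> / t)\<^sup>2 + 1) * (- \<nu> / t\<^sup>2)) (at t)" .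
  moreover have "((\<lambda>t. sqrt (\<nu>\<^sup>2 + t\<^sup>2)) has_real_derivative t / w) (at t)"
    using p by (auto intro!: derivative_eq_intros simp: w_def field_simps)
  ultimately have "((\<lambda>t. debye_exponent \<nu> t) has_real_derivative
      (t / w - 1 - \<nu> * (1 / (w / t) * (- \<nu> / t\<^sup>2)))) (at t)"
    unfolding debye_exponent_def debye_radius_def
    by (intro DERIV_diff DERIV_cmult DERIV_ident) simp_all
  moreover have "t / w - 1 - \<nu> * (1 / (w / t) * (- \<nu> / t\<^sup>2)) = (\<nu>\<^sup>2 + t\<^sup>2) / (t * w) - 1"
    using t w(1) by (simp add: divide_simps power2_eq_square) (simp add: algebra_simps)
  then have "t / w - 1 - \<nu> * (1 / (w / t) * (- \<nu> / t\<^sup>2)) = w / t - 1"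
    using t w(1) unfolding w(2)[symmetric] by (simp add: power2_eq_square)
  ultimately have "((\<lambda>t. debye_exponent \<nu> t) has_real_derivative w / t - 1) (at t)"
    by (simp only:)
  then show ?thesis by (simp add: debye_radius_def w_def)
qed

text \<open>With \<open>E = exp y\<close>, the square of \<open>debye_radius x (T E) * w\<close> is
  \<open>(x^2 + T^2 E^2) (x^2 + T^2)\<close>. Cauchy-Schwarz bounds it below by
  \<open>(T^2 E + x^2)^2\<close>; and since \<open>2 E cosh y = E^2 + 1\<close>, the square
  \<open>(T^2 E + x^2 cosh y)^2\<close> exceeds it by \<open>x^4 ((cosh y)^2 - 1)\<close>. The two
  bounds agree to first order in \<open>y\<close>.\<close>

lemma debye_radius_exp_bounds:
  fixes x T y :: real
  assumes T: "T > 0"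
  defines "w \<equiv> debye_radius x T"
  shows "debye_radius x (T * exp y) \<le> exp y * w - x\<^sup>2 / w * sinh y"
    and "exp y * w + x\<^sup>2 / w * (1 - exp y) \<le> debye_radius x (T * exp y)"
proof -
  have w: "w > 0" "w\<^sup>2 = x\<^sup>2 + T\<^sup>2"
    using T by (simp_all add: w_def debye_radius_pos) (simp add: debye_radius_def)
  define E where "E = exp y"
  have E: "E > 0" by (simp add: E_def)
  define C where "C = cosh y"
  have C: "C \<ge> 1" by (simp add: C_def cosh_real_ge_1)
  have EC: "2 * E * C = E\<^sup>2 + 1"
    by (simp add: E_def C_def cosh_def field_simps power2_eq_square exp_minus)
  have Esinh: "E - sinh y = C"
    by (simp add: E_def C_def cosh_plus_sinh[symmetric])
  have r2: "(debye_radius x (T * E))\<^sup>2 = x\<^sup>2 + T\<^sup>2 * E\<^sup>2"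
    by (simp add: debye_radius_def power_mult_distrib)
  have r0: "debye_radius x (T * E) \<ge> 0" by (simp add: debye_radius_def)
  have *: "(debye_radius x (T * E) * w)\<^sup>2 = T^4 * E\<^sup>2 + T\<^sup>2 * x\<^sup>2 * (E\<^sup>2 + 1) + x^4"
    unfolding power_mult_distrib r2 w(2) by (simp add: algebra_simps eval_nat_numeral)
  have "debye_radius x (T * E) * w \<le> T\<^sup>2 * E + x\<^sup>2 * C"
  proof (rule power2_le_imp_le)
    have "(T\<^sup>2 * E + x\<^sup>2 * C)\<^sup>2 = T^4 * E\<^sup>2 + T\<^sup>2 * x\<^sup>2 * (2 * E * C) + x^4 * C\<^sup>2"
      by (simp add: algebra_simps eval_nat_numeral)
    moreover have "x^4 * 1 \<le> x^4 * C\<^sup>2" using C by (intro mult_left_mono) auto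
    ultimately show "(debye_radius x (T * E) * w)\<^sup>2 \<le> (T\<^sup>2 * E + x\<^sup>2 * C)\<^sup>2"
      by (simp add: * EC)
    show "0 \<le> T\<^sup>2 * E + x\<^sup>2 * C" using E C by simp
  qed
  then have "debye_radius x (T * E) \<le> (T\<^sup>2 * E + x\<^sup>2 * C) / w"
    using w by (simp add: field_simps)
  also have "T\<^sup>2 * E + x\<^sup>2 * C = E * w\<^sup>2 - x\<^sup>2 * sinh y"
    unfolding w(2) Esinh[symmetric] by (simp add: algebra_simps)
  also have "\<dots> / w = E * w - x\<^sup>2 / w * sinh y"
    using w(1) by (simp add: field_simps power2_eq_square)
  finally show "debye_radius x (T * exp y) \<le> exp y * w - x\<^sup>2 / w * sinh y"
    by (simp add: E_def)
  have "T\<^sup>2 * E + x\<^sup>2 \<le> debye_radius x (T * E) * w"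
  proof (rule power2_le_imp_le)
    have "2 * E \<le> E\<^sup>2 + 1"
      using sum_squares_bound[of E 1] by simp
    then have "T\<^sup>2 * x\<^sup>2 * (2 * E) \<le> T\<^sup>2 * x\<^sup>2 * (E\<^sup>2 + 1)"
      by (intro mult_left_mono) auto
    moreover have "(T\<^sup>2 * E + x\<^sup>2)\<^sup>2 = T^4 * E\<^sup>2 + T\<^sup>2 * x\<^sup>2 * (2 * E) + x^4"
      by (simp add: algebra_simps eval_nat_numeral)
    ultimately show "(T\<^sup>2 * E + x\<^sup>2)\<^sup>2 \<le> (debye_radius x (T * E) * w)\<^sup>2"
      by (simp add: *)
    show "0 \<le> debye_radius x (T * E) * w" using r0 w by simp
  qed
  then have "(T\<^sup>2 * E + x\<^sup>2) / w \<le> debye_radius x (T * E)"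
    using w by (simp add: field_simps)
  also have "T\<^sup>2 * E + x\<^sup>2 = E * w\<^sup>2 + x\<^sup>2 * (1 - E)"
    unfolding w(2) by (simp add: algebra_simps)
  also have "\<dots> / w = E * w + x\<^sup>2 / w * (1 - E)"
    using w(1) by (simp add: field_simps power2_eq_square)
  finally show "exp y * w + x\<^sup>2 / w * (1 - exp y) \<le> debye_radius x (T * exp y)"
    by (simp add: E_def)
qed

text \<open>\<open>ln (debye_radius x t)\<close> is 1-Lipschitz in \<open>ln t\<close>; this
  controls the square-root prefactors away from the saddle.\<close>

lemma debye_radius_exp_ge:
  assumes "T > 0"
  shows "exp (- \<bar>y\<bar>) * debye_radius x T \<le> debye_radius x (T * exp y)"
proof -
  define c where "c = exp (- \<bar>y\<bar>)"
  have c: "0 < c" "c \<le> 1" "c \<le> exp y" by (auto simp: c_def)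
  have "c * debye_radius x T = sqrt (c\<^sup>2 * x\<^sup>2 + c\<^sup>2 * T\<^sup>2)"
    using c by (simp add: debye_radius_def real_sqrt_mult flip: distrib_left)
  also have "\<dots> \<le> debye_radius x (T * exp y)"
    unfolding debye_radius_def
  proof (intro real_sqrt_le_mono add_mono)
    show "c\<^sup>2 * x\<^sup>2 \<le> x\<^sup>2" using c by (intro mult_left_le_one_le) (auto simp: power_le_one)
    have "c\<^sup>2 * T\<^sup>2 \<le> (exp y)\<^sup>2 * T\<^sup>2" using c by (intro mult_right_mono power_mono) auto
    then show "c\<^sup>2 * T\<^sup>2 \<le> (T * exp y)\<^sup>2" by (simp add: power_mult_distrib mult.commute)
  qed
  finally show ?thesis by (simp add: c_def)
qed

lemma debye_radius_exp_le:
  assumes "T > 0"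
  shows "debye_radius x (T * exp y) \<le> exp \<bar>y\<bar> * debye_radius x T"
  using debye_radius_exp_ge[of "T * exp y" "-y" x] assms
  by (simp add: exp_minus field_simps)

text \<open>The lower bound is quadratic near 0, like the phase itself, and linear at infinity, so
  that a large multiple of it beats any \<open>exp (c |y|)\<close>. For
  \<open>y \<rightarrow> -\<infinity>\<close> the right-hand side itself grows only
  linearly.\<close>

lemma exp_minus_linear_ge:
  fixes y :: real
  shows "y\<^sup>2 / (2 * (1 + \<bar>y\<bar>)) \<le> exp y - 1 - y"
proof (cases "y \<ge> 0")
  case True
  have "y\<^sup>2 / (2 * (1 + \<bar>y\<bar>)) \<le> y\<^sup>2 / 2"
    using True by (intro divide_left_mono) auto
  also have "\<dots> \<le> exp y - 1 - y"
    using exp_lower_Taylor_quadratic[OF True] by simp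
  finally show ?thesis .
next
  case False
  \<comment> \<open>With \<open>s = - y\<close>, the claim multiplied by \<open>2 (1 - y)\<close>
    and \<open>exp (- y)\<close> is \<open>f s \<ge> 0\<close>. Here \<open>f 0 = 0\<close>, and one
    more differentiation shows that the derivative of \<open>f\<close> is nonnegative.\<close>
  define f where "f = (\<lambda>s::real. 2 + 2 * s - (2 - s\<^sup>2) * exp s)"
  have "f 0 \<le> f (-y)"
  proof (rule DERIV_nonneg_imp_nondecreasing[of 0 "-y" f])
    show "0 \<le> -y" using False by simp
    fix s assume s: "0 \<le> s" "s \<le> -y"
    show "\<exists>d. (f has_real_derivative d) (at s) \<and> 0 \<le> d"
    proof (intro exI conjI)
      show "(f has_real_derivative 2 - ((2 - s\<^sup>2) * exp s - 2 * s * exp s)) (at s)"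
        unfolding f_def by (auto intro!: derivative_eq_intros simp: algebra_simps)
      have "(2 - s\<^sup>2 - 2 * s) * exp s \<le> 2"
      proof -
        define h where "h = (\<lambda>s::real. - ((2 - s\<^sup>2 - 2 * s) * exp s))"
        have "h 0 \<le> h s"
        proof (rule DERIV_nonneg_imp_nondecreasing[of 0 s h, OF s(1)])
          fix x assume x: "0 \<le> x" "x \<le> s"
          show "\<exists>d. (h has_real_derivative d) (at x) \<and> 0 \<le> d"
          proof (intro exI conjI)
            show "(h has_real_derivative (x\<^sup>2 + 4 * x) * exp x) (at x)"
              unfolding h_def by (auto intro!: derivative_eq_intros simp: algebra_simps)
            show "0 \<le> (x\<^sup>2 + 4 * x) * exp x" using x by simp
          qed
        qed
        then show ?thesis by (simp add: h_def)
      qed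
      then show "0 \<le> 2 - ((2 - s\<^sup>2) * exp s - 2 * s * exp s)"
        by (simp add: algebra_simps)
    qed
  qed
  then have "(2 - y\<^sup>2) * exp (-y) \<le> 2 - 2 * y" by (simp add: f_def)
  then have "(2 - y\<^sup>2) \<le> (2 - 2 * y) * exp y" by (simp add: exp_minus field_simps)
  then have "y\<^sup>2 \<le> 2 * (1 - y) * (exp y - 1 - y)"
    by (simp add: algebra_simps power2_eq_square)
  then show ?thesis
    using False by (simp add: pos_divide_le_eq mult_ac)
qed

text \<open>The average of \<open>exp_minus_linear_ge\<close> at \<open>y\<close> and at
  \<open>- y\<close>.\<close>

lemma cosh_minus_one_ge:
  fixes y :: real
  shows "y\<^sup>2 / (2 * (1 + \<bar>y\<bar>)) \<le> cosh y - 1"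
  using exp_minus_linear_ge[of y] exp_minus_linear_ge[of "-y"] unfolding cosh_def by (simp add: field_simps)

section \<open>The saddle point\<close>

text \<open>Stationarity of \<open>phase a x\<close> at \<open>t\<close> says that the radii
  \<open>debye_radius (x $ i) t\<close> sum to \<open>d (1 + a^2) t\<close>; divided by
  \<open>t\<close>, this is the equation of \<open>u_par\<close> for
  \<open>u = 1 / t\<close>.\<close>

definition saddle :: "real \<Rightarrow> real^'n::finite \<Rightarrow> real" where
  "saddle a x = 1 / u_par a x"

definition phase :: "real \<Rightarrow> real^'n::finite \<Rightarrow> real \<Rightarrow> real" where
  "phase a x t = - a\<^sup>2 * real CARD('n) * t + (\<Sum>i\<in>UNIV. debye_exponent (x $ i) t)"

text \<open>Minus the second derivative of \<open>phase a x (saddle a x * exp y)\<close> at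
  \<open>y = 0\<close>: each radius has logarithmic derivative term \<open>T^2 / w\<close>, and
  \<open>T^2 / w - w = - x_i^2 / w\<close>.\<close>

definition curvature :: "real \<Rightarrow> real^'n::finite \<Rightarrow> real" where
  "curvature a x = (\<Sum>i\<in>UNIV. (x $ i)\<^sup>2 / debye_radius (x $ i) (saddle a x))"

lemma
  fixes x :: "real^'n::finite"
  assumes "a > 0" "x \<noteq> 0"
  shows u_par_gt_0: "u_par a x > 0"
    and u_par_eq: "(\<Sum>i\<in>UNIV. sqrt (1 + (x $ i)\<^sup>2 * (u_par a x)\<^sup>2)) = real CARD('n) * (1 + a\<^sup>2)"
proof -
  have *: "u_par a x \<ge> 0 \<and> (\<Sum>i\<in>UNIV. sqrt (1 + (x $ i)\<^sup>2 * (u_par a x)\<^sup>2)) / real CARD('n) = 1 + a\<^sup>2"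
    unfolding u_par_def by (rule theI'[OF u_par_ex1[OF assms(2)]])
  then show "(\<Sum>i\<in>UNIV. sqrt (1 + (x $ i)\<^sup>2 * (u_par a x)\<^sup>2)) = real CARD('n) * (1 + a\<^sup>2)"
    by (simp add: field_simps)
  have "u_par a x \<noteq> 0" using * assms(1) by auto
  then show "u_par a x > 0" using * by simp
qed

lemma u_par_unique:
  fixes x :: "real^'n::finite"
  assumes "x \<noteq> 0" "u \<ge> 0" "(\<Sum>i\<in>UNIV. sqrt (1 + (x $ i)\<^sup>2 * u\<^sup>2)) / real CARD('n) = 1 + a\<^sup>2"
  shows "u_par a x = u"
  unfolding u_par_def using assms u_par_ex1[OF assms(1), of a] by (intro the1_equality) auto

lemma saddle_pos: "a > 0 \<Longrightarrow> x \<noteq> 0 \<Longrightarrow> saddle a x > 0"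
  by (simp add: saddle_def u_par_gt_0)

lemma debye_radius_saddle:
  assumes "a > 0" "x \<noteq> 0"
  shows "debye_radius (x $ i) (saddle a x) = saddle a x * sqrt (1 + (x $ i)\<^sup>2 * (u_par a x)\<^sup>2)"
proof -
  have u: "u_par a x > 0" using assms by (rule u_par_gt_0)
  have "(x $ i)\<^sup>2 + (saddle a x)\<^sup>2 = (saddle a x)\<^sup>2 * (1 + (x $ i)\<^sup>2 * (u_par a x)\<^sup>2)"
    using u by (simp add: saddle_def field_simps)
  then show ?thesis
    using saddle_pos[OF assms] by (simp add: debye_radius_def real_sqrt_mult)
qed

lemma sum_debye_radius_saddle:
  fixes x :: "real^'n::finite"
  assumes "a > 0" "x \<noteq> 0"
  shows "(\<Sum>i\<in>UNIV. debye_radius (x $ i) (saddle a x)) = real CARD('n) * (1 + a\<^sup>2) * saddle a x"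
  unfolding debye_radius_saddle[OF assms] sum_distrib_left[symmetric] u_par_eq[OF assms] by simp

lemma mass_nonneg: "mass d a \<ge> 0" and cosh_mass: "cosh (mass d a) = 1 + real d * a\<^sup>2"
  unfolding mass_def using theI'[OF mass_ex1, of d a] by blast+

lemma mass_pos:
  assumes "a > 0" "d > 0"
  shows "mass d a > 0"
proof -
  have "cosh (mass d a) \<noteq> 1" using assms by (simp add: cosh_mass)
  then have "mass d a \<noteq> 0" by auto
  with mass_nonneg[of d a] show ?thesis by simp
qed

text \<open>At the saddle the summed radii cancel all terms linear in \<open>t\<close>; the
  remaining \<open>arsinh\<close> terms are the numerator of \<open>aniso_norm\<close>.\<close>

lemma phase_saddle:
  fixes x :: "real^'n::finite"
  assumes "a > 0" "x \<noteq> 0"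
  shows "phase a x (saddle a x) = - mass CARD('n) a * aniso_norm a x"
proof -
  have "phase a x (saddle a x) = - (\<Sum>i\<in>UNIV. x $ i * arsinh (x $ i / saddle a x))"
    using sum_debye_radius_saddle[OF assms]
    by (simp add: phase_def debye_exponent_def sum_subtractf sum.distrib algebra_simps)
  also have "\<dots> = - mass CARD('n) a * aniso_norm a x"
    using assms mass_pos[of a "CARD('n)"] by (simp add: aniso_norm_def saddle_def)
  finally show ?thesis .
qed

lemma aniso_norm_pos:
  fixes x :: "real^'n::finite"
  assumes "a > 0" "x \<noteq> 0"
  shows "aniso_norm a x > 0"
proof -
  have u: "u_par a x > 0" using assms by (rule u_par_gt_0)
  obtain j where j: "x $ j \<noteq> 0" using assms(2) by (metis vec_eq_iff zero_index)
  have nn: "0 \<le> y * arsinh (y * u_par a x)" for y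
  proof (cases y "0::real" rule: linorder_cases)
    case less
    then have "arsinh (y * u_par a x) \<le> 0" using u by (intro less_imp_le) (simp add: mult_neg_pos)
    with less show ?thesis by (intro mult_nonpos_nonpos) auto
  next
    case greater
    then have "0 \<le> arsinh (y * u_par a x)" using u by (intro less_imp_le) simp
    with greater show ?thesis by (intro mult_nonneg_nonneg) auto
  qed simp
  have "x $ j * arsinh (x $ j * u_par a x) \<noteq> 0" using j u by simp
  with nn[of "x $ j"] have "0 < x $ j * arsinh (x $ j * u_par a x)" by linarith
  then have "0 < (\<Sum>i\<in>UNIV. x $ i * arsinh (x $ i * u_par a x))"
    by (intro sum_pos2[of _ j]) (use nn in auto)
  then show ?thesis using assms mass_pos[of a "CARD('n)"] by (simp add: aniso_norm_def)
qed

lemma curvature_pos: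
  fixes x :: "real^'n::finite"
  assumes "a > 0" "x \<noteq> 0"
  shows "curvature a x > 0"
proof -
  obtain j where j: "x $ j \<noteq> 0" using assms(2) by (metis vec_eq_iff zero_index)
  show ?thesis unfolding curvature_def
    using debye_radius_pos[OF saddle_pos[OF assms]] j
    by (intro sum_pos2[of _ j]) (auto intro!: divide_nonneg_pos)
qed

text \<open>Stationarity replaces \<open>d (1 + a^2) T exp y\<close> by \<open>exp y\<close> times
  the summed radii at \<open>T\<close>. The mass term disappears, and each coordinate contributes a
  difference covered by \<open>debye_radius_exp_bounds\<close>.\<close>

lemma phase_has_derivative:
  fixes x :: "real^'n::finite"
  assumes "a > 0" "x \<noteq> 0"
  defines "T \<equiv> saddle a x"
  shows "((\<lambda>y. phase a x (T * exp y)) has_real_derivative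
     (\<Sum>i\<in>UNIV. debye_radius (x $ i) (T * exp y) - exp y * debye_radius (x $ i) T)) (at y)"
proof -
  have T: "T > 0" using saddle_pos[OF assms(1,2)] by (simp add: T_def)
  define t where "t = T * exp y"
  have t: "t > 0" using T by (simp add: t_def)
  have "((\<lambda>t. phase a x t) has_real_derivative
      - a\<^sup>2 * real CARD('n) * 1 + (\<Sum>i\<in>UNIV. debye_radius (x $ i) t / t - 1)) (at t)"
    unfolding phase_def
    by (intro DERIV_add DERIV_cmult DERIV_ident DERIV_sum debye_exponent_has_derivative t)
  moreover have "((\<lambda>y. T * exp y) has_real_derivative t) (at y)"
    unfolding t_def by (auto intro!: derivative_eq_intros)
  ultimately have "((\<lambda>y. phase a x (T * exp y)) has_real_derivative
      (- a\<^sup>2 * real CARD('n) * 1 + (\<Sum>i\<in>UNIV. debye_radius (x $ i) t / t - 1)) * t) (at y)"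
    unfolding t_def by (rule DERIV_chain2[of "phase a x" _ "\<lambda>y. T * exp y" y])
  moreover have "(- a\<^sup>2 * real CARD('n) * 1 + (\<Sum>i\<in>UNIV. debye_radius (x $ i) t / t - 1)) * t
     = (\<Sum>i\<in>UNIV. debye_radius (x $ i) t) - exp y * (real CARD('n) * (1 + a\<^sup>2) * T)"
  proof -
    have "(\<Sum>i\<in>UNIV. debye_radius (x $ i) t / t - 1) * t = (\<Sum>i\<in>UNIV. debye_radius (x $ i) t) - real CARD('n) * t"
      using t by (simp add: sum_subtractf sum_divide_distrib[symmetric] left_diff_distrib)
    then show ?thesis by (simp add: algebra_simps t_def)
  qed
  ultimately show ?thesis
    unfolding sum_debye_radius_saddle[OF assms(1,2), folded T_def, symmetric]
    by (simp add: sum_subtractf sum_distrib_left t_def)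
qed

text \<open>The derivative in \<open>y\<close> lies between \<open>M (1 - exp y)\<close> and
  \<open>- M sinh y\<close> for every \<open>y\<close>. Integrating from 0 swaps the two bounds when
  \<open>y < 0\<close>, whence \<open>min\<close> and \<open>max\<close>; both primitives behave
  like \<open>- M y^2 / 2\<close> at 0.\<close>

lemma phase_increment_bounds:
  fixes x :: "real^'n::finite"
  assumes "a > 0" "x \<noteq> 0"
  defines "T \<equiv> saddle a x" and "M \<equiv> curvature a x"
  shows "phase a x (T * exp y) - phase a x T \<le> - (M * min (cosh y - 1) (exp y - 1 - y))"
    and "- (M * max (cosh y - 1) (exp y - 1 - y)) \<le> phase a x (T * exp y) - phase a x T"
proof -
  have T: "T > 0" using saddle_pos[OF assms(1,2)] by (simp add: T_def)
  have M: "M > 0" using curvature_pos[OF assms(1,2)] by (simp add: M_def)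
  define h where "h = (\<lambda>y. phase a x (T * exp y) - phase a x T)"
  define D where "D = (\<lambda>y. \<Sum>i\<in>UNIV. debye_radius (x $ i) (T * exp y) - exp y * debye_radius (x $ i) T)"
  have h: "(h has_real_derivative D y) (at y)" for y
    unfolding h_def D_def using DERIV_diff[OF phase_has_derivative[OF assms(1,2)] DERIV_const]
    by (simp add: T_def)
  have Dle: "D y \<le> - M * sinh y" for y
  proof -
    have "D y \<le> (\<Sum>i\<in>UNIV. - (x $ i)\<^sup>2 / debye_radius (x $ i) T * sinh y)"
      unfolding D_def by (intro sum_mono) (use debye_radius_exp_bounds(1)[OF T] in \<open>simp add: algebra_simps\<close>)
    also have "\<dots> = - M * sinh y"
      by (simp add: M_def curvature_def T_def sum_distrib_right sum_negf)
    finally show ?thesis .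
  qed
  have Dge: "M * (1 - exp y) \<le> D y" for y
  proof -
    have "M * (1 - exp y) = (\<Sum>i\<in>UNIV. (x $ i)\<^sup>2 / debye_radius (x $ i) T * (1 - exp y))"
      by (simp add: M_def curvature_def T_def sum_distrib_right)
    also have "\<dots> \<le> D y"
      unfolding D_def by (intro sum_mono) (use debye_radius_exp_bounds(2)[OF T] in \<open>simp add: algebra_simps\<close>)
    finally show ?thesis .
  qed
  \<comment> \<open>\<open>P\<close> and \<open>Q\<close> are nondecreasing and vanish at 0, so each
    gives one bound on either half line.\<close>
  define P where "P = (\<lambda>y. - (h y + M * (cosh y - 1)))"
  define Q where "Q = (\<lambda>y. h y + M * (exp y - 1 - y))"
  have P: "P y1 \<le> P y2" if "y1 \<le> y2" for y1 y2
  proof (rule DERIV_nonneg_imp_nondecreasing[OF that])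
    fix y
    show "\<exists>d. (P has_real_derivative d) (at y) \<and> 0 \<le> d"
    proof (intro exI conjI)
      show "(P has_real_derivative - (D y + M * sinh y)) (at y)"
        unfolding P_def by (auto intro!: derivative_eq_intros h)
      show "0 \<le> - (D y + M * sinh y)" using Dle[of y] by simp
    qed
  qed
  have Q: "Q y1 \<le> Q y2" if "y1 \<le> y2" for y1 y2
  proof (rule DERIV_nonneg_imp_nondecreasing[OF that])
    fix y
    show "\<exists>d. (Q has_real_derivative d) (at y) \<and> 0 \<le> d"
    proof (intro exI conjI)
      show "(Q has_real_derivative (D y + M * (exp y - 1))) (at y)"
        unfolding Q_def by (auto intro!: derivative_eq_intros h)
      show "0 \<le> (D y + M * (exp y - 1))" using Dge[of y] by (simp add: algebra_simps)
    qed
  qed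
  have P0: "P 0 = 0" and Q0: "Q 0 = 0" by (simp_all add: P_def Q_def h_def)
  have *: "h y \<le> - (M * min (cosh y - 1) (exp y - 1 - y)) \<and>
         - (M * max (cosh y - 1) (exp y - 1 - y)) \<le> h y"
  proof (cases "y \<ge> 0")
    case True
    have "h y \<le> - (M * (cosh y - 1))" using P[OF True] P0 by (simp add: P_def)
    moreover have "- (M * (exp y - 1 - y)) \<le> h y" using Q[OF True] Q0 by (simp add: Q_def)
    moreover have "M * min (cosh y - 1) (exp y - 1 - y) \<le> M * (cosh y - 1)"
      "M * (exp y - 1 - y) \<le> M * max (cosh y - 1) (exp y - 1 - y)"
      using M by (auto intro!: mult_left_mono)
    ultimately show ?thesis by linarith
  next
    case False
    then have y: "y \<le> 0" by simp
    have "- (M * (cosh y - 1)) \<le> h y" using P[OF y] P0 by (simp add: P_def)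
    moreover have "h y \<le> - (M * (exp y - 1 - y))" using Q[OF y] Q0 by (simp add: Q_def)
    moreover have "M * min (cosh y - 1) (exp y - 1 - y) \<le> M * (exp y - 1 - y)"
      "M * (cosh y - 1) \<le> M * max (cosh y - 1) (exp y - 1 - y)"
      using M by (auto intro!: mult_left_mono)
    ultimately show ?thesis by linarith
  qed
  then show "phase a x (T * exp y) - phase a x T \<le> - (M * min (cosh y - 1) (exp y - 1 - y))"
    and "- (M * max (cosh y - 1) (exp y - 1 - y)) \<le> phase a x (T * exp y) - phase a x T"
    by (simp_all add: h_def)
qed

lemma phase_increment_le:
  fixes x :: "real^'n::finite"
  assumes "a > 0" "x \<noteq> 0"
  shows "phase a x (saddle a x * exp y) - phase a x (saddle a x)
     \<le> - (curvature a x * (y\<^sup>2 / (2 * (1 + \<bar>y\<bar>))))"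
proof -
  have "curvature a x * (y\<^sup>2 / (2 * (1 + \<bar>y\<bar>))) \<le> curvature a x * min (cosh y - 1) (exp y - 1 - y)"
    using curvature_pos[OF assms] exp_minus_linear_ge[of y] cosh_minus_one_ge[of y]
    by (intro mult_left_mono) auto
  with phase_increment_bounds(1)[OF assms, of y] show ?thesis by linarith
qed

section \<open>The Laplace method\<close>

definition green_integrand :: "real \<Rightarrow> real \<Rightarrow> real^'n::finite \<Rightarrow> real \<Rightarrow> real" where
  "green_integrand a q x t =
     t powr (q - 1) * exp (- a\<^sup>2 * real CARD('n) * t) * (\<Prod>i\<in>UNIV. scaled_bessel_I (x $ i) t)"

text \<open>The Laplace prefactor: \<open>T powr q\<close> from \<open>t powr (q - 1) dt\<close>
  under \<open>t = T exp y\<close>, the Debye prefactors frozen at \<open>T\<close>, and the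
  Gaussian integral \<open>sqrt (2 pi / M)\<close>.\<close>

definition saddle_amplitude :: "real \<Rightarrow> real \<Rightarrow> real^'n::finite \<Rightarrow> real" where
  "saddle_amplitude a q x = saddle a x powr q *
     (\<Prod>i\<in>UNIV. 1 / sqrt (2 * pi * debye_radius (x $ i) (saddle a x))) * sqrt (2 * pi / curvature a x)"

definition saddle_value :: "real \<Rightarrow> real \<Rightarrow> real^'n::finite \<Rightarrow> real" where
  "saddle_value a q x = saddle_amplitude a q x * exp (phase a x (saddle a x))"

text \<open>The integrand in \<open>y\<close> divided by its Debye leading value at
  \<open>y = 0\<close>; the square roots record how the Debye prefactors vary away from the
  saddle.\<close>

definition saddle_profile :: "real \<Rightarrow> real \<Rightarrow> real^'n::finite \<Rightarrow> real \<Rightarrow> real" where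
  "saddle_profile a q x y = (let T = saddle a x in
     exp (q * y) * exp (phase a x (T * exp y) - phase a x T) *
     (\<Prod>i\<in>UNIV. debye_ratio (x $ i) (T * exp y) * sqrt (debye_radius (x $ i) T / debye_radius (x $ i) (T * exp y))))"

lemma scaled_bessel_I_measurable [measurable]: "scaled_bessel_I \<nu> \<in> borel_measurable borel"
  unfolding scaled_bessel_I_def set_lebesgue_integral_def by measurable

lemma debye_ratio_measurable [measurable]: "debye_ratio \<nu> \<in> borel_measurable borel"
  unfolding debye_ratio_def debye_radius_def set_lebesgue_integral_def by measurable

lemma debye_radius_measurable [measurable]: "debye_radius \<nu> \<in> borel_measurable borel"
  unfolding debye_radius_def by measurable

lemma debye_exponent_measurable [measurable]: "debye_exponent \<nu> \<in> borel_measurable borel"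
  unfolding debye_exponent_def arsinh_real_def by measurable

lemma phase_measurable [measurable]: "phase a x \<in> borel_measurable borel"
  unfolding phase_def by measurable

lemma green_integrand_measurable [measurable]: "green_integrand a q x \<in> borel_measurable borel"
  unfolding green_integrand_def by measurable

lemma saddle_profile_measurable [measurable]: "saddle_profile a q x \<in> borel_measurable borel"
  unfolding saddle_profile_def Let_def by measurable

lemma green_integrand_saddle:
  fixes x :: "real^'n::finite"
  assumes a: "a > 0" and x: "x \<in> int_lattice" "x \<noteq> 0"
  defines "T \<equiv> saddle a x"
  shows "(T * exp y) * green_integrand a q x (T * exp y)
    = saddle_value a q x / sqrt (2 * pi / curvature a x) * saddle_profile a q x y"
proof -
  have T: "T > 0" using saddle_pos[OF a x(2)] by (simp add: T_def)
  define t where "t = T * exp y"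
  have t: "t > 0" using T by (simp add: t_def)
  have M: "curvature a x > 0" using curvature_pos[OF a x(2)] .
  have I: "scaled_bessel_I (x $ i) t = exp (debye_exponent (x $ i) t) *
     ((1 / sqrt (2 * pi * debye_radius (x $ i) T)) *
     (debye_ratio (x $ i) t * sqrt (debye_radius (x $ i) T / debye_radius (x $ i) t)))" for i
  proof -
    have "x $ i \<in> \<int>" using x by (auto simp: int_lattice_def)
    from scaled_bessel_I_eq_debye[OF this t]
    show ?thesis using debye_radius_pos[OF T, of "x $ i"] debye_radius_pos[OF t, of "x $ i"]
      by (simp add: real_sqrt_divide real_sqrt_mult)
  qed
  have "t * t powr (q - 1) = T powr q * exp (q * y)"
    using t T by (simp add: powr_mult_base) (simp add: t_def powr_mult exp_powr_real mult.commute)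
  then have "t * green_integrand a q x t = T powr q * exp (q * y) *
     (exp (- a\<^sup>2 * real CARD('n) * t) * (\<Prod>i\<in>UNIV. exp (debye_exponent (x $ i) t))) *
     (\<Prod>i\<in>UNIV. 1 / sqrt (2 * pi * debye_radius (x $ i) T)) *
     (\<Prod>i\<in>UNIV. debye_ratio (x $ i) t * sqrt (debye_radius (x $ i) T / debye_radius (x $ i) t))"
    unfolding green_integrand_def I prod.distrib by (simp add: mult_ac)
  also have "exp (- a\<^sup>2 * real CARD('n) * t) * (\<Prod>i\<in>UNIV. exp (debye_exponent (x $ i) t))
     = exp (phase a x T) * exp (phase a x t - phase a x T)"
    by (simp add: exp_sum[symmetric] exp_add[symmetric] phase_def)
  finally show ?thesis
    using M by (simp add: saddle_value_def saddle_amplitude_def saddle_profile_def Let_def T_def[symmetric] t_def mult_ac)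
qed

text \<open>An exact identity, from \<open>t = T exp y\<close> and \<open>y = z / sqrt M\<close>:
  every approximation is confined to the last factor, which will tend to 1.\<close>

lemma green_integral_saddle:
  fixes x :: "real^'n::finite"
  assumes a: "a > 0" and x: "x \<in> int_lattice" "x \<noteq> 0"
  shows "(LINT t:{0<..}|lborel. green_integrand a q x t)
    = saddle_value a q x * ((LINT z|lborel. saddle_profile a q x (z / sqrt (curvature a x))) / sqrt (2 * pi))"
proof -
  define T where "T = saddle a x"
  define M where "M = curvature a x"
  have T: "T > 0" using saddle_pos[OF a x(2)] by (simp add: T_def)
  have M: "M > 0" using curvature_pos[OF a x(2)] by (simp add: M_def)
  define f where "f = (\<lambda>y. exp y * green_integrand a q x (exp y))"
  have "(LINT t:{0<..}|lborel. green_integrand a q x t) = (LINT y|lborel. f y)"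
    unfolding f_def by (rule exp_substitution) measurable
  also have "\<dots> = \<bar>1 / sqrt M\<bar> *\<^sub>R (LINT z|lborel. f (ln T + 1 / sqrt M * z))"
    by (rule lborel_integral_real_affine) (use M in simp)
  also have "(\<lambda>z. f (ln T + 1 / sqrt M * z)) =
      (\<lambda>z. saddle_value a q x / sqrt (2 * pi / M) * saddle_profile a q x (z / sqrt M))"
    using T green_integrand_saddle[OF a x] by (simp add: f_def exp_add T_def M_def)
  also have "\<bar>1 / sqrt M\<bar> *\<^sub>R integral\<^sup>L lborel \<dots>
     = saddle_value a q x * ((LINT z|lborel. saddle_profile a q x (z / sqrt M)) / sqrt (2 * pi))"
    using M by (simp add: real_sqrt_divide)
  finally show ?thesis by (simp add: M_def)
qed

text \<open>The amplitude grows at most like \<open>exp ((q + d) |y|)\<close>, which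
  \<open>4 (q + d) \<le> sqrt M\<close> turns into \<open>exp (|z| / 4)\<close>. As
  \<open>M \<ge> 1\<close> gives \<open>|y| \<le> |z|\<close>, the phase loses at least
  \<open>z^2 / (2 (1 + |z|)) \<ge> (|z| - 1) / 2\<close>. What remains is
  \<open>exp (1/2 - |z| / 4)\<close>.\<close>

lemma saddle_profile_bound:
  fixes x :: "real^'n::finite"
  assumes a: "a > 0" and x: "x \<noteq> 0"
    and M: "curvature a x \<ge> 1" "4 * (q + real CARD('n)) \<le> sqrt (curvature a x)" and q: "q > 0"
  shows "\<bar>saddle_profile a q x (z / sqrt (curvature a x))\<bar> \<le> 3 ^ CARD('n) * exp (1 / 2) * exp (- (\<bar>z\<bar> / 4))"
proof -
  define T where "T = saddle a x"
  define r where "r = sqrt (curvature a x)"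
  define y where "y = z / r"
  have T: "T > 0" using saddle_pos[OF a x] by (simp add: T_def)
  have r: "r \<ge> 1" "r\<^sup>2 = curvature a x" using M by (simp_all add: r_def)
  have t: "T * exp y > 0" using T by simp
  have w: "debye_radius \<nu> T > 0" "debye_radius \<nu> (T * exp y) > 0" for \<nu>
    using debye_radius_pos T t by blast+
  have "\<bar>debye_ratio (x $ i) (T * exp y) * sqrt (debye_radius (x $ i) T / debye_radius (x $ i) (T * exp y))\<bar>
      \<le> 3 * exp \<bar>y\<bar>" for i
  proof -
    have "debye_radius (x $ i) T / debye_radius (x $ i) (T * exp y) \<le> exp \<bar>y\<bar>"
      using debye_radius_exp_ge[OF T, of y "x $ i"] w by (simp add: exp_minus field_simps)
    also have "\<dots> \<le> (exp \<bar>y\<bar>)\<^sup>2"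
      by (simp add: power2_eq_square)
    finally have "sqrt (debye_radius (x $ i) T / debye_radius (x $ i) (T * exp y)) \<le> exp \<bar>y\<bar>"
      by (intro real_le_lsqrt) auto
    then show ?thesis
      unfolding abs_mult using debye_ratio_le[OF t, of "x $ i"] w(1,2)[of "x $ i"]
      by (intro mult_mono) auto
  qed
  then have "(\<Prod>i\<in>UNIV. \<bar>debye_ratio (x $ i) (T * exp y) * sqrt (debye_radius (x $ i) T / debye_radius (x $ i) (T * exp y))\<bar>)
     \<le> (\<Prod>i\<in>(UNIV::'n set). 3 * exp \<bar>y\<bar>)"
    by (intro prod_mono) auto
  also have "\<dots> = 3 ^ CARD('n) * exp (real CARD('n) * \<bar>y\<bar>)"
    by (simp add: power_mult_distrib exp_of_nat_mult)
  finally have P: "\<bar>\<Prod>i\<in>UNIV. debye_ratio (x $ i) (T * exp y) * sqrt (debye_radius (x $ i) T / debye_radius (x $ i) (T * exp y))\<bar>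
     \<le> 3 ^ CARD('n) * exp (real CARD('n) * \<bar>y\<bar>)"
    by (simp add: abs_prod)
  have "\<bar>saddle_profile a q x y\<bar> = exp (q * y) * exp (phase a x (T * exp y) - phase a x T) *
     \<bar>\<Prod>i\<in>UNIV. debye_ratio (x $ i) (T * exp y) * sqrt (debye_radius (x $ i) T / debye_radius (x $ i) (T * exp y))\<bar>"
    by (simp add: saddle_profile_def Let_def T_def abs_mult)
  also have "\<dots> \<le> exp (q * \<bar>y\<bar>) * exp (- (r\<^sup>2 * (y\<^sup>2 / (2 * (1 + \<bar>y\<bar>))))) * (3 ^ CARD('n) * exp (real CARD('n) * \<bar>y\<bar>))"
    using phase_increment_le[OF a x, of y] q P
    by (intro mult_mono) (auto simp: T_def r)
  also have "\<dots> = 3 ^ CARD('n) * exp ((q + real CARD('n)) * \<bar>y\<bar> - r\<^sup>2 * (y\<^sup>2 / (2 * (1 + \<bar>y\<bar>))))"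
  proof -
    have "exp A * exp (- Z) * (K * exp B) = K * exp (A + B - Z)" for A B Z K :: real
      by (simp add: exp_add exp_diff exp_minus field_simps)
    then show ?thesis by (simp only: distrib_right)
  qed
  also have "\<dots> \<le> 3 ^ CARD('n) * exp (1 / 2 + - (\<bar>z\<bar> / 4))"
  proof -
    have ay: "\<bar>y\<bar> = \<bar>z\<bar> / r" using r by (simp add: y_def)
    have "(q + real CARD('n)) * \<bar>y\<bar> = 4 * (q + real CARD('n)) * (\<bar>z\<bar> / (4 * r))"
      using r unfolding ay by (simp add: field_simps)
    also have "\<dots> \<le> r * (\<bar>z\<bar> / (4 * r))"
      using M(2) r by (intro mult_right_mono) (auto simp: r_def)
    also have "\<dots> = \<bar>z\<bar> / 4" using r by simp
    finally have 1: "(q + real CARD('n)) * \<bar>y\<bar> \<le> \<bar>z\<bar> / 4" .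
    have "(\<bar>z\<bar> - 1) / 2 \<le> z\<^sup>2 / (2 * (1 + \<bar>z\<bar>))"
      by (simp add: field_simps power2_eq_square)
    also have "\<dots> \<le> z\<^sup>2 / (2 * (1 + \<bar>y\<bar>))"
    proof (intro divide_left_mono)
      have "1 * \<bar>z\<bar> \<le> r * \<bar>z\<bar>" using r by (intro mult_right_mono) auto
      then have "\<bar>y\<bar> \<le> \<bar>z\<bar>" using r by (simp add: ay field_simps)
      then show "2 * (1 + \<bar>y\<bar>) \<le> 2 * (1 + \<bar>z\<bar>)" by simp
    qed auto
    also have "z\<^sup>2 = r\<^sup>2 * y\<^sup>2" using r(1) by (simp add: y_def power_divide)
    finally have "(\<bar>z\<bar> - 1) / 2 \<le> r\<^sup>2 * (y\<^sup>2 / (2 * (1 + \<bar>y\<bar>)))" by simp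
    moreover have "A - Z \<le> 1 / 2 + - (v / 4)" if "A \<le> v / 4" "(v - 1) / 2 \<le> Z" for A Z v :: real
      using that by (simp add: field_simps)
    ultimately have "(q + real CARD('n)) * \<bar>y\<bar> - r\<^sup>2 * (y\<^sup>2 / (2 * (1 + \<bar>y\<bar>))) \<le> 1 / 2 + - (\<bar>z\<bar> / 4)"
      using 1 by blast
    then show ?thesis by simp
  qed
  finally show ?thesis by (simp only: y_def r_def exp_add mult.assoc)
qed

lemma exp_abs_integrable:
  assumes "c > 0"
  shows "integrable lborel (\<lambda>z::real. exp (- (\<bar>z\<bar> * c)))"
proof -
  have "set_integrable lborel {0..} (\<lambda>z::real. exp (- (z * c)))"
  proof -
    have "(\<lambda>x. exp (- c * x)) integrable_on {0..}"
      using integrable_on_exp_minus_to_infinity[OF assms, of 0] by simp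
    then have "(\<lambda>x. exp (- c * x)) absolutely_integrable_on {0..}"
      by (rule nonnegative_absolutely_integrable_1) auto
    then show ?thesis
      unfolding set_integrable_def by (subst (asm) integrable_completion) (auto simp: mult.commute)
  qed
  then have i: "integrable lborel (\<lambda>z::real. indicator {0..} z * exp (- (z * c)))"
    by (simp add: set_integrable_def)
  then have "integrable lborel (\<lambda>z::real. indicator {0..} (0 + -1 * z) * exp (- ((0 + -1 * z) * c)))"
    by (rule lborel_integrable_real_affine) simp
  from Bochner_Integration.integrable_add[OF i this]
  show ?thesis
    by (rule Bochner_Integration.integrable_bound) (auto simp: indicator_def abs_if)
qed

text \<open>The Laplace limit along arbitrary sequences: divergence of the saddle sends every
  \<open>debye_ratio\<close> to 1, and divergence of the curvature makes the phase increment
  Gaussian. The freedom in \<open>A\<close> and \<open>X\<close> is what the uniform statement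
  exploits.\<close>

lemma saddle_profile_integral_tendsto:
  fixes A :: "nat \<Rightarrow> real" and X :: "nat \<Rightarrow> real^'n::finite"
  assumes A: "\<And>k. A k > 0" and X: "\<And>k. X k \<noteq> 0" and q: "q > 0"
    and T: "filterlim (\<lambda>k. saddle (A k) (X k)) at_top sequentially"
    and M: "filterlim (\<lambda>k. curvature (A k) (X k)) at_top sequentially"
  shows "(\<lambda>k. LINT z|lborel. saddle_profile (A k) q (X k) (z / sqrt (curvature (A k) (X k)))) \<longlonglongrightarrow> sqrt (2 * pi)"
proof -
  have "\<forall>\<^sub>F m in at_top. m \<ge> 1 \<and> 4 * (q + real CARD('n)) \<le> sqrt m"
    using eventually_ge_at_top[of "max 1 ((4 * (q + real CARD('n)))\<^sup>2)"]
    by eventually_elim (auto intro: real_le_rsqrt)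
  then have "\<forall>\<^sub>F k in sequentially. curvature (A k) (X k) \<ge> 1 \<and> 4 * (q + real CARD('n)) \<le> sqrt (curvature (A k) (X k))"
    using M by (rule eventually_compose_filterlim)
  then obtain N where N: "\<And>k. k \<ge> N \<Longrightarrow> curvature (A k) (X k) \<ge> 1 \<and> 4 * (q + real CARD('n)) \<le> sqrt (curvature (A k) (X k))"
    by (auto simp: eventually_sequentially)
  define F where "F = (\<lambda>k z. saddle_profile (A k) q (X k) (z / sqrt (curvature (A k) (X k))))"
  have lim: "(\<lambda>k. F k z) \<longlonglongrightarrow> exp (- (z\<^sup>2 / 2))" for z
  proof -
    define m where "m = (\<lambda>k. curvature (A k) (X k))"
    define y where "y = (\<lambda>k. z / sqrt (m k))"
    define S where "S = (\<lambda>k. saddle (A k) (X k))"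
    have S: "S k > 0" for k using A X by (simp add: S_def saddle_pos)
    have m: "filterlim m at_top sequentially" using M by (simp add: m_def)
    have "((\<lambda>m. z / sqrt m) \<longlongrightarrow> 0) at_top" by real_asymp
    from filterlim_compose[OF this m] have y: "y \<longlonglongrightarrow> 0" by (simp add: y_def)
    have "((\<lambda>m. m * (cosh (z / sqrt m) - 1)) \<longlongrightarrow> z * z / 2) at_top" by real_asymp
    from filterlim_compose[OF this m] have l1: "(\<lambda>k. m k * (cosh (y k) - 1)) \<longlonglongrightarrow> z\<^sup>2 / 2"
      by (simp add: y_def power2_eq_square)
    have "((\<lambda>m. m * (exp (z / sqrt m) - 1 - z / sqrt m)) \<longlongrightarrow> z * z / 2) at_top" by real_asymp
    from filterlim_compose[OF this m] have l2: "(\<lambda>k. m k * (exp (y k) - 1 - y k)) \<longlonglongrightarrow> z\<^sup>2 / 2"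
      by (simp add: y_def power2_eq_square)
    have m0: "m k > 0" for k using A X by (simp add: m_def curvature_pos)
    have ph: "(\<lambda>k. phase (A k) (X k) (S k * exp (y k)) - phase (A k) (X k) (S k)) \<longlonglongrightarrow> - (z\<^sup>2 / 2)"
    proof (rule tendsto_sandwich)
      show "(\<lambda>k. - max (m k * (cosh (y k) - 1)) (m k * (exp (y k) - 1 - y k))) \<longlonglongrightarrow> - (z\<^sup>2 / 2)"
        using tendsto_minus[OF tendsto_max[OF l1 l2]] by simp
      show "(\<lambda>k. - min (m k * (cosh (y k) - 1)) (m k * (exp (y k) - 1 - y k))) \<longlonglongrightarrow> - (z\<^sup>2 / 2)"
        using tendsto_minus[OF tendsto_min[OF l1 l2]] by simp
      show "\<forall>\<^sub>F k in sequentially. - max (m k * (cosh (y k) - 1)) (m k * (exp (y k) - 1 - y k))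
         \<le> phase (A k) (X k) (S k * exp (y k)) - phase (A k) (X k) (S k)"
      proof (intro always_eventually allI)
        fix k
        have "m k * max (cosh (y k) - 1) (exp (y k) - 1 - y k)
            = max (m k * (cosh (y k) - 1)) (m k * (exp (y k) - 1 - y k))"
          using m0[of k] by (simp add: max_mult_distrib_left)
        with phase_increment_bounds(2)[OF A X, of k k "y k"]
        show "- max (m k * (cosh (y k) - 1)) (m k * (exp (y k) - 1 - y k))
         \<le> phase (A k) (X k) (S k * exp (y k)) - phase (A k) (X k) (S k)"
          by (simp add: m_def S_def)
      qed
      show "\<forall>\<^sub>F k in sequentially. phase (A k) (X k) (S k * exp (y k)) - phase (A k) (X k) (S k)
        \<le> - min (m k * (cosh (y k) - 1)) (m k * (exp (y k) - 1 - y k))"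
      proof (intro always_eventually allI)
        fix k
        have "m k * min (cosh (y k) - 1) (exp (y k) - 1 - y k)
            = min (m k * (cosh (y k) - 1)) (m k * (exp (y k) - 1 - y k))"
          using m0[of k] by (simp add: min_mult_distrib_left)
        with phase_increment_bounds(1)[OF A X, of k k "y k"]
        show "phase (A k) (X k) (S k * exp (y k)) - phase (A k) (X k) (S k)
        \<le> - min (m k * (cosh (y k) - 1)) (m k * (exp (y k) - 1 - y k))"
          by (simp add: m_def S_def)
      qed
    qed
    have r: "(\<lambda>k. debye_ratio (X k $ i) (S k * exp (y k))) \<longlonglongrightarrow> 1" for i
    proof (rule debye_ratio_tendsto)
      show "S k * exp (y k) > 0" for k using S by simp
      have "(\<lambda>k. exp (y k)) \<longlonglongrightarrow> exp 0" by (intro tendsto_exp y)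
      moreover have "filterlim S at_top sequentially" using T by (simp add: S_def)
      ultimately have "filterlim (\<lambda>k. exp (y k) * S k) at_top sequentially"
        by (intro filterlim_tendsto_pos_mult_at_top[of _ 1]) auto
      then show "filterlim (\<lambda>k. debye_radius (X k $ i) (S k * exp (y k))) at_top sequentially"
      proof (rule filterlim_at_top_mono, intro always_eventually allI)
        fix k show "exp (y k) * S k \<le> debye_radius (X k $ i) (S k * exp (y k))"
          unfolding debye_radius_def by (rule real_le_rsqrt) (simp add: mult.commute)
      qed
    qed
    have w: "(\<lambda>k. debye_radius (X k $ i) (S k) / debye_radius (X k $ i) (S k * exp (y k))) \<longlonglongrightarrow> 1" for i
    proof (rule tendsto_sandwich)
      have "(\<lambda>k. exp (- \<bar>y k\<bar>)) \<longlonglongrightarrow> exp (- \<bar>0\<bar>)" by (intro tendsto_intros y)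
      then show "(\<lambda>k. exp (- \<bar>y k\<bar>)) \<longlonglongrightarrow> 1" by simp
      have "(\<lambda>k. exp \<bar>y k\<bar>) \<longlonglongrightarrow> exp \<bar>0\<bar>" by (intro tendsto_intros y)
      then show "(\<lambda>k. exp \<bar>y k\<bar>) \<longlonglongrightarrow> 1" by simp
      have p: "debye_radius (X k $ i) (S k * exp (y k)) > 0" for k
        using S by (simp add: debye_radius_pos)
      show "\<forall>\<^sub>F k in sequentially. exp (- \<bar>y k\<bar>) \<le> debye_radius (X k $ i) (S k) / debye_radius (X k $ i) (S k * exp (y k))"
        using debye_radius_exp_le[OF S] p
        by (intro always_eventually allI) (simp add: exp_minus field_simps)
      show "\<forall>\<^sub>F k in sequentially. debye_radius (X k $ i) (S k) / debye_radius (X k $ i) (S k * exp (y k)) \<le> exp \<bar>y k\<bar>"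
        using debye_radius_exp_ge[OF S] p
        by (intro always_eventually allI) (simp add: exp_minus field_simps)
    qed
    have "(\<lambda>k. exp (q * y k) * exp (phase (A k) (X k) (S k * exp (y k)) - phase (A k) (X k) (S k)) *
     (\<Prod>i\<in>UNIV. debye_ratio (X k $ i) (S k * exp (y k)) * sqrt (debye_radius (X k $ i) (S k) / debye_radius (X k $ i) (S k * exp (y k)))))
      \<longlonglongrightarrow> exp (q * 0) * exp (- (z\<^sup>2 / 2)) * (\<Prod>i\<in>(UNIV::'n set). 1 * sqrt 1)"
      by (intro tendsto_intros y ph r w)
    then show ?thesis
      by (simp add: F_def saddle_profile_def Let_def S_def y_def m_def)
  qed
  \<comment> \<open>The majorant is available only once the curvature is large, hence the shift by
    \<open>N\<close>.\<close>
  have "(\<lambda>k. LINT z|lborel. F (k + N) z) \<longlonglongrightarrow> (LINT z|lborel. exp (- (z\<^sup>2 / 2)))"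
  proof (rule integral_dominated_convergence)
    show "integrable lborel (\<lambda>z::real. 3 ^ CARD('n) * exp (1 / 2) * exp (- (\<bar>z\<bar> / 4)))"
      using exp_abs_integrable[of "1/4"] by simp
    show "AE z in lborel. (\<lambda>k. F (k + N) z) \<longlonglongrightarrow> exp (- (z\<^sup>2 / 2))"
      using lim by (auto intro!: LIMSEQ_ignore_initial_segment)
    show "AE z in lborel. norm (F (k + N) z) \<le> 3 ^ CARD('n) * exp (1 / 2) * exp (- (\<bar>z\<bar> / 4))" for k
      unfolding F_def real_norm_def using N[of "k + N"]
      by (intro AE_I2 saddle_profile_bound A X q) auto
  qed (auto simp: F_def)
  also have "(LINT z::real|lborel. exp (- (z\<^sup>2 / 2))) = sqrt (2 * pi)"
    by (rule has_bochner_integral_integral_eq) (rule gauss_has_bochner_integral, simp)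
  finally show ?thesis
    unfolding F_def by (rule LIMSEQ_offset)
qed

section \<open>Integral representation of the lattice Green function\<close>

text \<open>\<open>ln v \<le> v - 1\<close> at \<open>v = c t / b\<close>; the constant
  \<open>K\<close> is the maximum of \<open>t powr b * exp (- c t)\<close>, attained at
  \<open>t = b / c\<close>.\<close>

lemma exp_le_powr:
  fixes b c :: real
  assumes "b > 0" "c > 0"
  shows "\<exists>K>0. \<forall>t>0. exp (- (c * t)) \<le> K * t powr (- b)"
proof (intro exI conjI allI impI)
  show "exp (- b - b * ln (c / b)) > 0" by simp
  fix t :: real assume t: "t > 0"
  have "ln (c / b * t) \<le> c / b * t - 1" using assms t by (intro ln_le_minus_one) auto
  moreover have "ln (c / b * t) = ln (c / b) + ln t" using assms t by (intro ln_mult_pos) auto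
  ultimately have "b * (ln (c / b) + ln t) \<le> b * (c / b * t - 1)"
    using assms t by (intro mult_left_mono) auto
  then have "- (c * t) \<le> - b - b * ln (c / b) - b * ln t"
    using assms by (simp add: algebra_simps)
  then have "exp (- (c * t)) \<le> exp (- b - b * ln (c / b) - b * ln t)" by simp
  also have "\<dots> = exp (- b - b * ln (c / b)) * t powr (- b)"
    using t by (simp add: powr_def flip: exp_add)
  finally show "exp (- (c * t)) \<le> exp (- b - b * ln (c / b)) * t powr (- b)" .
qed

lemma set_integrable_powr_pieces:
  fixes p r :: real
  assumes "p > 0" "r < 0"
  shows "set_integrable lborel {0<..} (\<lambda>t. if t \<le> 1 then t powr (p - 1) else t powr (r - 1))"
proof -
  have I: "set_integrable lborel S (f :: real \<Rightarrow> real)"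
    if "f integrable_on S" "\<And>x. x \<in> S \<Longrightarrow> f x \<ge> 0" "f \<in> borel_measurable borel" "S \<in> sets borel" for f S
  proof -
    have "f absolutely_integrable_on S"
      using that(1,2) by (intro nonnegative_absolutely_integrable_1) auto
    then show ?thesis
      using that(3,4) unfolding set_integrable_def by (subst (asm) integrable_completion) auto
  qed
  have "set_integrable lborel {0..1} (\<lambda>t::real. t powr (p - 1))"
    by (rule I[OF integrable_on_powr_from_0]) (use assms in auto)
  moreover have "set_integrable lborel {1..} (\<lambda>t::real. t powr (r - 1))"
    by (rule I[OF has_integral_integrable[OF has_integral_powr_to_inf]]) (use assms in auto)
  ultimately have "integrable lborel (\<lambda>t::real. indicator {0..1} t *\<^sub>R t powr (p - 1) + indicator {1..} t *\<^sub>R t powr (r - 1))"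
    unfolding set_integrable_def by (rule Bochner_Integration.integrable_add)
  then show ?thesis unfolding set_integrable_def
    by (rule Bochner_Integration.integrable_bound) (auto simp: indicator_def)
qed

lemma Gamma_has_bochner_integral:
  fixes q c :: real
  assumes q: "q > 0" and c: "c > 0"
  shows "has_bochner_integral lborel (\<lambda>t. indicator {0<..} t * (t powr (q - 1) * exp (- (c * t)))) (Gamma q / c powr q)"
proof -
  have 1: "has_bochner_integral lborel (\<lambda>t. indicator {0..} t * t powr (q - 1) / exp t) (Gamma q)"
  proof (rule has_bochner_integral_nn_integral)
    show "(\<integral>\<^sup>+ t. ennreal (indicator {0..} t * t powr (q - 1) / exp t) \<partial>lborel) = ennreal (Gamma q)"
      using Gamma_conv_nn_integral_real[OF q] by simp
    show "Gamma q \<ge> 0" using q by (simp add: Gamma_real_pos less_imp_le)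
  qed auto
  have "has_bochner_integral lborel (\<lambda>t. indicator {0..} (0 + c * t) * (0 + c * t) powr (q - 1) / exp (0 + c * t)) (Gamma q /\<^sub>R \<bar>c\<bar>)"
    by (rule lborel_has_bochner_integral_real_affine_iff[THEN iffD1, OF _ 1]) (use c in simp)
  from has_bochner_integral_mult_right[OF this, of "c powr (1 - q)"]
  have 2: "has_bochner_integral lborel (\<lambda>t. c powr (1 - q) * (indicator {0..} (0 + c * t) * (0 + c * t) powr (q - 1) / exp (0 + c * t)))
     (c powr (1 - q) * (Gamma q /\<^sub>R \<bar>c\<bar>))" .
  have "c powr (1 - q) * (indicator {0..} (0 + c * t) * (0 + c * t) powr (q - 1) / exp (0 + c * t))
     = indicator {0<..} t * (t powr (q - 1) * exp (- (c * t)))" for t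
  proof (cases "t > 0")
    case True
    have "c powr (1 - q) * c powr (q - 1) = 1" using c by (simp flip: powr_add)
    then show ?thesis using True c
      by (simp add: powr_mult exp_minus field_simps)
  next
    case False
    then show ?thesis using c by (auto simp: indicator_def zero_le_mult_iff)
  qed
  moreover have "c powr (1 - q) * (Gamma q /\<^sub>R \<bar>c\<bar>) = Gamma q / c powr q"
    using c by (simp add: powr_diff field_simps)
  ultimately show ?thesis using 2 by simp
qed

text \<open>\<open>lborel\<close> on vectors is the image of a product measure indexed by
  \<open>Basis\<close>, whose elements are the \<open>axis i 1\<close>; reindexing along
  \<open>inv ?e\<close> carries the product formula over to coordinates.\<close>

lemma lborel_vec_integral_prod:
  fixes f :: "'n::finite \<Rightarrow> real \<Rightarrow> 'a::{real_normed_field,banach,second_countable_topology}"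
  assumes f: "\<And>i. integrable lborel (f i)"
  shows "integrable lborel (\<lambda>k::real^'n. \<Prod>i\<in>UNIV. f i (k $ i))"
    and "(LINT k::real^'n|lborel. (\<Prod>i\<in>UNIV. f i (k $ i))) = (\<Prod>i\<in>UNIV. (LINT t|lborel. f i t))"
proof -
  interpret product_sigma_finite "\<lambda>_::real^'n. lborel :: real measure" ..
  let ?e = "\<lambda>i::'n. axis i (1::real)"
  have inj: "inj ?e" by (auto simp: inj_on_def axis_eq_axis)
  have B: "Basis = range ?e" by (auto simp: Basis_vec_def)
  define F where "F = (\<lambda>b. f (inv ?e b))"
  have F: "F (?e i) = f i" for i using inv_f_f[OF inj, of i] by (simp add: F_def)
  let ?\<phi> = "\<lambda>g::real^'n \<Rightarrow> real. \<Sum>b\<in>Basis. g b *\<^sub>R b"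
  have [measurable]: "?\<phi> \<in> measurable (PiM Basis (\<lambda>_. lborel)) borel"
    by measurable
  have nth: "?\<phi> g $ i = g (?e i)" for g i
  proof -
    have "?\<phi> g $ i = ?\<phi> g \<bullet> ?e i" by (simp add: inner_axis)
    also have "\<dots> = g (?e i)" by (rule inner_sum_left_Basis) (simp add: B)
    finally show ?thesis .
  qed
  have prod: "(\<Prod>b\<in>Basis. F b (h b)) = (\<Prod>i\<in>UNIV. f i (h (?e i)))" for h
    unfolding B by (subst prod.reindex[OF inj]) (simp add: F)
  have [measurable]: "f i \<in> borel_measurable borel" for i
    using borel_measurable_integrable[OF f[of i]] by simp
  have m: "(\<lambda>k::real^'n. \<Prod>i\<in>UNIV. f i (k $ i)) \<in> borel_measurable borel"
    by (intro borel_measurable_prod measurable_compose[OF borel_measurable_continuous_onI[of "\<lambda>k. k $ i" for i]])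
      (auto intro!: continuous_intros)
  have FI: "integrable lborel (F b)" for b unfolding F_def by (rule f)
  have "integrable (PiM Basis (\<lambda>_. lborel)) (\<lambda>g. \<Prod>b\<in>Basis. F b (g b))"
    by (intro product_integrable_prod FI) simp
  then show "integrable lborel (\<lambda>k::real^'n. \<Prod>i\<in>UNIV. f i (k $ i))"
    unfolding lborel_eq[where 'a = "real^'n"]
    by (subst integrable_distr_eq[OF _ m]) (simp_all add: nth[simplified] prod)
  have "(LINT k::real^'n|lborel. (\<Prod>i\<in>UNIV. f i (k $ i))) = integral\<^sup>L (PiM Basis (\<lambda>_. lborel)) (\<lambda>g. \<Prod>b\<in>Basis. F b (g b))"
    unfolding lborel_eq[where 'a = "real^'n"]
    by (subst integral_distr[OF _ m]) (simp_all add: nth[simplified] prod)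
  also have "\<dots> = (\<Prod>b\<in>Basis. (LINT t|lborel. F b t))"
    by (intro product_integral_prod FI) simp
  also have "\<dots> = (\<Prod>i\<in>UNIV. (LINT t|lborel. f i t))"
    unfolding B by (subst prod.reindex[OF inj]) (simp add: F)
  finally show "(LINT k::real^'n|lborel. (\<Prod>i\<in>UNIV. f i (k $ i))) = (\<Prod>i\<in>UNIV. (LINT t|lborel. f i t))" .
qed

text \<open>The imaginary part is the integral of an odd function, so only the cosine
  remains.\<close>

lemma scaled_bessel_I_cis:
  shows "integrable lborel (\<lambda>\<theta>. indicator {-pi..pi} \<theta> *\<^sub>R (of_real (exp (- t * (1 - cos \<theta>))) * cis (\<theta> * \<nu>)))"
    and "(LINT \<theta>|lborel. indicator {-pi..pi} \<theta> *\<^sub>R (of_real (exp (- t * (1 - cos \<theta>))) * cis (\<theta> * \<nu>)))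
      = of_real (2 * pi * scaled_bessel_I \<nu> t)"
proof -
  let ?f = "\<lambda>\<theta>. of_real (exp (- t * (1 - cos \<theta>))) * cis (\<theta> * \<nu>)"
  have "set_integrable lborel {-pi..pi} ?f"
    by (intro borel_integrable_atLeastAtMost' continuous_intros)
  then show int: "integrable lborel (\<lambda>\<theta>. indicator {-pi..pi} \<theta> *\<^sub>R ?f \<theta>)"
    by (simp add: set_integrable_def)
  let ?J = "LINT \<theta>|lborel. indicator {-pi..pi} \<theta> *\<^sub>R ?f \<theta>"
  have "Re ?J = (LINT \<theta>|lborel. Re (indicator {-pi..pi} \<theta> *\<^sub>R ?f \<theta>))"
    by (rule integral_bounded_linear[OF bounded_linear_Re int, symmetric])
  also have "\<dots> = 2 * pi * scaled_bessel_I \<nu> t"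
    by (simp add: scaled_bessel_I_def set_lebesgue_integral_def mult.commute)
  finally have Re: "Re ?J = 2 * pi * scaled_bessel_I \<nu> t" .
  define g where "g = (\<lambda>\<theta>. indicator {-pi..pi} \<theta> * (exp (- t * (1 - cos \<theta>)) * sin (\<theta> * \<nu>)))"
  have Im: "Im ?J = (LINT \<theta>|lborel. g \<theta>)"
    using integral_bounded_linear[OF bounded_linear_Im int, symmetric] by (simp add: g_def)
  have "(LINT \<theta>|lborel. g \<theta>) = \<bar>-1\<bar> *\<^sub>R (LINT \<theta>|lborel. g (0 + -1 * \<theta>))"
    by (rule lborel_integral_real_affine) simp
  also have "(\<lambda>\<theta>. g (0 + -1 * \<theta>)) = (\<lambda>\<theta>. - g \<theta>)"
    by (rule ext) (auto simp: g_def indicator_def of_bool_def)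
  finally have "(LINT \<theta>|lborel. g \<theta>) = 0" by simp
  with Re Im show "?J = of_real (2 * pi * scaled_bessel_I \<nu> t)"
    by (simp add: complex_eq_iff)
qed

lemma scaled_bessel_I_0_bounds:
  assumes t: "t > 0"
  shows "0 \<le> scaled_bessel_I 0 t" "scaled_bessel_I 0 t \<le> 1" "scaled_bessel_I 0 t \<le> 3 / sqrt (2 * pi * t)"
proof -
  show "0 \<le> scaled_bessel_I 0 t"
    by (simp add: scaled_bessel_I_def set_lebesgue_integral_def)
  have "(LINT \<theta>:{-pi..pi}|lborel. exp (- t * (1 - cos \<theta>)) * cos (0 * \<theta>)) \<le> (LINT \<theta>:{-pi..pi}|lborel. 1)"
  proof (rule set_integral_mono)
    show "set_integrable lborel {- pi..pi} (\<lambda>\<theta>. exp (- t * (1 - cos \<theta>)) * cos (0 * \<theta>))"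
      by (intro borel_integrable_atLeastAtMost' continuous_intros)
    show "set_integrable lborel {- pi..pi} (\<lambda>\<theta>. 1::real)"
      by (intro borel_integrable_atLeastAtMost' continuous_intros)
    show "exp (- t * (1 - cos \<theta>)) * cos (0 * \<theta>) \<le> 1" for \<theta>
      using t by (simp add: mult_nonneg_nonneg)
  qed
  also have "\<dots> = 2 * pi" by (simp add: set_lebesgue_integral_def)
  finally show "scaled_bessel_I 0 t \<le> 1" by (simp add: scaled_bessel_I_def)
  have "\<bar>scaled_bessel_I 0 t\<bar> \<le> 3 * exp (debye_exponent 0 t) / sqrt (2 * pi * debye_radius 0 t)"
    by (rule scaled_bessel_I_bound) (use t in auto)
  then show "scaled_bessel_I 0 t \<le> 3 / sqrt (2 * pi * t)"
    using t by (simp add: debye_exponent_def debye_radius_def)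
qed

text \<open>Up to \<open>(2 pi)^d\<close>, the integrand at \<open>x = 0\<close> is the
  \<open>k\<close>-integral of the modulus of the Fourier integrand for any \<open>x\<close>, hence
  the quantity Fubini needs. For \<open>a = 0\<close> it decays like
  \<open>t powr (q - 1 - d / 2)\<close>, which is where \<open>2 q < d\<close> enters.\<close>

lemma green_integrand_0_integrable:
  fixes a q :: real
  assumes q: "q > 0" and a: "a \<noteq> 0 \<or> 2 * q < real CARD('n)"
  shows "set_integrable lborel {0<..} (green_integrand a q (0 :: real^'n::finite))"
proof (cases "a = 0")
  case False
  have "integrable lborel (\<lambda>t. indicator {0<..} t * (t powr (q - 1) * exp (- (a\<^sup>2 * real CARD('n) * t))))"
    using Gamma_has_bochner_integral[OF q, of "a\<^sup>2 * real CARD('n)"] False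
    by (simp add: has_bochner_integral_iff)
  then show ?thesis unfolding set_integrable_def
  proof (rule Bochner_Integration.integrable_bound)
    show "AE t in lborel. norm (indicator {0<..} t *\<^sub>R green_integrand a q (0 :: real^'n) t)
         \<le> norm (indicator {0<..} t * (t powr (q - 1) * exp (- (a\<^sup>2 * real CARD('n) * t))))"
    proof (rule AE_I2)
      fix t :: real
      show "norm (indicator {0<..} t *\<^sub>R green_integrand a q (0 :: real^'n) t)
         \<le> norm (indicator {0<..} t * (t powr (q - 1) * exp (- (a\<^sup>2 * real CARD('n) * t))))"
      proof (cases "t > 0")
        case True
        then have "\<bar>scaled_bessel_I 0 t\<bar> ^ CARD('n) \<le> 1"
          using scaled_bessel_I_0_bounds[OF True] by (intro power_le_one) auto
        with True show ?thesis
          by (simp add: green_integrand_def abs_mult power_abs mult_left_le)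
      qed simp
    qed
  qed measurable
next
  case True
  with a have d: "2 * q < real CARD('n)" by simp
  have "set_integrable lborel {0<..} (\<lambda>t. if t \<le> 1 then t powr (q - 1) else t powr ((q - real CARD('n) / 2) - 1))"
    by (rule set_integrable_powr_pieces) (use q d in auto)
  then have "integrable lborel (\<lambda>t. 2 ^ CARD('n) *
      (indicator {0<..} t *\<^sub>R (if t \<le> 1 then t powr (q - 1) else t powr ((q - real CARD('n) / 2) - 1))))"
    unfolding set_integrable_def by simp
  then show ?thesis unfolding set_integrable_def
  proof (rule Bochner_Integration.integrable_bound)
    show "AE t in lborel. norm (indicator {0<..} t *\<^sub>R green_integrand a q (0 :: real^'n) t)
         \<le> norm (2 ^ CARD('n) * (indicator {0<..} t *\<^sub>R (if t \<le> 1 then t powr (q - 1) else t powr ((q - real CARD('n) / 2) - 1))))"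
    proof (rule AE_I2)
      fix t :: real
      consider "t \<le> 0" | "0 < t" "t \<le> 1" | "t > 1" by linarith
      then show "norm (indicator {0<..} t *\<^sub>R green_integrand a q (0 :: real^'n) t)
         \<le> norm (2 ^ CARD('n) * (indicator {0<..} t *\<^sub>R (if t \<le> 1 then t powr (q - 1) else t powr ((q - real CARD('n) / 2) - 1))))"
      proof cases
        case 2
        then have "\<bar>scaled_bessel_I 0 t\<bar> ^ CARD('n) \<le> 2 ^ CARD('n)"
          using scaled_bessel_I_0_bounds[of t] by (intro power_mono) auto
        with 2 \<open>a = 0\<close> show ?thesis
          by (simp add: green_integrand_def abs_mult power_abs mult.commute mult_left_mono)
      next
        case 3
        then have t: "t > 0" by simp
        have "3 / sqrt (2 * pi * t) \<le> 2 * t powr (- 1 / 2)"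
        proof -
          have "3 / 2 \<le> sqrt (2 * pi)"
            using pi_gt3 by (intro real_le_rsqrt) (simp add: power2_eq_square)
          then show ?thesis using t
            by (simp add: powr_minus powr_half_sqrt real_sqrt_mult field_simps)
        qed
        then have "\<bar>scaled_bessel_I 0 t\<bar> \<le> 2 * t powr (- 1 / 2)"
          using scaled_bessel_I_0_bounds[OF t] by linarith
        then have "\<bar>scaled_bessel_I 0 t\<bar> ^ CARD('n) \<le> (2 * t powr (- 1 / 2)) ^ CARD('n)"
          by (intro power_mono) auto
        also have "\<dots> = 2 ^ CARD('n) * t powr (- (real CARD('n) / 2))"
          using t by (simp add: power_mult_distrib powr_realpow[symmetric] powr_powr)
        finally have "t powr (q - 1) * \<bar>scaled_bessel_I 0 t\<bar> ^ CARD('n) \<le> t powr (q - 1) * (2 ^ CARD('n) * t powr (- (real CARD('n) / 2)))"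
          by (intro mult_left_mono) auto
        also have "\<dots> = 2 ^ CARD('n) * t powr ((q - real CARD('n) / 2) - 1)"
          by (simp add: powr_add[symmetric] algebra_simps)
        finally show ?thesis using 3 \<open>a = 0\<close>
          by (simp add: green_integrand_def abs_mult power_abs)
      qed simp
    qed
  qed measurable
qed

lemma one_minus_D_hat_pos:
  fixes k :: "real^'n::finite"
  assumes "k \<in> cbox (\<chi> i. - pi) (\<chi> i. pi)" "k \<noteq> 0"
  shows "D_hat k < 1"
proof -
  obtain j where j: "k $ j \<noteq> 0" using assms(2) by (metis vec_eq_iff zero_index)
  have "\<bar>k $ j\<bar> \<le> pi" using assms(1) by (auto simp: mem_box_cart abs_le_iff) (smt (verit, best))
  then have "0 < 1 - cos (k $ j)"
    using one_minus_cos_lower[of "k $ j"] j by (smt (verit) divide_pos_pos zero_less_power2)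
  then have "(\<Sum>i\<in>UNIV. cos (k $ i)) < (\<Sum>i\<in>(UNIV::'n set). 1)"
    by (intro sum_strict_mono_ex1) auto
  then show ?thesis by (simp add: D_hat_def)
qed

lemma cis_measurable [measurable]: "cis \<in> borel_measurable borel"
  by (intro borel_measurable_continuous_onI continuous_intros)

lemma vec_nth_measurable [measurable]: "(\<lambda>k::real^'n::finite. k $ i) \<in> borel_measurable borel"
  by (intro borel_measurable_continuous_onI continuous_intros)

text \<open>The Gamma integral is used with rate \<open>d (a^2 + 1 - D_hat k)\<close>, because
  \<open>d (1 - D_hat k)\<close> is the sum of the \<open>1 - cos (k $ i)\<close>: the exponential
  then factorises over the coordinates, and the extra \<open>d\<close> in the rate becomes the
  prefactor \<open>d powr q\<close>.\<close>

theorem lattice_green_eq_integral: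
  fixes x :: "real^'n::finite"
  assumes q: "q > 0" and a: "a \<noteq> 0 \<or> 2 * q < real CARD('n)"
  shows "lattice_green a q x = of_real (real CARD('n) powr q / Gamma q * (LINT t:{0<..}|lborel. green_integrand a q x t))"
proof -
  let ?d = "real CARD('n)"
  let ?Q = "cbox (\<chi> i. - pi) (\<chi> i. pi) :: (real^'n) set"
  define h where "h = (\<lambda>t \<nu> \<theta>. indicator {-pi..pi} \<theta> *\<^sub>R (of_real (exp (- t * (1 - cos \<theta>))) * cis (\<theta> * \<nu>)))"
  define p where "p = (\<lambda>t. indicator {0<..} t * (t powr (q - 1) * exp (- a\<^sup>2 * ?d * t)))"
  define F :: "real \<Rightarrow> real^'n \<Rightarrow> complex"
    where "F = (\<lambda>t k. of_real (p t) * (\<Prod>i\<in>UNIV. h t (x $ i) (k $ i)))"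
  have [measurable]: "case_prod F \<in> borel_measurable (lborel \<Otimes>\<^sub>M lborel)"
    unfolding F_def p_def h_def by measurable
  have Fk: "integrable lborel (F t)" "(LINT k|lborel. F t k) = of_real ((2 * pi) ^ CARD('n) * (indicator {0<..} t * green_integrand a q x t))" for t
  proof -
    have i: "integrable lborel (h t (x $ i))" for i unfolding h_def by (rule scaled_bessel_I_cis)
    have I: "integral\<^sup>L lborel (h t \<nu>) = of_real (2 * pi * scaled_bessel_I \<nu> t)" for \<nu>
      unfolding h_def by (rule scaled_bessel_I_cis(2))
    show "integrable lborel (F t)"
      unfolding F_def using lborel_vec_integral_prod(1)[where f = "\<lambda>i. h t (x $ i)", OF i] by simp
    have "(LINT k|lborel. F t k) = of_real (p t) * (\<Prod>i\<in>UNIV. of_real (2 * pi * scaled_bessel_I (x $ i) t))"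
      unfolding F_def using lborel_vec_integral_prod(2)[where f = "\<lambda>i. h t (x $ i)", OF i]
      by (simp add: I)
    then show "(LINT k|lborel. F t k) = of_real ((2 * pi) ^ CARD('n) * (indicator {0<..} t * green_integrand a q x t))"
      by (simp add: p_def green_integrand_def prod.distrib power_mult_distrib)
  qed
  have nF: "(LINT k|lborel. norm (F t k)) = (2 * pi) ^ CARD('n) * (indicator {0<..} t * green_integrand a q (0::real^'n) t)" for t
  proof -
    define g where "g = (\<lambda>\<theta>. indicator {-pi..pi} \<theta> * exp (- t * (1 - cos \<theta>)))"
    have "set_integrable lborel {-pi..pi} (\<lambda>\<theta>. exp (- t * (1 - cos \<theta>)))"
      by (intro borel_integrable_atLeastAtMost' continuous_intros)
    then have g: "integrable lborel g" "integral\<^sup>L lborel g = 2 * pi * scaled_bessel_I 0 t"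
      by (simp_all add: set_integrable_def g_def scaled_bessel_I_def set_lebesgue_integral_def)
    have "norm (F t k) = p t * (\<Prod>i\<in>UNIV. g (k $ i))" for k
    proof -
      have "norm (h t \<nu> \<theta>) = g \<theta>" for \<nu> \<theta> by (simp add: h_def g_def norm_mult indicator_def)
      moreover have "p t \<ge> 0" by (simp add: p_def)
      ultimately show ?thesis by (simp add: F_def norm_mult prod_norm[symmetric])
    qed
    then have "(LINT k|lborel. norm (F t k)) = p t * (\<Prod>i\<in>(UNIV::'n set). integral\<^sup>L lborel g)"
      using lborel_vec_integral_prod(2)[where f = "\<lambda>i::'n. g", OF g(1)] by simp
    then show ?thesis by (simp add: g p_def green_integrand_def power_mult_distrib)
  qed
  have int: "integrable (lborel \<Otimes>\<^sub>M lborel) (case_prod F)"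
  proof (rule lborel_pair.Fubini_integrable)
    show "integrable lborel (\<lambda>t. LINT k|lborel. norm (case (t, k) of (t, k) \<Rightarrow> F t k))"
      using green_integrand_0_integrable[OF q a] unfolding set_integrable_def
      by (simp add: nF)
    show "AE t in lborel. integrable lborel (\<lambda>k. case (t, k) of (t, k) \<Rightarrow> F t k)"
      using Fk(1) by simp
  qed measurable
  have Ft: "(LINT t|lborel. F t k) = of_real (Gamma q / ?d powr q) *
      (indicator ?Q k *\<^sub>R (cis (k \<bullet> x) / of_real ((a\<^sup>2 + 1 - D_hat k) powr q)))" if k: "k \<noteq> 0" for k
  proof (cases "k \<in> ?Q")
    case False
    then obtain i where "k $ i \<notin> {-pi..pi}" by (auto simp: mem_box_cart)
    then have "h t (x $ i) (k $ i) = 0" for t by (simp add: h_def)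
    then have "(\<Prod>i\<in>UNIV. h t (x $ i) (k $ i)) = 0" for t by (intro prod_zero) auto
    then have "F t k = 0" for t by (simp only: F_def mult_zero_right)
    then show ?thesis using False by simp
  next
    case True
    define A where "A = a\<^sup>2 + 1 - D_hat k"
    have A: "A > 0" using one_minus_D_hat_pos[OF True k] using zero_le_power2[of a] unfolding A_def by linarith
    have "(\<Sum>i\<in>UNIV. 1 - cos (k $ i)) = ?d * (1 - D_hat k)"
      by (simp add: D_hat_def sum_subtractf field_simps)
    then have dA: "?d * A = a\<^sup>2 * ?d + (\<Sum>i\<in>UNIV. 1 - cos (k $ i))"
      by (simp add: A_def algebra_simps)
    have "(\<Prod>i\<in>UNIV. h t (x $ i) (k $ i)) = of_real (exp (- t * (\<Sum>i\<in>UNIV. 1 - cos (k $ i)))) * cis (k \<bullet> x)" for t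
    proof -
      have "(\<Prod>i\<in>UNIV. h t (x $ i) (k $ i)) = (\<Prod>i\<in>UNIV. of_real (exp (- t * (1 - cos (k $ i)))) * cis (k $ i * x $ i))"
        using True by (intro prod.cong) (auto simp: h_def mem_box_cart)
      also have "\<dots> = of_real (\<Prod>i\<in>UNIV. exp (- t * (1 - cos (k $ i)))) * (\<Prod>i\<in>UNIV. cis (k $ i * x $ i))"
        by (simp add: prod.distrib)
      also have "(\<Prod>i\<in>UNIV. cis (k $ i * x $ i)) = cis (k \<bullet> x)"
        by (simp add: inner_vec_def cis_conv_exp exp_sum[symmetric] sum_distrib_left)
      also have "(\<Prod>i\<in>UNIV. exp (- t * (1 - cos (k $ i)))) = exp (- t * (\<Sum>i\<in>UNIV. 1 - cos (k $ i)))"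
        by (simp add: exp_sum[symmetric] sum_distrib_left)
      finally show ?thesis .
    qed
    then have "F t k = of_real (indicator {0<..} t * (t powr (q - 1) * exp (- (?d * A * t)))) * cis (k \<bullet> x)" for t
      unfolding dA by (simp add: F_def p_def mult.assoc exp_add[symmetric] algebra_simps flip: of_real_mult)
    then have "(LINT t|lborel. F t k) = (LINT t|lborel. of_real (indicator {0<..} t * (t powr (q - 1) * exp (- (?d * A * t)))) * cis (k \<bullet> x))"
      by (simp only:)
    also have "\<dots> = of_real (LINT t|lborel. indicator {0<..} t * (t powr (q - 1) * exp (- (?d * A * t)))) * cis (k \<bullet> x)"
      by (simp only: integral_mult_left_zero integral_complex_of_real)
    also have "(LINT t|lborel. indicator {0<..} t * (t powr (q - 1) * exp (- (?d * A * t)))) = Gamma q / (?d * A) powr q"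
      using A by (intro has_bochner_integral_integral_eq Gamma_has_bochner_integral q) simp
    finally show ?thesis using True A by (simp add: A_def[symmetric] powr_mult)
  qed
  have c: "Gamma q / ?d powr q \<noteq> 0" using Gamma_real_pos[OF q] by simp
  have "of_real (Gamma q / ?d powr q) * (LINT k : ?Q | lborel. cis (k \<bullet> x) / of_real ((a\<^sup>2 + 1 - D_hat k) powr q))
      = (LINT k|lborel. of_real (Gamma q / ?d powr q) *
      (indicator ?Q k *\<^sub>R (cis (k \<bullet> x) / of_real ((a\<^sup>2 + 1 - D_hat k) powr q))))"
    unfolding set_lebesgue_integral_def by (simp only: integral_mult_right_zero)
  also have "\<dots> = (LINT k|lborel. (LINT t|lborel. F t k))"
  proof (rule integral_cong_AE)
    \<comment> \<open>The point \<open>k = 0\<close>, where the base of the power vanishes if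
      \<open>a = 0\<close>, is a null set.\<close>
    show "AE k in lborel. of_real (Gamma q / ?d powr q) *
      (indicator ?Q k *\<^sub>R (cis (k \<bullet> x) / of_real ((a\<^sup>2 + 1 - D_hat k) powr q))) = (LINT t|lborel. F t k)"
      using AE_lborel_singleton[of "0::real^'n"] by eventually_elim (simp add: Ft)
  qed (unfold D_hat_def, measurable)
  also have "\<dots> = (LINT t|lborel. (LINT k|lborel. F t k))"
    by (rule lborel_pair.Fubini_integral[OF int])
  also have "\<dots> = of_real ((2 * pi) ^ CARD('n) * (LINT t:{0<..}|lborel. green_integrand a q x t))"
    unfolding Fk(2) by (simp only: integral_complex_of_real set_lebesgue_integral_def real_scaleR_def integral_mult_right_zero)
  finally have "(LINT k : ?Q | lborel. cis (k \<bullet> x) / of_real ((a\<^sup>2 + 1 - D_hat k) powr q))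
     = of_real ((2 * pi) ^ CARD('n) * (LINT t:{0<..}|lborel. green_integrand a q x t)) / of_real (Gamma q / ?d powr q)"
    using c by (simp add: field_simps)
  then show ?thesis
    unfolding lattice_green_def by (simp add: field_simps)
qed

section \<open>Ornstein--Zernike decay\<close>

lemma int_lattice_nth_ge_1:
  assumes "x \<in> int_lattice" "x \<noteq> 0"
  obtains j where "\<bar>x $ j\<bar> \<ge> 1"
proof -
  obtain j where j: "x $ j \<noteq> 0" using assms(2) by (metis vec_eq_iff zero_index)
  have "x $ j \<in> \<int>" using assms(1) by (simp add: int_lattice_def)
  with j show ?thesis using that Ints_nonzero_abs_ge1 by blast
qed

section \<open>Homogeneity of the saddle data, and the Ornstein-Zernike constant\<close>

lemma int_lattice_scale: "x \<in> int_lattice \<Longrightarrow> real n *\<^sub>R x \<in> int_lattice"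
  by (simp add: int_lattice_def)

lemma u_par_scale:
  fixes x :: "real^'n::finite"
  assumes "a > 0" "x \<noteq> 0" "r > 0"
  shows "u_par a (r *\<^sub>R x) = u_par a x / r"
proof (rule u_par_unique)
  have "(\<Sum>i\<in>UNIV. sqrt (1 + ((r *\<^sub>R x) $ i)\<^sup>2 * (u_par a x / r)\<^sup>2)) = (\<Sum>i\<in>UNIV. sqrt (1 + (x $ i)\<^sup>2 * (u_par a x)\<^sup>2))"
    using assms(3) by (simp add: power_divide power_mult_distrib)
  also have "\<dots> = real CARD('n) * (1 + a\<^sup>2)" by (rule u_par_eq[OF assms(1,2)])
  finally show "(\<Sum>i\<in>UNIV. sqrt (1 + ((r *\<^sub>R x) $ i)\<^sup>2 * (u_par a x / r)\<^sup>2)) / real CARD('n) = 1 + a\<^sup>2"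
    by simp
qed (use assms u_par_gt_0[of a x] in auto)

lemma saddle_scale:
  assumes "a > 0" "x \<noteq> 0" "r > 0"
  shows "saddle a (r *\<^sub>R x) = r * saddle a x"
  using assms by (simp add: saddle_def u_par_scale)

lemma debye_radius_scale: "r > 0 \<Longrightarrow> debye_radius (r * \<nu>) (r * t) = r * debye_radius \<nu> t"
  by (simp add: debye_radius_def power_mult_distrib real_sqrt_mult flip: distrib_left)

lemma curvature_scale:
  assumes "a > 0" "x \<noteq> 0" "r > 0"
  shows "curvature a (r *\<^sub>R x) = r * curvature a x"
  unfolding curvature_def saddle_scale[OF assms] sum_distrib_left
  using assms(3) by (intro sum.cong) (simp_all add: debye_radius_scale power2_eq_square)

lemma aniso_norm_scale:
  assumes "a > 0" "x \<noteq> 0" "r > 0"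
  shows "aniso_norm a (r *\<^sub>R x) = r * aniso_norm a x"
  using assms by (simp add: aniso_norm_def u_par_scale sum_distrib_left mult.assoc)

text \<open>The saddle contributes the degree \<open>q\<close>, the \<open>d\<close> radii
  contribute \<open>- d / 2\<close> and the curvature \<open>- 1 / 2\<close>.\<close>

lemma saddle_amplitude_scale:
  fixes x :: "real^'n::finite"
  assumes "a > 0" "x \<noteq> 0" "r > 0"
  shows "saddle_amplitude a q (r *\<^sub>R x) = r powr (q - (real CARD('n) + 1) / 2) * saddle_amplitude a q x"
proof -
  have T: "saddle a x > 0" using assms saddle_pos by blast
  have M: "curvature a x > 0" using assms curvature_pos by blast
  have "(\<Prod>i\<in>UNIV. 1 / sqrt (2 * pi * debye_radius ((r *\<^sub>R x) $ i) (saddle a (r *\<^sub>R x))))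
     = (\<Prod>i\<in>(UNIV::'n set). 1 / sqrt r * (1 / sqrt (2 * pi * debye_radius (x $ i) (saddle a x))))"
    using assms by (simp add: saddle_scale debye_radius_scale real_sqrt_mult mult_ac)
  also have "\<dots> = r powr (- (real CARD('n) / 2)) * (\<Prod>i\<in>UNIV. 1 / sqrt (2 * pi * debye_radius (x $ i) (saddle a x)))"
  proof -
    have "(1 / sqrt r) ^ CARD('n) = r powr (- (real CARD('n) / 2))"
      using assms(3) by (simp add: powr_half_sqrt[symmetric] powr_minus_divide[symmetric] powr_realpow[symmetric] powr_powr)
    then show ?thesis by (simp only: prod.distrib prod_constant)
  qed
  finally have P: "(\<Prod>i\<in>UNIV. 1 / sqrt (2 * pi * debye_radius ((r *\<^sub>R x) $ i) (saddle a (r *\<^sub>R x))))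
    = r powr (- (real CARD('n) / 2)) * (\<Prod>i\<in>UNIV. 1 / sqrt (2 * pi * debye_radius (x $ i) (saddle a x)))" .
  have C: "sqrt (2 * pi / curvature a (r *\<^sub>R x)) = r powr (- (1 / 2)) * sqrt (2 * pi / curvature a x)"
    using assms M by (simp add: curvature_scale powr_minus_divide powr_half_sqrt real_sqrt_mult real_sqrt_divide)
  have "r powr (q - (real CARD('n) + 1) / 2) = r powr q * r powr (- (real CARD('n) / 2)) * r powr (- (1 / 2))"
    by (simp flip: powr_add add: add_divide_distrib diff_diff_eq)
  then show ?thesis
    unfolding saddle_amplitude_def P C
    using assms T by (simp add: saddle_scale powr_mult mult_ac)
qed

lemma saddle_amplitude_pos:
  fixes x :: "real^'n::finite"
  assumes "a > 0" "x \<noteq> 0"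
  shows "saddle_amplitude a q x > 0"
  unfolding saddle_amplitude_def
  using saddle_pos[OF assms] debye_radius_pos[OF saddle_pos[OF assms]] curvature_pos[OF assms]
  by (auto intro!: mult_pos_pos prod_pos)

text \<open>The exact saddle prefactor stripped of the power of the mass. At \<open>x\<close>
  divided by its norm, homogeneity of \<open>saddle_amplitude\<close> produces the factor
  \<open>aniso_norm a x powr ((d + 1 - 2 q) / 2)\<close>, which cancels the denominator of the
  claimed leading term.\<close>

definition oz_const :: "real \<Rightarrow> real \<Rightarrow> real^'n::finite \<Rightarrow> real" where
  "oz_const q a y = real CARD('n) powr q / Gamma q * saddle_amplitude a q y /
     mass CARD('n) a powr ((real CARD('n) - 1 - 2 * q) / 2)"

lemma oz_const_direction:
  fixes x :: "real^'n::finite"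
  assumes "a > 0" "x \<noteq> 0"
  shows "oz_const q a (x /\<^sub>R aniso_norm a x) = real CARD('n) powr q / Gamma q * saddle_amplitude a q x *
     aniso_norm a x powr ((real CARD('n) + 1 - 2 * q) / 2) / mass CARD('n) a powr ((real CARD('n) - 1 - 2 * q) / 2)"
proof -
  have N: "aniso_norm a x > 0" using assms by (rule aniso_norm_pos)
  have "inverse (aniso_norm a x) powr (q - (real CARD('n) + 1) / 2) = aniso_norm a x powr ((real CARD('n) + 1 - 2 * q) / 2)"
  proof -
    have "q - (real CARD('n) + 1) / 2 = - ((real CARD('n) + 1 - 2 * q) / 2)" by (simp add: field_simps)
    then show ?thesis using N by (simp add: powr_def ln_inverse)
  qed
  with N show ?thesis
    by (simp add: oz_const_def saddle_amplitude_scale[OF assms])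
qed

lemma oz_const_pos:
  fixes x :: "real^'n::finite"
  assumes "q > 0" "a > 0" "x \<noteq> 0"
  shows "oz_const q a (x /\<^sub>R aniso_norm a x) > 0"
  unfolding oz_const_direction[OF assms(2,3)]
  using assms aniso_norm_pos[OF assms(2,3)] saddle_amplitude_pos[OF assms(2,3)] mass_pos[of a "CARD('n)"] Gamma_real_pos[of q]
  by (intro divide_pos_pos mult_pos_pos) auto

text \<open>With this choice of the constant the claimed leading term is the saddle value itself,
  not merely asymptotic to it; the ratio in part (i) is then exactly the normalised profile
  integral.\<close>

lemma oz_leading_eq:
  fixes x :: "real^'n::finite" and n :: nat
  assumes "q > 0" "a > 0" "x \<noteq> 0" "n \<ge> 1"
  shows "oz_const q a (x /\<^sub>R aniso_norm a x) * (mass CARD('n) a powr ((real CARD('n) - 1 - 2 * q) / 2)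
       / (real n * aniso_norm a x) powr ((real CARD('n) + 1 - 2 * q) / 2)) * exp (- mass CARD('n) a * real n * aniso_norm a x)
    = real CARD('n) powr q / Gamma q * saddle_value a q (real n *\<^sub>R x)"
proof -
  have n: "real n > 0" using assms by simp
  have N: "aniso_norm a x > 0" using assms by (intro aniso_norm_pos)
  have m: "mass CARD('n) a > 0" using assms by (intro mass_pos) auto
  have nx: "real n *\<^sub>R x \<noteq> 0" using assms by simp
  have "phase a (real n *\<^sub>R x) (saddle a (real n *\<^sub>R x)) = - mass CARD('n) a * real n * aniso_norm a x"
    using phase_saddle[OF assms(2) nx] assms n by (simp add: aniso_norm_scale)
  moreover have "real n powr (q - (real CARD('n) + 1) / 2) = 1 / real n powr ((real CARD('n) + 1 - 2 * q) / 2)"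
  proof -
    have "q - (real CARD('n) + 1) / 2 = - ((real CARD('n) + 1 - 2 * q) / 2)" by (simp add: field_simps)
    then show ?thesis by (simp only: powr_minus_divide)
  qed
  ultimately show ?thesis
    unfolding oz_const_direction[OF assms(2,3)] saddle_value_def saddle_amplitude_scale[OF assms(2,3) n]
    using N m n by (simp add: powr_mult)
qed

section \<open>Divergence of saddle and curvature, uniformly over the lattice\<close>

lemma u_par_le:
  fixes x :: "real^'n::finite"
  assumes a: "a > 0" "a \<le> B" and x: "x \<in> int_lattice" "x \<noteq> 0"
  shows "u_par a x \<le> a * sqrt (2 * real CARD('n) + (real CARD('n) * B)\<^sup>2)"
proof -
  let ?d = "real CARD('n)" and ?u = "u_par a x"
  have u: "?u > 0" using a x by (intro u_par_gt_0)
  obtain j where j: "\<bar>x $ j\<bar> \<ge> 1" using x by (rule int_lattice_nth_ge_1)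
  \<comment> \<open>One coordinate of modulus at least 1 suffices: its term alone is at most
    \<open>d a^2\<close>, so \<open>sqrt (1 + u^2) \<le> 1 + d a^2\<close> and
    \<open>u^2 \<le> a^2 (2 d + (d a)^2)\<close>. The factor \<open>a\<close> is kept in front
    because \<open>a\<close> may tend to 0.\<close>
  have "1 * ?u\<^sup>2 \<le> (x $ j)\<^sup>2 * ?u\<^sup>2" using j by (intro mult_right_mono) (auto simp: power2_ge_1_iff)
  then have "sqrt (1 + ?u\<^sup>2) - 1 \<le> sqrt (1 + (x $ j)\<^sup>2 * ?u\<^sup>2) - 1" by simp
  also have "\<dots> \<le> (\<Sum>i\<in>UNIV. sqrt (1 + (x $ i)\<^sup>2 * ?u\<^sup>2) - 1)"
    by (rule member_le_sum) auto
  also have "\<dots> = ?d * a\<^sup>2"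
    using u_par_eq[OF a(1) x(2)] by (simp add: sum_subtractf algebra_simps)
  finally have "sqrt (1 + ?u\<^sup>2) \<le> 1 + ?d * a\<^sup>2" by simp
  then have "(sqrt (1 + ?u\<^sup>2))\<^sup>2 \<le> (1 + ?d * a\<^sup>2)\<^sup>2" by (intro power_mono) auto
  then have "?u\<^sup>2 \<le> a\<^sup>2 * (2 * ?d + (?d * a)\<^sup>2)"
    by (simp add: power2_eq_square algebra_simps)
  also have "\<dots> \<le> a\<^sup>2 * (2 * ?d + (?d * B)\<^sup>2)"
    using a by (intro mult_left_mono add_left_mono power_mono) auto
  finally have "sqrt (?u\<^sup>2) \<le> sqrt (a\<^sup>2 * (2 * ?d + (?d * B)\<^sup>2))" by (rule real_sqrt_le_mono)
  then show ?thesis using u a by (simp add: real_sqrt_mult)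
qed

text \<open>With \<open>s = sqrt (1 + x_i^2 u^2)\<close> the summand of the curvature is
  \<open>T (s^2 - 1) / s\<close>, and \<open>(s^2 - 1) / s \<ge> s - 1\<close> as
  \<open>s \<ge> 1\<close>; the \<open>s - 1\<close> sum to \<open>d a^2\<close> by the equation for
  \<open>u_par\<close>.\<close>

lemma curvature_ge:
  fixes x :: "real^'n::finite"
  assumes "a > 0" "x \<noteq> 0"
  shows "saddle a x * (real CARD('n) * a\<^sup>2) \<le> curvature a x"
proof -
  let ?u = "u_par a x"
  have u: "?u > 0" using assms by (rule u_par_gt_0)
  have "saddle a x * (real CARD('n) * a\<^sup>2) = (\<Sum>i\<in>UNIV. saddle a x * (sqrt (1 + (x $ i)\<^sup>2 * ?u\<^sup>2) - 1))"
    using u_par_eq[OF assms] by (simp add: sum_subtractf sum_distrib_left[symmetric] algebra_simps)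
  also have "\<dots> \<le> curvature a x"
    unfolding curvature_def
  proof (rule sum_mono)
    fix i
    define s where "s = sqrt (1 + (x $ i)\<^sup>2 * ?u\<^sup>2)"
    have s: "s \<ge> 1" "s\<^sup>2 = 1 + (x $ i)\<^sup>2 * ?u\<^sup>2" by (auto simp: s_def)
    have "s - 1 \<le> (s\<^sup>2 - 1) / s" using s(1) by (simp add: field_simps power2_eq_square)
    then have "saddle a x * (s - 1) \<le> saddle a x * ((s\<^sup>2 - 1) / s)"
      using saddle_pos[OF assms] by (intro mult_left_mono) auto
    also have "\<dots> = (x $ i)\<^sup>2 / (saddle a x * s)"
      unfolding s(2) using u by (simp add: saddle_def power2_eq_square)
    finally show "saddle a x * (sqrt (1 + (x $ i)\<^sup>2 * ?u\<^sup>2) - 1) \<le> (x $ i)\<^sup>2 / debye_radius (x $ i) (saddle a x)"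
      by (simp add: debye_radius_saddle[OF assms] s_def)
  qed
  finally show ?thesis .
qed

text \<open>By \<open>u_par_le\<close> the saddle is at least \<open>n / (a \<kappa>)\<close>. The
  first bound weakens \<open>a\<close> to \<open>B\<close>; the second keeps \<open>a\<close>, so
  that the factor \<open>d a^2\<close> of \<open>curvature_ge\<close> leaves order
  \<open>a n\<close>.\<close>

lemma saddle_curvature_lower:
  fixes x :: "real^'n::finite"
  assumes a: "a > 0" "a \<le> B" and x: "x \<in> int_lattice" "x \<noteq> 0" and n: "n \<ge> (1::nat)"
  defines "\<kappa> \<equiv> sqrt (2 * real CARD('n) + (real CARD('n) * B)\<^sup>2)"
  shows "real n / (B * \<kappa>) \<le> saddle a (real n *\<^sub>R x)"
    and "real CARD('n) / \<kappa> * (a * real n) \<le> curvature a (real n *\<^sub>R x)"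
proof -
  let ?u = "u_par a x"
  have \<kappa>: "\<kappa> > 0" by (simp add: \<kappa>_def add_pos_nonneg)
  have u: "?u > 0" "?u \<le> a * \<kappa>" using u_par_le[OF a x] u_par_gt_0[OF a(1) x(2)] by (auto simp: \<kappa>_def)
  have s: "1 / (a * \<kappa>) \<le> saddle a x" using u \<kappa> a by (simp add: saddle_def frac_le)
  have "1 / (B * \<kappa>) \<le> 1 / (a * \<kappa>)" using \<kappa> a by (intro divide_left_mono mult_right_mono) auto
  with s have "1 / (B * \<kappa>) \<le> saddle a x" by simp
  then have "real n * (1 / (B * \<kappa>)) \<le> real n * saddle a x" by (intro mult_left_mono) auto
  then show "real n / (B * \<kappa>) \<le> saddle a (real n *\<^sub>R x)"
    using a x n by (simp add: saddle_scale)
  have "real CARD('n) / \<kappa> * a = 1 / (a * \<kappa>) * (real CARD('n) * a\<^sup>2)"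
    using a \<kappa> by (simp add: field_simps power2_eq_square)
  also have "\<dots> \<le> saddle a x * (real CARD('n) * a\<^sup>2)" using s by (intro mult_right_mono) auto
  also have "\<dots> \<le> curvature a x" using a x by (intro curvature_ge)
  finally have "real n * (real CARD('n) / \<kappa> * a) \<le> real n * curvature a x" by (intro mult_left_mono) auto
  then show "real CARD('n) / \<kappa> * (a * real n) \<le> curvature a (real n *\<^sub>R x)"
    using a x n by (simp add: curvature_scale mult_ac)
qed

text \<open>If uniformity failed, there would be indices \<open>\<nu> k\<close> and points
  \<open>X k\<close> staying \<open>e\<close> away from the limit, against
  \<open>saddle_profile_integral_tendsto\<close>. Requiring \<open>\<nu> k \<ge> Suc k\<close> makes
  the indices diverge and keeps them at least 1.\<close>

lemma saddle_profile_integral_uniform: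
  fixes a :: "nat \<Rightarrow> real"
  assumes q: "q > 0" and a: "\<And>n. n \<ge> 1 \<Longrightarrow> a n > 0" and bdd: "bounded (a ` {1..})"
    and lim: "filterlim (\<lambda>n. a n * real n) at_top sequentially"
  shows "uniform_limit (int_lattice - {0 :: real^'n::finite})
     (\<lambda>n x. LINT z|lborel. saddle_profile (a n) q (real n *\<^sub>R x) (z / sqrt (curvature (a n) (real n *\<^sub>R x))))
     (\<lambda>_. sqrt (2 * pi)) sequentially"
proof (rule ccontr)
  define J where "J = (\<lambda>n (x::real^'n). LINT z|lborel. saddle_profile (a n) q (real n *\<^sub>R x) (z / sqrt (curvature (a n) (real n *\<^sub>R x))))"
  assume "\<not> ?thesis"
  then obtain e where e: "e > 0" and "\<not> (\<forall>\<^sub>F n in sequentially. \<forall>x\<in>int_lattice - {0}. dist (J n x) (sqrt (2 * pi)) < e)"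
    by (auto simp: uniform_limit_iff J_def)
  then have "\<forall>N. \<exists>n x. n \<ge> N \<and> x \<in> int_lattice - {0} \<and> \<not> dist (J n x) (sqrt (2 * pi)) < e"
    unfolding eventually_sequentially by blast
  then have "\<forall>k. \<exists>n x. n \<ge> Suc k \<and> x \<in> int_lattice - {0} \<and> \<not> dist (J n x) (sqrt (2 * pi)) < e"
    by blast
  then obtain \<nu> X where \<nu>: "\<And>k. \<nu> k \<ge> Suc k" and X: "\<And>k. X k \<in> int_lattice - {0}"
    and bad: "\<And>k. \<not> dist (J (\<nu> k) (X k)) (sqrt (2 * pi)) < e"
    by metis
  obtain B where B: "\<And>n. n \<ge> 1 \<Longrightarrow> a n \<le> B" and B0: "B > 0"
    using bdd unfolding bounded_pos by (auto simp: abs_le_iff)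
  define \<kappa> where "\<kappa> = sqrt (2 * real CARD('n) + (real CARD('n) * B)\<^sup>2)"
  have \<kappa>: "\<kappa> > 0" by (simp add: \<kappa>_def add_pos_nonneg)
  have \<nu>1: "\<nu> k \<ge> 1" for k using \<nu>[of k] by simp
  have \<nu>lim: "filterlim \<nu> at_top sequentially"
    by (rule filterlim_at_top_mono[OF filterlim_Suc]) (use \<nu> in \<open>auto intro!: always_eventually\<close>)
  have "(\<lambda>k. J (\<nu> k) (X k)) \<longlonglongrightarrow> sqrt (2 * pi)"
    unfolding J_def
  proof (rule saddle_profile_integral_tendsto[OF _ _ q])
    show "a (\<nu> k) > 0" for k using a \<nu>1 by blast
    show "real (\<nu> k) *\<^sub>R X k \<noteq> 0" for k using X[of k] \<nu>1[of k] by auto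
    have "filterlim (\<lambda>k. 1 / (B * \<kappa>) * real (\<nu> k)) at_top sequentially"
      using B0 \<kappa> by (intro filterlim_tendsto_pos_mult_at_top[OF tendsto_const]
        filterlim_compose[OF filterlim_real_sequentially \<nu>lim]) auto
    then show "filterlim (\<lambda>k. saddle (a (\<nu> k)) (real (\<nu> k) *\<^sub>R X k)) at_top sequentially"
    proof (rule filterlim_at_top_mono, intro always_eventually allI)
      fix k show "1 / (B * \<kappa>) * real (\<nu> k) \<le> saddle (a (\<nu> k)) (real (\<nu> k) *\<^sub>R X k)"
        using saddle_curvature_lower(1)[OF a[OF \<nu>1[of k]] B[OF \<nu>1[of k]] _ _ \<nu>1[of k], of "X k"] X[of k] by (simp add: \<kappa>_def)
    qed
    have "filterlim (\<lambda>k. real CARD('n) / \<kappa> * (a (\<nu> k) * real (\<nu> k))) at_top sequentially"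
      using \<kappa> by (intro filterlim_tendsto_pos_mult_at_top[OF tendsto_const]
        filterlim_compose[OF lim \<nu>lim]) auto
    then show "filterlim (\<lambda>k. curvature (a (\<nu> k)) (real (\<nu> k) *\<^sub>R X k)) at_top sequentially"
    proof (rule filterlim_at_top_mono, intro always_eventually allI)
      fix k show "real CARD('n) / \<kappa> * (a (\<nu> k) * real (\<nu> k)) \<le> curvature (a (\<nu> k)) (real (\<nu> k) *\<^sub>R X k)"
        using saddle_curvature_lower(2)[OF a[OF \<nu>1[of k]] B[OF \<nu>1[of k]] _ _ \<nu>1[of k], of "X k"] X[of k] by (simp add: \<kappa>_def)
    qed
  qed
  then have "\<forall>\<^sub>F k in sequentially. dist (J (\<nu> k) (X k)) (sqrt (2 * pi)) < e"
    using e by (rule tendstoD)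
  then show False using bad by (auto simp: eventually_sequentially)
qed

theorem ornstein_zernike_uniform:
  fixes a :: "nat \<Rightarrow> real"
  assumes q: "q > 0" and a: "\<And>n. n \<ge> 1 \<Longrightarrow> a n > 0" and bdd: "bounded (a ` {1..})"
    and lim: "filterlim (\<lambda>n. a n * real n) at_top sequentially"
  defines "R \<equiv> \<lambda>n (x::real^'n::finite). oz_const q (a n) (x /\<^sub>R aniso_norm (a n) x)
                  * (mass CARD('n) (a n) powr ((real CARD('n) - 1 - 2 * q) / 2)
                     / (real n * aniso_norm (a n) x) powr ((real CARD('n) + 1 - 2 * q) / 2))
                  * exp (- mass CARD('n) (a n) * real n * aniso_norm (a n) x)"
  shows "uniform_limit (int_lattice - {0})
                 (\<lambda>n x. lattice_green (a n) q (real n *\<^sub>R x) / complex_of_real (R n x))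
                 (\<lambda>_. 1) sequentially"
proof -
  define J where "J = (\<lambda>n (x::real^'n). LINT z|lborel. saddle_profile (a n) q (real n *\<^sub>R x) (z / sqrt (curvature (a n) (real n *\<^sub>R x))))"
  have eq: "lattice_green (a n) q (real n *\<^sub>R x) / complex_of_real (R n x) = complex_of_real (J n x / sqrt (2 * pi))"
    if n: "n \<ge> 1" and x: "x \<in> int_lattice - {0}" for n and x :: "real^'n"
  proof -
    have an: "a n > 0" using a n by blast
    have x': "x \<noteq> 0" "real n *\<^sub>R x \<in> int_lattice" "real n *\<^sub>R x \<noteq> 0"
      using x n by (auto intro: int_lattice_scale)
    have R: "R n x = real CARD('n) powr q / Gamma q * saddle_value (a n) q (real n *\<^sub>R x)"
      unfolding R_def by (rule oz_leading_eq[OF q an x'(1) n])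
    have "R n x \<noteq> 0"
      unfolding R using saddle_amplitude_pos[OF an x'(3), of q] Gamma_real_pos[OF q] by (simp add: saddle_value_def)
    moreover have "lattice_green (a n) q (real n *\<^sub>R x) = complex_of_real (R n x * (J n x / sqrt (2 * pi)))"
      using lattice_green_eq_integral[OF q, of "a n" "real n *\<^sub>R x"] an green_integral_saddle[OF an x'(2,3), of q]
      unfolding R J_def by (simp add: mult.assoc)
    ultimately show ?thesis by simp
  qed
  have "uniform_limit (int_lattice - {0}) J (\<lambda>_. sqrt (2 * pi)) sequentially"
    unfolding J_def by (rule saddle_profile_integral_uniform[OF q a bdd lim])
  then have J: "uniform_limit (int_lattice - {0}) (\<lambda>n x. complex_of_real (J n x / sqrt (2 * pi))) (\<lambda>_. complex_of_real (sqrt (2 * pi) / sqrt (2 * pi))) sequentially"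
    by (intro bounded_linear.uniform_limit[OF bounded_linear_of_real] bounded_linear.uniform_limit[OF bounded_linear_divide])
  show ?thesis
  proof (rule uniform_limit_cong[THEN iffD2, OF _ _ J])
    show "\<forall>\<^sub>F n in sequentially. \<forall>x\<in>int_lattice - {0}.
       lattice_green (a n) q (real n *\<^sub>R x) / complex_of_real (R n x) = complex_of_real (J n x / sqrt (2 * pi))"
      using eventually_ge_at_top[of "1::nat"] by eventually_elim (use eq in blast)
  qed simp
qed

section \<open>The direction-independent limit of the constants as \<open>a\<close> tends to
  0\<close>

lemma mass_tendsto_0: "((\<lambda>a. mass d a) \<longlongrightarrow> 0) (at_right 0)"
proof (rule order_tendstoI)
  fix e :: real assume "e < 0"
  then show "\<forall>\<^sub>F a in at_right 0. e < mass d a"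
    using mass_nonneg by (intro always_eventually allI) (rule less_le_trans)
next
  fix e :: real assume e: "e > 0"
  have "cosh 0 < cosh e" using e by (intro cosh_real_strict_mono) auto
  then have "1 < cosh e" by simp
  moreover have "((\<lambda>a. 1 + real d * a\<^sup>2) \<longlongrightarrow> 1 + real d * 0\<^sup>2) (at_right 0)"
    by (intro tendsto_intros)
  ultimately have "\<forall>\<^sub>F a in at_right 0. 1 + real d * a\<^sup>2 < cosh e"
    by (intro order_tendstoD(2)[of _ 1]) auto
  then show "\<forall>\<^sub>F a in at_right 0. mass d a < e"
  proof eventually_elim
    case (elim a)
    show ?case
    proof (rule ccontr)
      assume "\<not> mass d a < e"
      then have "cosh e \<le> cosh (mass d a)" using e by (intro cosh_real_nonneg_le_iff[THEN iffD2]) auto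
      with elim show False by (simp add: cosh_mass)
    qed
  qed
qed

lemma u_par_tendsto_0:
  fixes x :: "real^'n::finite"
  assumes "x \<in> int_lattice" "x \<noteq> 0"
  shows "filterlim (\<lambda>a. u_par a x) (at_right 0) (at_right 0)"
proof -
  define C where "C = sqrt (2 * real CARD('n) + (real CARD('n) * 1)\<^sup>2)"
  have pos: "\<forall>\<^sub>F a in at_right 0. u_par a x > 0"
    using eventually_at_right_less[of 0] by eventually_elim (rule u_par_gt_0[OF _ assms(2)])
  have ub: "\<forall>\<^sub>F a in at_right 0. u_par a x \<le> a * C"
    using eventually_at_right_real[of 0 1, OF zero_less_one]
  proof eventually_elim
    case (elim a)
    then show ?case unfolding C_def by (intro u_par_le assms) auto
  qed
  have "((\<lambda>a. a * C) \<longlongrightarrow> 0 * C) (at_right 0)" by (intro tendsto_intros)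
  then have lim: "((\<lambda>a. a * C) \<longlongrightarrow> 0) (at_right 0)" by simp
  have "\<forall>\<^sub>F a in at_right 0. 0 \<le> u_par a x"
    using pos by eventually_elim simp
  then have "((\<lambda>a. u_par a x) \<longlongrightarrow> 0) (at_right 0)"
    by (rule tendsto_sandwich[OF _ ub tendsto_const lim])
  then show ?thesis
    unfolding filterlim_at using pos by (auto elim!: eventually_mono)
qed

text \<open>For small \<open>u\<close> only the quadratic coefficient of \<open>g\<close> survives,
  and squared coordinates add up to the squared Euclidean norm: this is where the anisotropy
  disappears.\<close>

lemma sum_quadratic_limit:
  fixes x :: "real^'n::finite" and g :: "real \<Rightarrow> real"
  assumes "g 0 = 0" and g: "((\<lambda>b. g b / b\<^sup>2) \<longlongrightarrow> L) (at 0)"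
  shows "((\<lambda>u. (\<Sum>i\<in>UNIV. g (x $ i * u)) / u\<^sup>2) \<longlongrightarrow> L * (norm x)\<^sup>2) (at_right 0)"
proof -
  have "((\<lambda>u. g (x $ i * u) / u\<^sup>2) \<longlongrightarrow> L * (x $ i)\<^sup>2) (at_right 0)" for i
  proof (cases "x $ i = 0")
    case False
    have "filterlim (\<lambda>u. x $ i * u) (at 0) (at_right 0)"
    proof (rule filterlim_atI)
      have "((\<lambda>u. x $ i * u) \<longlongrightarrow> x $ i * 0) (at_right 0)" by (intro tendsto_intros)
      then show "((\<lambda>u. x $ i * u) \<longlongrightarrow> 0) (at_right 0)" by simp
      show "\<forall>\<^sub>F u in at_right 0. x $ i * u \<noteq> 0"
        using eventually_at_right_less[of 0] by eventually_elim (use False in auto)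
    qed
    from filterlim_compose[OF g this]
    have "((\<lambda>u. g (x $ i * u) / (x $ i * u)\<^sup>2 * (x $ i)\<^sup>2) \<longlongrightarrow> L * (x $ i)\<^sup>2) (at_right 0)"
      by (intro tendsto_mult tendsto_const)
    then show ?thesis using False by (simp add: power_mult_distrib)
  qed (simp add: assms)
  then have "((\<lambda>u. \<Sum>i\<in>UNIV. g (x $ i * u) / u\<^sup>2) \<longlongrightarrow> (\<Sum>i\<in>UNIV. L * (x $ i)\<^sup>2)) (at_right 0)"
    by (intro tendsto_sum)
  then show ?thesis
    by (simp add: sum_divide_distrib sum_distrib_left[symmetric] norm_vec_def L2_set_def sum_nonneg)
qed

theorem oz_const_tendsto:
  fixes x :: "real^'n::finite"
  assumes q: "q > 0" and x: "x \<in> int_lattice" "x \<noteq> 0"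
  shows "((\<lambda>a. oz_const q a (x /\<^sub>R aniso_norm a x)) \<longlongrightarrow>
      real CARD('n) powr q / ((2 * pi) powr ((real CARD('n) - 1) / 2) * Gamma q)) (at_right 0)"
proof -
  let ?d = "real CARD('n)"
  let ?S = "(norm x)\<^sup>2"
  define u where "u = (\<lambda>a. u_par a x)"
  define m where "m = (\<lambda>a. mass CARD('n) a)"
  have S: "?S > 0" using x by simp
  have u: "filterlim u (at_right 0) (at_right 0)" unfolding u_def by (rule u_par_tendsto_0[OF x])
  then have u0: "(u \<longlongrightarrow> 0) (at_right 0)" by (simp add: filterlim_at)
  have m0: "(m \<longlongrightarrow> 0) (at_right 0)" unfolding m_def by (rule mass_tendsto_0)
  have ev: "\<forall>\<^sub>F a in at_right (0::real). a > 0" by (rule eventually_at_right_less)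
  have "\<forall>\<^sub>F a in at_right 0. m a \<noteq> 0"
    using ev by eventually_elim (use mass_pos[of _ "CARD('n)"] in \<open>force simp: m_def\<close>)
  with m0 have m: "filterlim m (at 0) (at_right 0)" by (rule filterlim_atI)

  \<comment> \<open>Both \<open>cosh m - 1\<close> and the sum of the
    \<open>sqrt (1 + x_i^2 u^2) - 1\<close> equal \<open>d a^2\<close>; comparing their quadratic
    parts yields \<open>u^2 / m^2 \<rightarrow> 1 / |x|^2\<close> with the Euclidean norm.\<close>
  have "((\<lambda>b::real. (cosh b - 1) / b\<^sup>2) \<longlongrightarrow> 1 / 2) (at 0)" by real_asymp
  from filterlim_compose[OF this m]
  have l1: "((\<lambda>a. (cosh (m a) - 1) / (m a)\<^sup>2) \<longlongrightarrow> 1 / 2) (at_right 0)" .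
  have "((\<lambda>b::real. (sqrt (1 + b\<^sup>2) - 1) / b\<^sup>2) \<longlongrightarrow> 1 / 2) (at 0)" by real_asymp
  from filterlim_compose[OF sum_quadratic_limit[OF _ this] u]
  have "((\<lambda>a. (\<Sum>i\<in>UNIV. sqrt (1 + (x $ i * u a)\<^sup>2) - 1) / (u a)\<^sup>2) \<longlongrightarrow> 1 / 2 * ?S) (at_right 0)" by simp
  moreover have "\<forall>\<^sub>F a in at_right 0. (\<Sum>i\<in>UNIV. sqrt (1 + (x $ i * u a)\<^sup>2) - 1) / (u a)\<^sup>2 = (cosh (m a) - 1) / (u a)\<^sup>2"
    using ev
  proof eventually_elim
    case (elim a)
    show ?case using u_par_eq[OF elim x(2)]
      by (simp add: u_def m_def cosh_mass sum_subtractf power_mult_distrib algebra_simps)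
  qed
  ultimately have l2: "((\<lambda>a. (cosh (m a) - 1) / (u a)\<^sup>2) \<longlongrightarrow> 1 / 2 * ?S) (at_right 0)"
    by (rule Lim_transform_eventually)
  have r: "((\<lambda>a. (u a)\<^sup>2 / (m a)\<^sup>2) \<longlongrightarrow> 1 / ?S) (at_right 0)"
  proof -
    have "((\<lambda>a. (cosh (m a) - 1) / (m a)\<^sup>2 / ((cosh (m a) - 1) / (u a)\<^sup>2)) \<longlongrightarrow> 1 / 2 / (1 / 2 * ?S)) (at_right 0)"
      by (intro tendsto_divide l1 l2) (use S in auto)
    moreover have "\<forall>\<^sub>F a in at_right 0. (cosh (m a) - 1) / (m a)\<^sup>2 / ((cosh (m a) - 1) / (u a)\<^sup>2) = (u a)\<^sup>2 / (m a)\<^sup>2"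
      using ev
    proof eventually_elim
      case (elim a)
      then have "cosh (m a) - 1 \<noteq> 0" by (simp add: m_def cosh_mass)
      then show ?case by simp
    qed
    ultimately show ?thesis by (simp add: Lim_transform_eventually)
  qed
  have "((\<lambda>b::real. b * arsinh b / b\<^sup>2) \<longlongrightarrow> 1) (at 0)" by real_asymp
  from filterlim_compose[OF sum_quadratic_limit[OF _ this] u]
  have "((\<lambda>a. (\<Sum>i\<in>UNIV. x $ i * u a * arsinh (x $ i * u a)) / (u a)\<^sup>2) \<longlongrightarrow> 1 * ?S) (at_right 0)" by simp
  from tendsto_mult[OF this r]
  have P0: "((\<lambda>a. (\<Sum>i\<in>UNIV. x $ i * u a * arsinh (x $ i * u a)) / (u a)\<^sup>2 * ((u a)\<^sup>2 / (m a)\<^sup>2)) \<longlongrightarrow> 1) (at_right 0)"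
    using S by simp
  have "((\<lambda>b::real. b\<^sup>2 / sqrt (1 + b\<^sup>2) / b\<^sup>2) \<longlongrightarrow> 1) (at 0)" by real_asymp
  from filterlim_compose[OF sum_quadratic_limit[OF _ this] u]
  have "((\<lambda>a. (\<Sum>i\<in>UNIV. (x $ i * u a)\<^sup>2 / sqrt (1 + (x $ i * u a)\<^sup>2)) / (u a)\<^sup>2) \<longlongrightarrow> 1 * ?S) (at_right 0)" by simp
  from tendsto_mult[OF this r]
  have Q0: "((\<lambda>a. (\<Sum>i\<in>UNIV. (x $ i * u a)\<^sup>2 / sqrt (1 + (x $ i * u a)\<^sup>2)) / (u a)\<^sup>2 * ((u a)\<^sup>2 / (m a)\<^sup>2)) \<longlongrightarrow> 1) (at_right 0)"
    using S by simp
  \<comment> \<open>With \<open>T = 1 / u\<close>, the norm is \<open>T m P\<close>, the curvature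
    is \<open>T m^2 Q\<close>, and \<open>W\<close> collects the inverse square roots of the radii
    divided by \<open>T\<close>. All three tend to 1.\<close>
  define P where "P = (\<lambda>a. (\<Sum>i\<in>UNIV. x $ i * u a * arsinh (x $ i * u a)) / (m a)\<^sup>2)"
  define Q where "Q = (\<lambda>a. (\<Sum>i\<in>UNIV. (x $ i * u a)\<^sup>2 / sqrt (1 + (x $ i * u a)\<^sup>2)) / (m a)\<^sup>2)"
  have upos: "\<forall>\<^sub>F a in at_right 0. u a > 0"
    using ev by eventually_elim (use x in \<open>auto simp: u_def intro: u_par_gt_0\<close>)
  have P: "(P \<longlongrightarrow> 1) (at_right 0)"
    by (rule Lim_transform_eventually[OF P0]) (use upos in \<open>eventually_elim, simp add: P_def\<close>)
  have Q: "(Q \<longlongrightarrow> 1) (at_right 0)"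
    by (rule Lim_transform_eventually[OF Q0]) (use upos in \<open>eventually_elim, simp add: Q_def\<close>)
  define W where "W = (\<lambda>a. \<Prod>i\<in>UNIV. 1 / sqrt (sqrt (1 + (x $ i * u a)\<^sup>2)))"
  have "(W \<longlongrightarrow> (\<Prod>i\<in>(UNIV::'n set). 1 / sqrt (sqrt (1 + (x $ i * 0)\<^sup>2)))) (at_right 0)"
    unfolding W_def by (intro tendsto_intros u0) auto
  then have W: "(W \<longlongrightarrow> 1) (at_right 0)" by simp
  let ?C = "?d powr q / ((2 * pi) powr ((?d - 1) / 2) * Gamma q)"
  have "((\<lambda>a. ?C * (P a powr ((?d + 1 - 2 * q) / 2) * W a / sqrt (Q a))) \<longlongrightarrow> ?C * (1 powr ((?d + 1 - 2 * q) / 2) * 1 / sqrt 1)) (at_right 0)"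
    by (intro tendsto_intros P Q W) auto
  then have "((\<lambda>a. ?C * (P a powr ((?d + 1 - 2 * q) / 2) * W a / sqrt (Q a))) \<longlongrightarrow> ?C) (at_right 0)" by simp
  moreover have "\<forall>\<^sub>F a in at_right 0. ?C * (P a powr ((?d + 1 - 2 * q) / 2) * W a / sqrt (Q a)) = oz_const q a (x /\<^sub>R aniso_norm a x)"
    using ev
  proof eventually_elim
    case (elim a)
    define T where "T = saddle a x"
    have T: "T > 0" using saddle_pos[OF elim x(2)] by (simp add: T_def)
    have ua: "u a = 1 / T" "u a > 0" using u_par_gt_0[OF elim x(2)] by (simp_all add: T_def saddle_def u_def)
    have ma: "m a > 0" unfolding m_def using elim by (intro mass_pos) auto
    have N: "aniso_norm a x > 0" by (rule aniso_norm_pos[OF elim x(2)])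
    have Pa: "aniso_norm a x = T * m a * P a"
    proof -
      have "u_par a x = 1 / T" using ua(1) by (simp add: u_def)
      then show ?thesis
        using x ma T unfolding aniso_norm_def P_def ua(1)
        by (simp add: m_def[symmetric] sum_divide_distrib[symmetric] power2_eq_square)
    qed
    have "0 < T * m a" using T ma by simp
    with N have P0: "P a > 0" unfolding Pa by (rule zero_less_mult_pos)
    have r: "debye_radius (x $ i) T = T * sqrt (1 + (x $ i * u a)\<^sup>2)" for i
      using debye_radius_saddle[OF elim x(2), of i] by (simp add: T_def u_def power_mult_distrib)
    have Qa: "curvature a x = T * (m a)\<^sup>2 * Q a"
    proof -
      have "curvature a x = (\<Sum>i\<in>UNIV. T * ((x $ i * u a)\<^sup>2 / sqrt (1 + (x $ i * u a)\<^sup>2)))"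
        unfolding curvature_def T_def[symmetric] r
        using T by (intro sum.cong) (simp_all add: ua(1) power2_eq_square)
      moreover have "(m a)\<^sup>2 * Q a = (\<Sum>i\<in>UNIV. (x $ i * u a)\<^sup>2 / sqrt (1 + (x $ i * u a)\<^sup>2))"
        using ma by (simp add: Q_def)
      ultimately show ?thesis by (simp only: mult.assoc sum_distrib_left)
    qed
    have "0 < T * (m a)\<^sup>2" using T ma by simp
    with curvature_pos[OF elim x(2)] have Q0: "Q a > 0" unfolding Qa by (rule zero_less_mult_pos)
    have W: "(\<Prod>i\<in>UNIV. 1 / sqrt (2 * pi * debye_radius (x $ i) T)) = (2 * pi * T) powr (- (?d / 2)) * W a"
    proof -
      have "(\<Prod>i\<in>UNIV. 1 / sqrt (2 * pi * debye_radius (x $ i) T))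
          = (\<Prod>i\<in>(UNIV::'n set). 1 / sqrt (2 * pi * T) * (1 / sqrt (sqrt (1 + (x $ i * u a)\<^sup>2))))"
        unfolding r by (simp add: real_sqrt_mult mult_ac)
      moreover have "(1 / sqrt (2 * pi * T)) ^ CARD('n) = (2 * pi * T) powr (- (?d / 2))"
        using T by (simp add: powr_half_sqrt[symmetric] powr_minus_divide[symmetric] powr_realpow[symmetric] powr_powr)
      ultimately show ?thesis unfolding W_def by (simp only: prod.distrib prod_constant)
    qed
    \<comment> \<open>Logarithms turn the identity marked \<open>*\<close> into linear algebra of
      exponents: all powers of \<open>T\<close> and of \<open>m a\<close> cancel, and
      \<open>2 pi\<close> is left with the exponent \<open>- (d - 1) / 2\<close>.\<close>
    define lT where "lT = ln T"
    define lm where "lm = ln (m a)"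
    define lP where "lP = ln (P a)"
    define lQ where "lQ = ln (Q a)"
    define l2 where "l2 = ln (2 * pi)"
    have eT: "T = exp lT" using T by (simp add: lT_def)
    have em: "m a = exp lm" using ma by (simp add: lm_def)
    have eP: "P a = exp lP" using P0 by (simp add: lP_def)
    have eQ: "Q a = exp lQ" using Q0 by (simp add: lQ_def)
    have e2: "2 * pi = exp l2" by (simp add: l2_def)
    have sq: "sqrt (exp y) = exp (y / 2)" for y :: real
      by (simp add: real_sqrt_eq_iff powr_half_sqrt[symmetric] exp_powr_real)
    have *: "T powr q * (2 * pi * T) powr (- (?d / 2)) * sqrt (2 * pi / (T * (m a)\<^sup>2 * Q a)) *
        (T * m a * P a) powr ((?d + 1 - 2 * q) / 2) / m a powr ((?d - 1 - 2 * q) / 2)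
       = P a powr ((?d + 1 - 2 * q) / 2) / sqrt (Q a) / (2 * pi) powr ((?d - 1) / 2)"
      unfolding em eP eQ e2 eT power2_eq_square exp_powr_real exp_add[symmetric] exp_diff[symmetric] sq
      by (simp add: field_simps)
    have "oz_const q a (x /\<^sub>R aniso_norm a x) = ?d powr q / Gamma q * W a * (T powr q * (2 * pi * T) powr (- (?d / 2)) * sqrt (2 * pi / (T * (m a)\<^sup>2 * Q a)) *
        (T * m a * P a) powr ((?d + 1 - 2 * q) / 2) / m a powr ((?d - 1 - 2 * q) / 2))"
      unfolding oz_const_direction[OF elim x(2)]
      unfolding saddle_amplitude_def T_def[symmetric] W Qa Pa m_def[symmetric]
      by (simp add: mult_ac)
    then show ?case unfolding * by (simp add: mult_ac)
  qed
  ultimately show ?thesis by (rule Lim_transform_eventually)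
qed

section \<open>Critical decay\<close>

text \<open>The bracket depends on the ratio \<open>\<nu> / t\<close> alone and is
  \<open>- (\<nu> / t)^2 / 2\<close> to leading order, the form suited to diffusive scaling.\<close>

lemma debye_exponent_scaled:
  assumes t: "t > 0"
  shows "debye_exponent \<nu> t = t * (sqrt (1 + (\<nu> / t)\<^sup>2) - 1 - \<nu> / t * arsinh (\<nu> / t))"
proof -
  have "\<nu>\<^sup>2 + t\<^sup>2 = t\<^sup>2 * (1 + (\<nu> / t)\<^sup>2)" using t by (simp add: field_simps)
  then have "debye_radius \<nu> t = t * sqrt (1 + (\<nu> / t)\<^sup>2)"
    using t by (simp add: debye_radius_def real_sqrt_mult)
  then show ?thesis using t by (simp add: debye_exponent_def algebra_simps)
qed

text \<open>With \<open>c = sinh z\<close> this is \<open>tanh (z / 2) \<le> z / 2\<close> in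
  disguise. It yields both the sign of \<open>debye_exponent\<close> and its monotonicity along
  parabolas.\<close>

lemma arsinh_quadratic_lower:
  fixes c :: real
  shows "2 * (sqrt (1 + c\<^sup>2) - 1) \<le> c * arsinh c"
proof -
  have nonneg: "2 * (cosh z - 1) \<le> z * sinh z" if z: "z \<ge> 0" for z :: real
  proof -
    have "sinh y \<le> y * cosh y" if y: "y \<ge> 0" for y :: real
    proof -
      define f where "f = (\<lambda>y::real. y * cosh y - sinh y)"
      have "f 0 \<le> f y"
      proof (rule DERIV_nonneg_imp_nondecreasing[of 0 y f, OF y])
        fix x :: real assume "0 \<le> x"
        then show "\<exists>d. (f has_real_derivative d) (at x) \<and> 0 \<le> d"
          unfolding f_def by (intro exI[of _ "x * sinh x"]) (auto intro!: derivative_eq_intros)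
      qed
      then show ?thesis by (simp add: f_def)
    qed
    note s = this
    define f where "f = (\<lambda>y::real. y * sinh y - 2 * (cosh y - 1))"
    have "f 0 \<le> f z"
    proof (rule DERIV_nonneg_imp_nondecreasing[of 0 z f, OF z])
      fix x :: real assume "0 \<le> x"
      then show "\<exists>d. (f has_real_derivative d) (at x) \<and> 0 \<le> d"
        unfolding f_def using s[of x]
        by (intro exI[of _ "x * cosh x - sinh x"]) (auto intro!: derivative_eq_intros)
    qed
    then show ?thesis by (simp add: f_def)
  qed
  have all: "2 * (cosh z - 1) \<le> z * sinh z" for z :: real
    using nonneg[of z] nonneg[of "-z"] by (cases "z \<ge> 0") auto
  from all[of "arsinh c"] show ?thesis
    by (simp add: cosh_arsinh_real add.commute mult.commute)
qed

lemma debye_exponent_nonpos: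
  assumes "t > 0"
  shows "debye_exponent \<nu> t \<le> 0"
proof -
  have "A - 1 - B \<le> 0" if "2 * (A - 1) \<le> B" "0 \<le> A - 1" for A B :: real
    using that by simp
  from this[OF arsinh_quadratic_lower[of "\<nu> / t"]]
  have "sqrt (1 + (\<nu> / t)\<^sup>2) - 1 - \<nu> / t * arsinh (\<nu> / t) \<le> 0" by simp
  then show ?thesis unfolding debye_exponent_scaled[OF assms]
    using assms by (intro mult_nonneg_nonpos) auto
qed

text \<open>Along a parabola \<open>\<nu>\<^sup>2 / t = const\<close> the exponent decreases; this makes the diffusively rescaled
  integrands comparable with a single one.\<close>

lemma debye_exponent_parabola_antimono:
  fixes n m :: real
  assumes t: "t > 0" and nm: "0 < n" "n \<le> m"
  shows "debye_exponent (m * \<nu>) (m\<^sup>2 * t) \<le> debye_exponent (n * \<nu>) (n\<^sup>2 * t)"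
proof -
  define b where "b = \<nu> / t"
  \<comment> \<open>Up to the factor \<open>- t\<close>, \<open>\<phi> l\<close> is the exponent at
    order \<open>l \<nu>\<close> and argument \<open>l^2 t\<close>. With \<open>c = b / l\<close>
    its derivative is \<open>l (c arsinh c - 2 (sqrt (1 + c^2) - 1))\<close>, nonnegative by
    \<open>arsinh_quadratic_lower\<close>.\<close>
  define \<phi> where "\<phi> = (\<lambda>l. - (l\<^sup>2 * (sqrt (1 + (b / l)\<^sup>2) - 1 - b / l * arsinh (b / l))))"
  have eq: "debye_exponent (l * \<nu>) (l\<^sup>2 * t) = - (t * \<phi> l)" if "l > 0" for l
  proof -
    have "l * \<nu> / (l\<^sup>2 * t) = b / l" using that t by (simp add: b_def power2_eq_square)
    moreover have "l\<^sup>2 * t > 0" using that t by simp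
    ultimately show ?thesis by (simp add: debye_exponent_scaled \<phi>_def mult_ac)
  qed
  have "\<phi> n \<le> \<phi> m"
  proof (rule DERIV_nonneg_imp_nondecreasing[of n m \<phi>, OF nm(2)])
    fix l assume "n \<le> l"
    then have l: "l > 0" using nm by simp
    define c where "c = b / l"
    have p: "1 + c\<^sup>2 > 0" by (simp add: add_pos_nonneg)
    have c': "((\<lambda>l. b / l) has_real_derivative - c / l) (at l)"
      using l by (auto intro!: derivative_eq_intros simp: c_def power2_eq_square)
    have "((\<lambda>c. sqrt (1 + c\<^sup>2) - 1 - c * arsinh c) has_real_derivative - arsinh c) (at c)"
      using p by (auto intro!: derivative_eq_intros simp: field_simps power2_eq_square add.commute)
    then have "((\<lambda>c. sqrt (1 + c\<^sup>2) - 1 - c * arsinh c) has_real_derivative - arsinh c) (at (b / l))"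
      by (simp only: c_def)
    from DERIV_chain2[OF this c']
    have d: "((\<lambda>l. sqrt (1 + (b / l)\<^sup>2) - 1 - b / l * arsinh (b / l)) has_real_derivative - arsinh c * (- c / l)) (at l)" .
    have sq: "((\<lambda>l. l\<^sup>2) has_real_derivative 2 * l) (at l)" by (auto intro!: derivative_eq_intros)
    have "(\<phi> has_real_derivative - (2 * l * (sqrt (1 + (b / l)\<^sup>2) - 1 - b / l * arsinh (b / l)) + - arsinh c * (- c / l) * l\<^sup>2)) (at l)"
      unfolding \<phi>_def by (intro DERIV_minus DERIV_mult sq d)
    moreover have "- (2 * l * (sqrt (1 + (b / l)\<^sup>2) - 1 - b / l * arsinh (b / l)) + - arsinh c * (- c / l) * l\<^sup>2)
       = l * (c * arsinh c - 2 * (sqrt (1 + c\<^sup>2) - 1))"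
      unfolding c_def[symmetric] using l by (simp add: algebra_simps power2_eq_square)
    moreover have "0 \<le> l * (c * arsinh c - 2 * (sqrt (1 + c\<^sup>2) - 1))"
      using l arsinh_quadratic_lower[of c] by (intro mult_nonneg_nonneg) auto
    ultimately show "\<exists>d. (\<phi> has_real_derivative d) (at l) \<and> 0 \<le> d" by auto
  qed
  then show ?thesis using t nm by (simp add: eq)
qed

text \<open>From \<open>w - t \<le> |\<nu>|\<close> and \<open>ln v \<le> arsinh v\<close>. The
  vanishing like \<open>t powr |\<nu>|\<close> as \<open>t\<close> tends to 0 supplies integrability
  at the origin.\<close>

lemma exp_debye_exponent_le_power:
  fixes \<nu> t :: real
  assumes \<nu>: "\<nu> \<noteq> 0" and t: "t > 0"
  shows "exp (debye_exponent \<nu> t) \<le> exp \<bar>\<nu>\<bar> * (t / \<bar>\<nu>\<bar>) powr \<bar>\<nu>\<bar>"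
proof -
  have "debye_radius \<nu> t \<le> \<bar>\<nu>\<bar> + t"
    unfolding debye_radius_def by (rule real_le_lsqrt) (use t in \<open>auto simp: power2_sum\<close>)
  moreover have "ln (\<bar>\<nu>\<bar> / t) \<le> arsinh (\<bar>\<nu>\<bar> / t)"
    unfolding arsinh_real_def using \<nu> t by (intro ln_mono) auto
  then have "\<bar>\<nu>\<bar> * ln (\<bar>\<nu>\<bar> / t) \<le> \<bar>\<nu>\<bar> * arsinh (\<bar>\<nu>\<bar> / t)" by (intro mult_left_mono) auto
  moreover have "\<bar>\<nu>\<bar> * arsinh (\<bar>\<nu>\<bar> / t) = \<nu> * arsinh (\<nu> / t)" by (simp add: abs_if)
  ultimately have "debye_exponent \<nu> t \<le> \<bar>\<nu>\<bar> - \<bar>\<nu>\<bar> * ln (\<bar>\<nu>\<bar> / t)"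
    by (simp add: debye_exponent_def)
  also have "ln (\<bar>\<nu>\<bar> / t) = - ln (t / \<bar>\<nu>\<bar>)" using \<nu> t by (simp add: ln_div)
  finally have "exp (debye_exponent \<nu> t) \<le> exp (\<bar>\<nu>\<bar> + \<bar>\<nu>\<bar> * ln (t / \<bar>\<nu>\<bar>))" by simp
  also have "\<dots> = exp \<bar>\<nu>\<bar> * (t / \<bar>\<nu>\<bar>) powr \<bar>\<nu>\<bar>" using \<nu> t by (simp add: exp_add powr_def)
  finally show ?thesis .
qed

text \<open>A local central limit theorem: for order \<open>n x\<close> and argument
  \<open>n^2 r\<close> the exponent tends to \<open>- x^2 / (2 r)\<close>, and the radius is
  asymptotic to \<open>n^2 r\<close>.\<close>

lemma scaled_bessel_I_diffusive_limit:
  assumes x: "x \<in> \<int>" and r: "r > 0"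
  shows "(\<lambda>n. real n * scaled_bessel_I (real n * x) ((real n)\<^sup>2 * r)) \<longlonglongrightarrow> exp (- (x\<^sup>2 / (2 * r))) / sqrt (2 * pi * r)"
proof -
  \<comment> \<open>The shifted index keeps \<open>N k\<close> positive for every \<open>k\<close>;
    \<open>LIMSEQ_imp_Suc\<close> undoes the shift.\<close>
  define N where "N = (\<lambda>k. real (Suc k))"
  have N: "N k > 0" for k by (simp add: N_def)
  have Nlim: "filterlim N at_top sequentially"
    unfolding N_def by (rule filterlim_compose[OF filterlim_real_sequentially filterlim_Suc])
  define w where "w = (\<lambda>k. debye_radius (N k * x) ((N k)\<^sup>2 * r))"
  have t: "(N k)\<^sup>2 * r > 0" for k using N[of k] r by simp
  have w: "w k > 0" for k using t by (simp add: w_def debye_radius_pos)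
  have wN: "w k = (N k)\<^sup>2 * sqrt ((x / N k)\<^sup>2 + r\<^sup>2)" for k
  proof -
    have "(N k * x)\<^sup>2 + ((N k)\<^sup>2 * r)\<^sup>2 = ((N k)\<^sup>2)\<^sup>2 * ((x / N k)\<^sup>2 + r\<^sup>2)"
      using N[of k] by (simp add: field_simps power2_eq_square)
    then show ?thesis by (simp only: w_def debye_radius_def real_sqrt_mult real_sqrt_abs abs_power2)
  qed
  have xN: "(\<lambda>k. x / N k) \<longlonglongrightarrow> 0"
    by (rule tendsto_divide_0[OF tendsto_const filterlim_at_top_imp_at_infinity[OF Nlim]])
  have rho: "(\<lambda>k. debye_ratio (N k * x) ((N k)\<^sup>2 * r)) \<longlonglongrightarrow> 1"
  proof (rule debye_ratio_tendsto[OF t])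
    have "filterlim (\<lambda>k. r * (N k)\<^sup>2) at_top sequentially"
      using r Nlim by (intro filterlim_tendsto_pos_mult_at_top[OF tendsto_const] filterlim_pow_at_top) auto
    then show "filterlim (\<lambda>k. debye_radius (N k * x) ((N k)\<^sup>2 * r)) at_top sequentially"
    proof (rule filterlim_at_top_mono, intro always_eventually allI)
      fix k show "r * (N k)\<^sup>2 \<le> debye_radius (N k * x) ((N k)\<^sup>2 * r)"
        unfolding debye_radius_def by (rule real_le_rsqrt) (simp add: mult.commute)
    qed
  qed
  have ex: "(\<lambda>k. debye_exponent (N k * x) ((N k)\<^sup>2 * r)) \<longlonglongrightarrow> - (x\<^sup>2 / (2 * r))"
  proof (cases "x = 0")
    case True
    then show ?thesis using t r by (simp add: debye_exponent_def debye_radius_def)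
  next
    case False
    define b where "b = (\<lambda>k. (x / r) / N k)"
    have "b \<longlonglongrightarrow> 0" unfolding b_def
      by (rule tendsto_divide_0[OF tendsto_const filterlim_at_top_imp_at_infinity[OF Nlim]])
    moreover have b0: "b k \<noteq> 0" for k using False r N[of k] by (simp add: b_def)
    ultimately have b: "filterlim b (at 0) sequentially" by (intro filterlim_atI) auto
    have "((\<lambda>b::real. (sqrt (1 + b\<^sup>2) - 1 - b * arsinh b) / b\<^sup>2) \<longlongrightarrow> - 1 / 2) (at 0)" by real_asymp
    from filterlim_compose[OF this b]
    have "(\<lambda>k. (sqrt (1 + (b k)\<^sup>2) - 1 - b k * arsinh (b k)) / (b k)\<^sup>2 * (x\<^sup>2 / r)) \<longlonglongrightarrow> (- 1 / 2) * (x\<^sup>2 / r)"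
      by (intro tendsto_mult tendsto_const)
    moreover have "(sqrt (1 + (b k)\<^sup>2) - 1 - b k * arsinh (b k)) / (b k)\<^sup>2 * (x\<^sup>2 / r) = debye_exponent (N k * x) ((N k)\<^sup>2 * r)" for k
    proof -
      have e1: "N k * x / ((N k)\<^sup>2 * r) = b k" using N[of k] r by (simp add: b_def power2_eq_square)
      have e2: "x\<^sup>2 / r / (b k)\<^sup>2 = (N k)\<^sup>2 * r" using N[of k] r False by (simp add: b_def power2_eq_square)
      have "(sqrt (1 + (b k)\<^sup>2) - 1 - b k * arsinh (b k)) / (b k)\<^sup>2 * (x\<^sup>2 / r)
          = x\<^sup>2 / r / (b k)\<^sup>2 * (sqrt (1 + (b k)\<^sup>2) - 1 - b k * arsinh (b k))" by (simp add: mult_ac)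
      then show ?thesis by (simp only: e2 debye_exponent_scaled[OF t] e1)
    qed
    ultimately show ?thesis by simp
  qed
  have "(\<lambda>k. debye_ratio (N k * x) ((N k)\<^sup>2 * r) * exp (debye_exponent (N k * x) ((N k)\<^sup>2 * r))
       / sqrt (2 * pi * sqrt ((x / N k)\<^sup>2 + r\<^sup>2))) \<longlonglongrightarrow> 1 * exp (- (x\<^sup>2 / (2 * r))) / sqrt (2 * pi * sqrt (0\<^sup>2 + r\<^sup>2))"
    by (intro tendsto_intros rho ex xN) (use r in auto)
  moreover have "debye_ratio (N k * x) ((N k)\<^sup>2 * r) * exp (debye_exponent (N k * x) ((N k)\<^sup>2 * r))
       / sqrt (2 * pi * sqrt ((x / N k)\<^sup>2 + r\<^sup>2)) = N k * scaled_bessel_I (N k * x) ((N k)\<^sup>2 * r)" for k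
  proof -
    have "N k * x \<in> \<int>" using x by (simp add: N_def)
    moreover have "debye_radius (N k * x) ((N k)\<^sup>2 * r) = (N k)\<^sup>2 * sqrt ((x / N k)\<^sup>2 + r\<^sup>2)"
      using wN[of k] by (simp only: w_def)
    ultimately show ?thesis
      using N[of k] scaled_bessel_I_eq_debye[OF _ t[of k], of "N k * x"] by (simp add: real_sqrt_mult)
  qed
  ultimately have "(\<lambda>k. N k * scaled_bessel_I (N k * x) ((N k)\<^sup>2 * r)) \<longlonglongrightarrow> exp (- (x\<^sup>2 / (2 * r))) / sqrt (2 * pi * r)"
    using r by simp
  then show ?thesis unfolding N_def by (rule LIMSEQ_imp_Suc)
qed

text \<open>The constant 2 absorbs \<open>3 / sqrt (2 pi)\<close>. The exponential is retained,
  since it has to compensate the singular power near \<open>r = 0\<close>.\<close>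

lemma scaled_bessel_I_diffusive_bound:
  assumes x: "x \<in> \<int>" and r: "r > 0" and n: "n \<ge> (1::nat)"
  shows "\<bar>real n * scaled_bessel_I (real n * x) ((real n)\<^sup>2 * r)\<bar>
      \<le> 2 * exp (debye_exponent (real n * x) ((real n)\<^sup>2 * r)) * r powr (- 1 / 2)"
proof -
  have n0: "real n > 0" using n by simp
  define t where "t = (real n)\<^sup>2 * r"
  define E where "E = exp (debye_exponent (real n * x) t)"
  have t: "t > 0" using n0 r by (simp add: t_def)
  have "real n * x \<in> \<int>" using x by simp
  then have "\<bar>scaled_bessel_I (real n * x) t\<bar> \<le> 3 * E / sqrt (2 * pi * debye_radius (real n * x) t)"
    unfolding E_def using t by (rule scaled_bessel_I_bound)
  also have "\<dots> \<le> 3 * E / sqrt (2 * pi * t)"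
  proof (intro divide_left_mono)
    have "t \<le> debye_radius (real n * x) t" unfolding debye_radius_def by (rule real_le_rsqrt) simp
    then show "sqrt (2 * pi * t) \<le> sqrt (2 * pi * debye_radius (real n * x) t)" by simp
    show "0 < sqrt (2 * pi * debye_radius (real n * x) t) * sqrt (2 * pi * t)"
      using t debye_radius_pos[OF t, of "real n * x"] by simp
  qed (simp add: E_def)
  finally have "real n * \<bar>scaled_bessel_I (real n * x) t\<bar> \<le> real n * (3 * E / sqrt (2 * pi * t))"
    by (intro mult_left_mono) auto
  also have "\<dots> = 3 / sqrt (2 * pi) * (E * r powr (- 1 / 2))"
    using n0 r by (simp add: t_def real_sqrt_mult powr_minus powr_half_sqrt field_simps)
  also have "\<dots> \<le> 2 * (E * r powr (- 1 / 2))"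
  proof (intro mult_right_mono)
    have "3 / 2 \<le> sqrt (2 * pi)"
      using pi_gt3 by (intro real_le_rsqrt) (simp add: power2_eq_square)
    then show "3 / sqrt (2 * pi) \<le> 2" by (simp add: field_simps)
  qed (simp add: E_def)
  finally show ?thesis by (simp add: abs_mult t_def E_def)
qed

text \<open>The product is the density at \<open>x\<close> of a centred Gaussian with variance
  \<open>r\<close> in each coordinate.\<close>

definition limit_integrand :: "real \<Rightarrow> real \<Rightarrow> real^'n::finite \<Rightarrow> real \<Rightarrow> real" where
  "limit_integrand s q x r = r powr (q - 1) * exp (- s\<^sup>2 * real CARD('n) * r) *
     (\<Prod>i\<in>UNIV. exp (- ((x $ i)\<^sup>2 / (2 * r))) / sqrt (2 * pi * r))"

lemma limit_integrand_measurable [measurable]: "limit_integrand s q x \<in> borel_measurable borel"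
  unfolding limit_integrand_def by measurable

lemma limit_integrand_eq:
  fixes x :: "real^'n::finite"
  assumes r: "r > 0"
  shows "limit_integrand s q x r = (2 * pi) powr (- (real CARD('n) / 2)) *
     (r powr (q - real CARD('n) / 2 - 1) * exp (- (s\<^sup>2 * real CARD('n) * r + (norm x)\<^sup>2 / (2 * r))))"
proof -
  let ?d = "real CARD('n)"
  have "(\<Prod>i\<in>UNIV. exp (- ((x $ i)\<^sup>2 / (2 * r))) / sqrt (2 * pi * r))
      = exp (- ((norm x)\<^sup>2 / (2 * r))) / sqrt (2 * pi * r) ^ CARD('n)"
  proof -
    have "(norm x)\<^sup>2 = (\<Sum>i\<in>UNIV. (x $ i)\<^sup>2)" by (simp add: norm_vec_def L2_set_def sum_nonneg)
    then show ?thesis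
      by (simp add: prod_dividef exp_sum[symmetric] sum_negf sum_divide_distrib)
  qed
  also have "sqrt (2 * pi * r) ^ CARD('n) = (2 * pi) powr (?d / 2) * r powr (?d / 2)"
    using r by (simp add: powr_half_sqrt[symmetric] powr_realpow[symmetric] powr_powr powr_mult)
  finally have "limit_integrand s q x r = r powr (q - 1) * exp (- s\<^sup>2 * ?d * r) * (exp (- ((norm x)\<^sup>2 / (2 * r))) / ((2 * pi) powr (?d / 2) * r powr (?d / 2)))"
    by (simp add: limit_integrand_def)
  also have "\<dots> = 1 / (2 * pi) powr (?d / 2) * (r powr (q - 1) / r powr (?d / 2) * (exp (- s\<^sup>2 * ?d * r) * exp (- ((norm x)\<^sup>2 / (2 * r)))))"
    by simp
  also have "1 / (2 * pi) powr (?d / 2) = (2 * pi) powr (- (?d / 2))"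
    by (simp add: powr_minus_divide)
  also have "r powr (q - 1) / r powr (?d / 2) = r powr (q - ?d / 2 - 1)"
    by (simp add: powr_diff[symmetric] algebra_simps)
  also have "exp (- s\<^sup>2 * ?d * r) * exp (- ((norm x)\<^sup>2 / (2 * r))) = exp (- (s\<^sup>2 * ?d * r + (norm x)\<^sup>2 / (2 * r)))"
    by (simp flip: exp_add)
  finally show ?thesis .
qed

text \<open>Under \<open>t = n^2 r\<close> the Jacobian and \<open>t powr (q - 1)\<close> give
  \<open>n powr (2 q)\<close>; together with \<open>n powr (d - 2 q)\<close> this is
  \<open>n ^ d\<close>, one factor \<open>n\<close> for each coordinate.\<close>

lemma green_integrand_rescale:
  fixes x :: "real^'n::finite"
  assumes n: "n \<ge> (1::nat)"
  shows "real n powr (real CARD('n) - 2 * q) * (LINT t:{0<..}|lborel. green_integrand (s / real n) q (real n *\<^sub>R x) t)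
    = (LINT r|lborel. indicator {0<..} r * (r powr (q - 1) * exp (- s\<^sup>2 * real CARD('n) * r) *
        (\<Prod>i\<in>UNIV. real n * scaled_bessel_I (real n * x $ i) ((real n)\<^sup>2 * r))))"
proof -
  let ?d = "real CARD('n)"
  have n0: "real n > 0" using n by simp
  let ?f = "\<lambda>t. indicator {0<..} t * green_integrand (s / real n) q (real n *\<^sub>R x) t"
  have "(LINT t|lborel. ?f t) = \<bar>(real n)\<^sup>2\<bar> *\<^sub>R (LINT r|lborel. ?f (0 + (real n)\<^sup>2 * r))"
    by (rule lborel_integral_real_affine) (use n0 in auto)
  then have "real n powr (?d - 2 * q) * (LINT t|lborel. ?f t) = (LINT r|lborel. real n powr (?d - 2 * q) * (real n)\<^sup>2 * ?f ((real n)\<^sup>2 * r))"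
    by simp
  also have "\<dots> = (LINT r|lborel. indicator {0<..} r * (r powr (q - 1) * exp (- s\<^sup>2 * ?d * r) *
        (\<Prod>i\<in>UNIV. real n * scaled_bessel_I (real n * x $ i) ((real n)\<^sup>2 * r))))"
  proof (rule Bochner_Integration.integral_cong[OF refl])
    fix r :: real
    show "real n powr (?d - 2 * q) * (real n)\<^sup>2 * ?f ((real n)\<^sup>2 * r) = indicator {0<..} r * (r powr (q - 1) * exp (- s\<^sup>2 * ?d * r) *
        (\<Prod>i\<in>UNIV. real n * scaled_bessel_I (real n * x $ i) ((real n)\<^sup>2 * r)))"
    proof (cases "r > 0")
      case True
      have 1: "(real n)\<^sup>2 = real n powr 2" using n0 by simp
      have "real n powr (?d - 2 * q) * (real n)\<^sup>2 * ((real n)\<^sup>2 * r) powr (q - 1) = real n powr (?d - 2 * q + 2 + 2 * (q - 1)) * r powr (q - 1)"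
        using True n0 by (simp only: 1 powr_mult powr_powr powr_add)
      also have "real n powr (?d - 2 * q + 2 + 2 * (q - 1)) = real n ^ CARD('n)"
        using n0 by (simp add: powr_realpow algebra_simps)
      finally have 2: "real n powr (?d - 2 * q) * (real n)\<^sup>2 * ((real n)\<^sup>2 * r) powr (q - 1) = real n ^ CARD('n) * r powr (q - 1)" .
      have 3: "- (s / real n)\<^sup>2 * ?d * ((real n)\<^sup>2 * r) = - s\<^sup>2 * ?d * r"
        using n0 by (simp add: power_divide)
      have "real n powr (?d - 2 * q) * (real n)\<^sup>2 * ?f ((real n)\<^sup>2 * r)
        = (real n powr (?d - 2 * q) * (real n)\<^sup>2 * ((real n)\<^sup>2 * r) powr (q - 1)) * exp (- (s / real n)\<^sup>2 * ?d * ((real n)\<^sup>2 * r)) *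
          (\<Prod>i\<in>UNIV. scaled_bessel_I (real n * x $ i) ((real n)\<^sup>2 * r))"
        using True n0 unfolding green_integrand_def by (simp add: mult_ac)
      then show ?thesis unfolding 2 3 using True by (simp add: prod.distrib mult_ac)
    next
      case False
      then have "\<not> (real n)\<^sup>2 * r > 0" using n0 by (simp add: zero_less_mult_iff)
      with False show ?thesis by simp
    qed
  qed
  finally show ?thesis by (simp add: set_lebesgue_integral_def)
qed

text \<open>The crude bound \<open>r powr (q - d / 2 - 1)\<close> cannot be integrable at both ends.
  At 0, a nonzero coordinate \<open>j\<close> yields the gain \<open>r powr \<nu>\<close> for
  \<open>n = n0\<close>, and monotonicity along the parabola passes it on to all
  \<open>n \<ge> n0\<close>. At infinity the exponential yields \<open>r powr (- q)\<close> if
  \<open>s \<noteq> 0\<close>, while for \<open>s = 0\<close> the condition \<open>2 q < d\<close>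
  does the work.\<close>

lemma limit_integrand_dominated:
  fixes x :: "real^'n::finite"
  assumes q: "q > 0" and s: "s \<noteq> 0 \<or> 2 * q < real CARD('n)" and x: "x \<in> int_lattice" "x \<noteq> 0"
  obtains g n0 where "integrable lborel g"
    "\<And>n r. n \<ge> n0 \<Longrightarrow> \<bar>indicator {0<..} r * (r powr (q - 1) * exp (- s\<^sup>2 * real CARD('n) * r) *
        (\<Prod>i\<in>UNIV. real n * scaled_bessel_I (real n * x $ i) ((real n)\<^sup>2 * r)))\<bar> \<le> g r"
proof -
  let ?d = "real CARD('n)"
  obtain j where j: "\<bar>x $ j\<bar> \<ge> 1" using x by (rule int_lattice_nth_ge_1)
  \<comment> \<open>\<open>n0 > d / 2\<close> makes \<open>\<nu> = n0 |x_j|\<close> exceed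
    \<open>d / 2\<close>, so that \<open>p = q - d / 2 + \<nu>\<close> is positive.\<close>
  obtain n0 :: nat where n0: "real n0 > ?d / 2" using reals_Archimedean2 by blast
  have n01: "n0 \<ge> 1" using n0 by (cases n0) auto
  define \<nu> where "\<nu> = \<bar>real n0 * x $ j\<bar>"
  have "real n0 * 1 \<le> real n0 * \<bar>x $ j\<bar>" using j by (intro mult_left_mono) auto
  then have "real n0 \<le> \<nu>" by (simp add: \<nu>_def abs_mult)
  with n0 n01 have \<nu>: "\<nu> > ?d / 2" "\<nu> > 0" by auto
  define C1 where "C1 = exp \<nu> * ((real n0)\<^sup>2 / \<nu>) powr \<nu>"
  have C1: "C1 > 0" using \<nu> n01 by (simp add: C1_def)
  \<comment> \<open>The power borrowed from the exponential at infinity, chosen so that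
    \<open>p' = q - d / 2 - \<beta>\<close> is negative in both cases.\<close>
  define \<beta> where "\<beta> = (if s = 0 then 0 else q)"
  obtain K where K: "K > 0" "\<And>r. r > 0 \<Longrightarrow> exp (- s\<^sup>2 * ?d * r) \<le> K * r powr (- \<beta>)"
  proof (cases "s = 0")
    case True
    then show ?thesis using that[of 1] by (simp add: \<beta>_def)
  next
    case False
    then have "s\<^sup>2 * ?d > 0" by simp
    from exp_le_powr[OF q this] obtain K where K: "K > 0" "\<forall>r>0. exp (- (s\<^sup>2 * ?d * r)) \<le> K * r powr (- q)"
      by blast
    then show ?thesis using False by (intro that[of K]) (simp_all add: \<beta>_def)
  qed
  define p where "p = q - ?d / 2 + \<nu>"
  define p' where "p' = q - ?d / 2 - \<beta>"
  have p: "p > 0" using q \<nu> by (simp add: p_def)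
  have p': "p' < 0" using s by (auto simp: p'_def \<beta>_def)
  define C where "C = 2 ^ CARD('n) * (C1 + K)"
  define g where "g = (\<lambda>r. C * (indicator {0<..} r *\<^sub>R (if r \<le> 1 then r powr (p - 1) else r powr (p' - 1))))"
  have "integrable lborel g"
    unfolding g_def using set_integrable_powr_pieces[OF p p'] unfolding set_integrable_def by simp
  moreover have "\<bar>indicator {0<..} r * (r powr (q - 1) * exp (- s\<^sup>2 * ?d * r) *
        (\<Prod>i\<in>UNIV. real n * scaled_bessel_I (real n * x $ i) ((real n)\<^sup>2 * r)))\<bar> \<le> g r"
    if n: "n \<ge> n0" for n r
  proof (cases "r > 0")
    case True
    note r = True
    define E where "E = (\<lambda>i. exp (debye_exponent (real n * x $ i) ((real n)\<^sup>2 * r)))"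
    have n1: "n \<ge> 1" using n n01 by simp
    have t: "(real n)\<^sup>2 * r > 0" using n1 r by simp
    have E1: "E i \<le> 1" for i using debye_exponent_nonpos[OF t] by (simp add: E_def)
    have "\<bar>\<Prod>i\<in>UNIV. real n * scaled_bessel_I (real n * x $ i) ((real n)\<^sup>2 * r)\<bar> \<le> (\<Prod>i\<in>UNIV. 2 * E i * r powr (- 1 / 2))"
      unfolding abs_prod E_def using x r n1
      by (intro prod_mono conjI scaled_bessel_I_diffusive_bound) (auto simp: int_lattice_def)
    also have "\<dots> = 2 ^ CARD('n) * (\<Prod>i\<in>UNIV. E i) * r powr (- (?d / 2))"
      using r by (simp add: prod.distrib powr_realpow[symmetric] powr_powr)
    also have "\<dots> \<le> 2 ^ CARD('n) * E j * r powr (- (?d / 2))"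
    proof -
      have "(\<Prod>i\<in>UNIV. E i) = E j * (\<Prod>i\<in>UNIV - {j}. E i)" by (rule prod.remove) auto
      also have "\<dots> \<le> E j * 1"
        using E1 by (intro mult_left_mono prod_le_1) (auto simp: E_def)
      finally show ?thesis by (intro mult_right_mono mult_left_mono) auto
    qed
    finally have B: "\<bar>indicator {0<..} r * (r powr (q - 1) * exp (- s\<^sup>2 * ?d * r) *
        (\<Prod>i\<in>UNIV. real n * scaled_bessel_I (real n * x $ i) ((real n)\<^sup>2 * r)))\<bar>
       \<le> r powr (q - 1) * exp (- s\<^sup>2 * ?d * r) * (2 ^ CARD('n) * E j * r powr (- (?d / 2)))"
      using r by (simp add: abs_mult mult_left_mono)
    also have "\<dots> = 2 ^ CARD('n) * r powr (q - ?d / 2 - 1) * (exp (- s\<^sup>2 * ?d * r) * E j)"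
    proof -
      have "r powr (q - 1) * r powr (- (?d / 2)) = r powr (q - ?d / 2 - 1)"
        by (simp add: algebra_simps flip: powr_add)
      then show ?thesis by (simp add: mult_ac)
    qed
    also have "\<dots> \<le> 2 ^ CARD('n) * r powr (q - ?d / 2 - 1) * (if r \<le> 1 then C1 * r powr \<nu> else K * r powr (- \<beta>))"
    proof (intro mult_left_mono)
      show "exp (- s\<^sup>2 * ?d * r) * E j \<le> (if r \<le> 1 then C1 * r powr \<nu> else K * r powr (- \<beta>))"
      proof (cases "r \<le> 1")
        case True
        have "debye_exponent (real n * x $ j) ((real n)\<^sup>2 * r) \<le> debye_exponent (real n0 * x $ j) ((real n0)\<^sup>2 * r)"
          using r n n01 by (intro debye_exponent_parabola_antimono) auto
        then have "E j \<le> exp (debye_exponent (real n0 * x $ j) ((real n0)\<^sup>2 * r))" by (simp add: E_def)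
        also have "\<dots> \<le> exp \<nu> * (((real n0)\<^sup>2 * r) / \<nu>) powr \<nu>"
          unfolding \<nu>_def using \<nu>(2) n01 r by (intro exp_debye_exponent_le_power) (auto simp: \<nu>_def)
        also have "\<dots> = C1 * r powr \<nu>"
          using \<nu>(2) r by (simp add: C1_def powr_mult powr_divide)
        finally have "E j \<le> C1 * r powr \<nu>" .
        moreover have "exp (- s\<^sup>2 * ?d * r) \<le> 1" using r by simp
        ultimately have "exp (- s\<^sup>2 * ?d * r) * E j \<le> 1 * (C1 * r powr \<nu>)"
          by (intro mult_mono) (auto simp: E_def)
        then show ?thesis using True by simp
      next
        case False
        have "exp (- s\<^sup>2 * ?d * r) * E j \<le> K * r powr (- \<beta>) * 1"
          using K r E1 by (intro mult_mono) (auto simp: E_def)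
        then show ?thesis using False by simp
      qed
    qed auto
    also have "\<dots> = 2 ^ CARD('n) * (if r \<le> 1 then C1 * r powr (p - 1) else K * r powr (p' - 1))"
    proof -
      have "r powr (q - ?d / 2 - 1) * r powr \<nu> = r powr (p - 1)"
        "r powr (q - ?d / 2 - 1) * r powr (- \<beta>) = r powr (p' - 1)"
        by (simp_all add: powr_add[symmetric] p_def p'_def algebra_simps)
      then show ?thesis by simp
    qed
    also have "\<dots> \<le> g r"
      unfolding g_def C_def using r C1 K(1)
      by (auto simp: mult.assoc intro!: mult_left_mono mult_right_mono)
    finally show ?thesis .
  qed (simp add: g_def)
  ultimately show ?thesis by (rule that)
qed

lemma limit_integral_convergence:
  fixes x :: "real^'n::finite"
  assumes q: "q > 0" and s: "s \<noteq> 0 \<or> 2 * q < real CARD('n)" and x: "x \<in> int_lattice" "x \<noteq> 0"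
  shows "set_integrable lborel {0<..} (limit_integrand s q x)"
    and "(\<lambda>n. real n powr (real CARD('n) - 2 * q) * (LINT t:{0<..}|lborel. green_integrand (s / real n) q (real n *\<^sub>R x) t))
       \<longlonglongrightarrow> (LINT r:{0<..}|lborel. limit_integrand s q x r)"
proof -
  define F where "F = (\<lambda>n r. indicator {0<..} r * (r powr (q - 1) * exp (- s\<^sup>2 * real CARD('n) * r) *
        (\<Prod>i\<in>UNIV. real n * scaled_bessel_I (real n * x $ i) ((real n)\<^sup>2 * r))))"
  obtain g n0 where g: "integrable lborel g" and b: "\<And>n r. n \<ge> n0 \<Longrightarrow> \<bar>F n r\<bar> \<le> g r"
    unfolding F_def using limit_integrand_dominated[OF q s x] by blast
  have [measurable]: "F n \<in> borel_measurable borel" for n unfolding F_def by measurable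
  have "(\<lambda>n. F n r) \<longlonglongrightarrow> indicator {0<..} r * limit_integrand s q x r" for r
  proof (cases "r > 0")
    case True
    have "(\<lambda>n. indicator {0<..} r * (r powr (q - 1) * exp (- s\<^sup>2 * real CARD('n) * r) *
        (\<Prod>i\<in>UNIV. real n * scaled_bessel_I (real n * x $ i) ((real n)\<^sup>2 * r))))
        \<longlonglongrightarrow> indicator {0<..} r * (r powr (q - 1) * exp (- s\<^sup>2 * real CARD('n) * r) *
        (\<Prod>i\<in>UNIV. exp (- ((x $ i)\<^sup>2 / (2 * r))) / sqrt (2 * pi * r)))"
      using True x by (intro tendsto_mult tendsto_const tendsto_prod scaled_bessel_I_diffusive_limit) (auto simp: int_lattice_def)
    then show ?thesis by (simp add: F_def limit_integrand_def)
  qed (simp add: F_def)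
  then have lim: "AE r in lborel. (\<lambda>n. F (n + n0) r) \<longlonglongrightarrow> indicator {0<..} r * limit_integrand s q x r"
    by (auto intro!: LIMSEQ_ignore_initial_segment)
  have bound: "AE r in lborel. norm (F (n + n0) r) \<le> g r" for n using b by simp
  have m: "(\<lambda>r. indicator {0<..} r * limit_integrand s q x r) \<in> borel_measurable lborel" "\<And>n. F (n + n0) \<in> borel_measurable lborel"
    by measurable
  from integrable_dominated_convergence[OF m g lim bound]
  show "set_integrable lborel {0<..} (limit_integrand s q x)" by (simp add: set_integrable_def)
  from integral_dominated_convergence[OF m g lim bound]
  have "(\<lambda>n. integral\<^sup>L lborel (F n)) \<longlonglongrightarrow> (LINT r|lborel. indicator {0<..} r * limit_integrand s q x r)"
    by (rule LIMSEQ_offset)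
  moreover have "\<forall>\<^sub>F n in sequentially. integral\<^sup>L lborel (F n) = real n powr (real CARD('n) - 2 * q) * (LINT t:{0<..}|lborel. green_integrand (s / real n) q (real n *\<^sub>R x) t)"
    using eventually_ge_at_top[of "1::nat"] by eventually_elim (simp add: green_integrand_rescale F_def)
  ultimately show "(\<lambda>n. real n powr (real CARD('n) - 2 * q) * (LINT t:{0<..}|lborel. green_integrand (s / real n) q (real n *\<^sub>R x) t))
       \<longlonglongrightarrow> (LINT r:{0<..}|lborel. limit_integrand s q x r)"
    by (simp add: set_lebesgue_integral_def Lim_transform_eventually)
qed

text \<open>A nonzero limit is what turns convergence of the rescaled integrals into asymptotic
  equivalence.\<close>

lemma limit_integral_pos:
  fixes x :: "real^'n::finite"
  assumes "set_integrable lborel {0<..} (limit_integrand s q x)"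
  shows "0 < (LINT r:{0<..}|lborel. limit_integrand s q x r)"
proof -
  let ?f = "\<lambda>r. indicator {0<..} r * limit_integrand s q x r"
  have pos: "limit_integrand s q x r > 0" if "r > 0" for r
    using that unfolding limit_integrand_def by (auto intro!: mult_pos_pos prod_pos)
  then have nn: "0 \<le> ?f r" for r by (cases "r > 0") (auto intro: less_imp_le)
  have int: "integrable lborel ?f" using assms by (simp add: set_integrable_def)
  have "integral\<^sup>L lborel ?f \<noteq> 0"
  proof
    assume "integral\<^sup>L lborel ?f = 0"
    then have "AE r in lborel. ?f r = 0"
      using integral_nonneg_eq_0_iff_AE[OF int] nn by auto
    then have "AE r in lborel. r \<notin> {0<..<1::real}"
      by eventually_elim (use pos in force)
    then have "{0<..<1::real} \<in> null_sets lborel"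
      by (subst AE_iff_null_sets) auto
    then show False by (auto simp: null_sets_def)
  qed
  moreover have "0 \<le> integral\<^sup>L lborel ?f" using nn by (intro integral_nonneg_AE) auto
  ultimately show ?thesis by (simp add: set_lebesgue_integral_def)
qed

section \<open>Bessel and Gamma forms of the continuum Green function\<close>

lemma bessel_K_full_line:
  assumes z: "z > 0"
  shows "(LINT y|lborel. exp (\<beta> * y) * exp (- (z * cosh y))) = 2 * bessel_K \<beta> z"
proof -
  define f where "f = (\<lambda>y. exp (\<beta> * y) * exp (- (z * cosh y)))"
  have int: "integrable lborel f"
  proof -
    \<comment> \<open>The exponent \<open>|\<beta>| + 1\<close> is chosen so that, after absorbing
      \<open>exp (\<beta> y)\<close>, the decay \<open>exp (- |y|)\<close> is left.\<close>
    have "\<bar>\<beta>\<bar> + 1 > 0" "z / 2 > 0" using z by auto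
    from exp_le_powr[OF this] obtain K where K: "K > 0" "\<forall>t>0. exp (- (z / 2 * t)) \<le> K * t powr (- (\<bar>\<beta>\<bar> + 1))"
      by blast
    have "\<bar>f y\<bar> \<le> K * exp (- (\<bar>y\<bar> * 1))" for y
    proof -
      have "exp \<bar>y\<bar> \<le> 2 * cosh y" by (simp add: cosh_def abs_if)
      then have "z / 2 * exp \<bar>y\<bar> \<le> z / 2 * (2 * cosh y)" using z by (intro mult_left_mono) auto
      then have "exp (- (z * cosh y)) \<le> exp (- (z / 2 * exp \<bar>y\<bar>))" by simp
      also have "\<dots> \<le> K * exp \<bar>y\<bar> powr (- (\<bar>\<beta>\<bar> + 1))" by (rule K(2)[rule_format, OF exp_gt_zero])
      also have "\<dots> = K * exp (- (\<bar>\<beta>\<bar> + 1) * \<bar>y\<bar>)" by (simp add: exp_powr_real mult.commute)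
      finally have "exp (- (z * cosh y)) \<le> K * exp (- (\<bar>\<beta>\<bar> + 1) * \<bar>y\<bar>)" .
      moreover have "exp (\<beta> * y) \<le> exp (\<bar>\<beta>\<bar> * \<bar>y\<bar>)" by (simp flip: abs_mult)
      ultimately have "f y \<le> exp (\<bar>\<beta>\<bar> * \<bar>y\<bar>) * (K * exp (- (\<bar>\<beta>\<bar> + 1) * \<bar>y\<bar>))"
        unfolding f_def by (intro mult_mono) auto
      also have "\<dots> = K * (exp (\<bar>\<beta>\<bar> * \<bar>y\<bar>) * exp (- (\<bar>\<beta>\<bar> + 1) * \<bar>y\<bar>))" by simp
      also have "\<dots> = K * exp (- (\<bar>y\<bar> * 1))" by (simp add: algebra_simps flip: exp_add)
      finally show ?thesis by (simp add: f_def)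
    qed
    then have "norm (f y) \<le> norm (K * exp (- (\<bar>y\<bar> * 1)))" for y
      using K(1) by simp
    moreover have "integrable lborel (\<lambda>y. K * exp (- (\<bar>y\<bar> * 1)))"
      by (intro integrable_mult_right exp_abs_integrable) simp
    moreover have "f \<in> borel_measurable lborel" unfolding f_def cosh_def by measurable
    ultimately show ?thesis by (intro Bochner_Integration.integrable_bound[of _ _ f] AE_I2)
  qed
  \<comment> \<open>Folding the line at 0 turns \<open>exp (\<beta> y)\<close> into
    \<open>exp (\<beta> y) + exp (- \<beta> y) = 2 cosh (\<beta> y)\<close>; the point
    \<open>y = 0\<close>, counted twice, is a null set.\<close>
  define g where "g = (\<lambda>y. indicator {0..} y * f y)"
  define h where "h = (\<lambda>y. indicator {0..} y * f (- y))"
  have i: "integrable lborel (\<lambda>y. f (0 + -1 * y))" by (rule lborel_integrable_real_affine[OF int]) simp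
  have g: "integrable lborel g"
    using integrable_mult_indicator[OF _ int, of "{0..}"] by (simp add: g_def)
  have h: "integrable lborel h"
    using integrable_mult_indicator[OF _ i, of "{0..}"] by (simp add: h_def)
  have hr: "integrable lborel (\<lambda>y. h (0 + -1 * y))" by (rule lborel_integrable_real_affine[OF h]) simp
  have "(LINT y|lborel. f y) = (LINT y|lborel. g y + h (0 + -1 * y))"
  proof (rule integral_cong_AE)
    show "AE y in lborel. f y = g y + h (0 + -1 * y)"
      using AE_lborel_singleton[of "0::real"] by eventually_elim (auto simp: g_def h_def indicator_def)
  qed (use int g hr in auto)
  also have "\<dots> = (LINT y|lborel. g y) + (LINT y|lborel. h (0 + -1 * y))"
    by (rule Bochner_Integration.integral_add[OF g hr])
  also have "(LINT y|lborel. h (0 + -1 * y)) = (LINT y|lborel. h y)"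
    using lborel_integral_real_affine[of "-1" h 0] by simp
  also have "(LINT y|lborel. g y) + (LINT y|lborel. h y) = (LINT y|lborel. g y + h y)"
    by (rule Bochner_Integration.integral_add[OF g h, symmetric])
  also have "(\<lambda>y. g y + h y) = (\<lambda>y. 2 * (indicator {0..} y *\<^sub>R (exp (- z * cosh y) * cosh (\<beta> * y))))"
  proof
    fix y :: real
    have "exp (\<beta> * y) + exp (- (\<beta> * y)) = 2 * cosh (\<beta> * y)" by (simp add: cosh_def)
    moreover have "f y + f (- y) = exp (- z * cosh y) * (exp (\<beta> * y) + exp (- (\<beta> * y)))"
      by (simp add: f_def distrib_left mult.commute)
    ultimately show "g y + h y = 2 * (indicator {0..} y *\<^sub>R (exp (- z * cosh y) * cosh (\<beta> * y)))"
      unfolding g_def h_def distrib_left[symmetric] by simp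
  qed
  also have "integral\<^sup>L lborel \<dots> = 2 * bessel_K \<beta> z"
    by (simp add: bessel_K_def set_lebesgue_integral_def)
  finally show ?thesis by (simp add: f_def)
qed

lemma bessel_K_minus: "bessel_K (- \<alpha>) z = bessel_K \<alpha> z"
  by (simp add: bessel_K_def)

text \<open>After \<open>r = exp y\<close> the integrand is \<open>exp (\<beta> y)\<close> times a
  double exponential. For \<open>s = 0\<close> the reflection of \<open>y\<close> gives a Gamma
  integral; for \<open>s > 0\<close> a translation balances the two inner exponentials and gives the
  Bessel integral, whose order may change sign.\<close>

theorem continuum_green_eq_integral:
  fixes x :: "real^'n::finite"
  assumes q: "q > 0" and s: "s \<ge> 0" "s = 0 \<longrightarrow> real CARD('n) > 2 * q" and x: "x \<noteq> 0"
  shows "continuum_green s q x = real CARD('n) powr q / Gamma q * (LINT r:{0<..}|lborel. limit_integrand s q x r)"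
proof -
  let ?d = "real CARD('n)"
  let ?N = "norm x"
  define \<beta> where "\<beta> = q - ?d / 2"
  have N: "?N > 0" using x by simp
  have I: "(LINT r:{0<..}|lborel. limit_integrand s q x r)
     = (2 * pi) powr (- (?d / 2)) * (LINT y|lborel. exp (\<beta> * y) * exp (- (s\<^sup>2 * ?d * exp y + ?N\<^sup>2 / 2 * exp (- y))))"
  proof -
    have "(LINT r:{0<..}|lborel. limit_integrand s q x r) = (LINT y|lborel. exp y * limit_integrand s q x (exp y))"
      by (rule exp_substitution) measurable
    also have "(\<lambda>y. exp y * limit_integrand s q x (exp y))
        = (\<lambda>y. (2 * pi) powr (- (?d / 2)) * (exp (\<beta> * y) * exp (- (s\<^sup>2 * ?d * exp y + ?N\<^sup>2 / 2 * exp (- y)))))"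
    proof
      fix y :: real
      have e1: "exp y * exp y powr (q - ?d / 2 - 1) = exp (\<beta> * y)"
        by (simp add: exp_powr_real \<beta>_def algebra_simps flip: exp_add)
      have e2: "s\<^sup>2 * ?d * exp y + ?N\<^sup>2 / (2 * exp y) = s\<^sup>2 * ?d * exp y + ?N\<^sup>2 / 2 * exp (- y)"
        by (simp add: exp_minus field_simps)
      have "exp y * limit_integrand s q x (exp y) = (2 * pi) powr (- (?d / 2)) *
          (exp y * exp y powr (q - ?d / 2 - 1) * exp (- (s\<^sup>2 * ?d * exp y + ?N\<^sup>2 / (2 * exp y))))"
        unfolding limit_integrand_eq[OF exp_gt_zero] by (simp only: mult_ac)
      then show "exp y * limit_integrand s q x (exp y) = (2 * pi) powr (- (?d / 2)) * (exp (\<beta> * y) * exp (- (s\<^sup>2 * ?d * exp y + ?N\<^sup>2 / 2 * exp (- y))))"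
        by (simp only: e1 e2)
    qed
    also have "integral\<^sup>L lborel \<dots> = (2 * pi) powr (- (?d / 2)) * (LINT y|lborel. exp (\<beta> * y) * exp (- (s\<^sup>2 * ?d * exp y + ?N\<^sup>2 / 2 * exp (- y))))"
      by simp
    finally show ?thesis .
  qed
  show ?thesis
  proof (cases "s = 0")
    case True
    with s have p: "- \<beta> > 0" by (simp add: \<beta>_def)
    let ?f = "\<lambda>y. exp (\<beta> * y) * exp (- (?N\<^sup>2 / 2 * exp (- y)))"
    have "(LINT y|lborel. ?f y) = \<bar>-1\<bar> *\<^sub>R (LINT y|lborel. ?f (0 + -1 * y))"
      by (rule lborel_integral_real_affine) simp
    also have "(\<lambda>y. ?f (0 + -1 * y)) = (\<lambda>y. exp y * (exp y powr (- \<beta> - 1) * exp (- (?N\<^sup>2 / 2 * exp y))))"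
    proof
      fix y :: real
      have "exp y * exp y powr (- \<beta> - 1) = exp (- \<beta> * y)"
        by (simp add: exp_powr_real algebra_simps flip: exp_add)
      then show "?f (0 + -1 * y) = exp y * (exp y powr (- \<beta> - 1) * exp (- (?N\<^sup>2 / 2 * exp y)))"
        by (simp flip: mult.assoc)
    qed
    also have "\<bar>-1\<bar> *\<^sub>R integral\<^sup>L lborel \<dots> = (LINT t:{0<..}|lborel. t powr (- \<beta> - 1) * exp (- (?N\<^sup>2 / 2 * t)))"
      using exp_substitution(2)[of "\<lambda>t. t powr (- \<beta> - 1) * exp (- (?N\<^sup>2 / 2 * t))"] by simp
    also have "\<dots> = Gamma (- \<beta>) / (?N\<^sup>2 / 2) powr (- \<beta>)"
      unfolding set_lebesgue_integral_def real_scaleR_def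
      by (intro has_bochner_integral_integral_eq Gamma_has_bochner_integral p) (use N in simp)
    finally have J: "(LINT y|lborel. ?f y) = Gamma (- \<beta>) / (?N\<^sup>2 / 2) powr (- \<beta>)" .
    have e: "- \<beta> = (?d - 2 * q) / 2" by (simp add: \<beta>_def field_simps)
    have e1: "(?N\<^sup>2 / 2) powr (- \<beta>) = ?N powr (?d - 2 * q) / 2 powr (- \<beta>)"
    proof -
      have "?N\<^sup>2 = ?N powr 2" using N by simp
      then have "?N\<^sup>2 powr (- \<beta>) = ?N powr (2 * - \<beta>)" by (simp only: powr_powr)
      also have "2 * - \<beta> = ?d - 2 * q" by (simp add: \<beta>_def)
      finally have "?N\<^sup>2 powr (- \<beta>) = ?N powr (?d - 2 * q)" .
      then show ?thesis using N by (simp add: powr_divide)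
    qed
    have e2: "(2 * pi) powr (- (?d / 2)) * 2 powr (- \<beta>) = 1 / (2 powr q * pi powr (?d / 2))"
    proof -
      have "2 powr (- (?d / 2)) * 2 powr (- \<beta>) = 1 / 2 powr q"
        by (simp add: \<beta>_def flip: powr_add powr_minus_divide)
      moreover have "pi powr (- (?d / 2)) = 1 / pi powr (?d / 2)" by (rule powr_minus_divide)
      ultimately show ?thesis by (simp add: powr_mult)
    qed
    have "(2 * pi) powr (- (?d / 2)) * (LINT y|lborel. ?f y)
        = Gamma (- \<beta>) * ((2 * pi) powr (- (?d / 2)) * 2 powr (- \<beta>)) / ?N powr (?d - 2 * q)"
      unfolding J e1 by simp
    also have "\<dots> = Gamma (- \<beta>) * (1 / (2 powr q * pi powr (?d / 2))) / ?N powr (?d - 2 * q)"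
      unfolding e2 ..
    finally have "(2 * pi) powr (- (?d / 2)) * (LINT y|lborel. ?f y) = Gamma (- \<beta>) * (1 / (2 powr q * pi powr (?d / 2))) / ?N powr (?d - 2 * q)" .
    then show ?thesis
      unfolding I using True by (simp add: continuum_green_def Let_def e)
  next
    case False
    with s have s: "s > 0" by simp
    define z where "z = sqrt (2 * ?d) * (s * ?N)"
    \<comment> \<open>The point where \<open>s^2 d r\<close> and \<open>|x|^2 / (2 r)\<close> agree:
      both equal \<open>z / 2\<close> there, so after translation by \<open>ln r0\<close> their sum
      is \<open>z cosh y\<close>.\<close>
    define r0 where "r0 = ?N / (s * sqrt (2 * ?d))"
    have z: "z > 0" using s N by (simp add: z_def)
    have r0: "r0 > 0" using s N by (simp add: r0_def)
    have z1: "s\<^sup>2 * ?d * r0 = z / 2"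
    proof -
      define w where "w = sqrt (2 * ?d)"
      have w: "w > 0" "?d = w * w / 2" by (simp_all add: w_def)
      have "s\<^sup>2 * (w * w / 2) * (?N / (s * w)) = w * (s * ?N) / 2"
        using s w(1) by (simp add: power2_eq_square)
      then show ?thesis unfolding r0_def z_def w_def[symmetric] w(2)[symmetric] .
    qed
    have z2: "?N\<^sup>2 / 2 / r0 = z / 2"
      using s N by (simp add: r0_def z_def power2_eq_square)
    let ?f = "\<lambda>y. exp (\<beta> * y) * exp (- (s\<^sup>2 * ?d * exp y + ?N\<^sup>2 / 2 * exp (- y)))"
    have "(LINT y|lborel. ?f y) = \<bar>1\<bar> *\<^sub>R (LINT y|lborel. ?f (ln r0 + 1 * y))"
      by (rule lborel_integral_real_affine) simp
    also have "(\<lambda>y. ?f (ln r0 + 1 * y)) = (\<lambda>y. r0 powr \<beta> * (exp (\<beta> * y) * exp (- (z * cosh y))))"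
    proof
      fix y :: real
      have "s\<^sup>2 * ?d * exp (ln r0 + 1 * y) + ?N\<^sup>2 / 2 * exp (- (ln r0 + 1 * y)) = s\<^sup>2 * ?d * r0 * exp y + ?N\<^sup>2 / 2 / r0 * exp (- y)"
        using r0 by (simp add: exp_add exp_diff exp_minus field_simps)
      also have "\<dots> = z * cosh y" unfolding z1 z2 by (simp add: cosh_def field_simps)
      finally have "?f (ln r0 + 1 * y) = exp (\<beta> * (ln r0 + 1 * y)) * exp (- (z * cosh y))" by simp
      then show "?f (ln r0 + 1 * y) = r0 powr \<beta> * (exp (\<beta> * y) * exp (- (z * cosh y)))"
        using r0 by (simp add: powr_def exp_add algebra_simps)
    qed
    also have "\<bar>1\<bar> *\<^sub>R integral\<^sup>L lborel \<dots> = r0 powr \<beta> * (2 * bessel_K \<beta> z)"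
      using bessel_K_full_line[OF z, of \<beta>] by simp
    also have "bessel_K \<beta> z = bessel_K ((?d - 2 * q) / 2) z"
    proof -
      have "(?d - 2 * q) / 2 = - \<beta>" by (simp add: \<beta>_def field_simps)
      then show ?thesis by (simp only: bessel_K_minus)
    qed
    finally have J: "(LINT y|lborel. ?f y) = r0 powr \<beta> * (2 * bessel_K ((?d - 2 * q) / 2) z)" .
    have P: "s powr (?d - 2 * q) * (sqrt (2 * ?d) / (s * ?N)) powr ((?d - 2 * q) / 2) = r0 powr \<beta>"
    proof -
      define e where "e = (?d - 2 * q) / 2"
      have e: "?d - 2 * q = e + e" "\<beta> = - e" by (simp_all add: e_def \<beta>_def field_simps)
      have "r0 powr \<beta> = (1 / r0) powr e"
        unfolding e(2) using r0 by (simp add: powr_minus_divide powr_divide)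
      also have "1 / r0 = s * s * (sqrt (2 * ?d) / (s * ?N))" using s N by (simp add: r0_def)
      also have "\<dots> powr e = s powr e * s powr e * (sqrt (2 * ?d) / (s * ?N)) powr e"
      proof -
        have "(s * s * X) powr e = s powr e * s powr e * X powr e" if "X \<ge> 0" for X
          using s that by (simp add: powr_mult)
        from this[of "sqrt (2 * ?d) / (s * ?N)"] show ?thesis using s by simp
      qed
      also have "s powr e * s powr e = s powr (?d - 2 * q)" unfolding e(1) by (rule powr_add[symmetric])
      finally show ?thesis by (simp add: e_def)
    qed
    have "continuum_green s q x = ?d powr q / Gamma q * (1 / (2 * pi) powr (?d / 2) *
        (s powr (?d - 2 * q) * (sqrt (2 * ?d) / (s * ?N)) powr ((?d - 2 * q) / 2) * (2 * bessel_K ((?d - 2 * q) / 2) z)))"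
      using s by (simp add: continuum_green_def green_one_def Let_def z_def)
    also have "\<dots> = ?d powr q / Gamma q * (LINT r:{0<..}|lborel. limit_integrand s q x r)"
      unfolding I J P powr_minus_divide by simp
    finally show ?thesis .
  qed
qed

theorem lattice_green_critical:
  fixes x :: "real^'n::finite"
  assumes q: "q > 0" and s: "s \<ge> 0" "s = 0 \<longrightarrow> real CARD('n) > 2 * q" and x: "x \<in> int_lattice - {0}"
  shows "(\<lambda>n. lattice_green (s / real n) q (real n *\<^sub>R x)) \<sim>[sequentially]
     (\<lambda>n. complex_of_real (1 / real n powr (real CARD('n) - 2 * q) * continuum_green s q x))"
proof -
  let ?d = "real CARD('n)"
  let ?J = "\<lambda>n. real n powr (?d - 2 * q) * (LINT t:{0<..}|lborel. green_integrand (s / real n) q (real n *\<^sub>R x) t)"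
  let ?I = "LINT r:{0<..}|lborel. limit_integrand s q x r"
  let ?c = "?d powr q / Gamma q"
  have x': "x \<in> int_lattice" "x \<noteq> 0" using x by auto
  have s': "s \<noteq> 0 \<or> 2 * q < ?d" using s by auto
  have I: "?I > 0" by (rule limit_integral_pos[OF limit_integral_convergence(1)[OF q s' x']])
  have c: "?c > 0" using Gamma_real_pos[OF q] by simp
  have G: "continuum_green s q x = ?c * ?I" by (rule continuum_green_eq_integral[OF q s x'(2)])
  have "(\<lambda>n. ?J n / ?I) \<longlonglongrightarrow> ?I / ?I"
    by (intro tendsto_divide limit_integral_convergence(2)[OF q s' x'] tendsto_const) (use I in auto)
  then have "(\<lambda>n. complex_of_real (?J n / ?I)) \<longlonglongrightarrow> complex_of_real (?I / ?I)"
    by (rule tendsto_of_real)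
  then have lim: "(\<lambda>n. complex_of_real (?J n / ?I)) \<longlonglongrightarrow> 1" using I by simp
  have eq: "\<forall>\<^sub>F n in sequentially. complex_of_real (?J n / ?I) =
     lattice_green (s / real n) q (real n *\<^sub>R x) / complex_of_real (1 / real n powr (?d - 2 * q) * continuum_green s q x)"
    using eventually_ge_at_top[of "1::nat"]
  proof eventually_elim
    case (elim n)
    then have n: "real n powr (?d - 2 * q) > 0" by simp
    have "lattice_green (s / real n) q (real n *\<^sub>R x) = of_real (?c * (LINT t:{0<..}|lborel. green_integrand (s / real n) q (real n *\<^sub>R x) t))"
      by (rule lattice_green_eq_integral[OF q]) (use s' elim in auto)
    moreover have "?J n / ?I = ?c * (LINT t:{0<..}|lborel. green_integrand (s / real n) q (real n *\<^sub>R x) t) / (1 / real n powr (?d - 2 * q) * (?c * ?I))"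
      using Gamma_real_pos[OF q] n I by simp
    ultimately show ?case unfolding G by (simp only: of_real_divide)
  qed
  show ?thesis
    by (rule asymp_equivI') (rule Lim_transform_eventually[OF lim eq])
qed

theorem theorem1p3:
  fixes q :: real
  assumes "q > 0"
  shows
    "(\<exists>c :: real \<Rightarrow> real^'n::finite \<Rightarrow> real.
        (\<forall>a>0. \<forall>x\<in>int_lattice - {0}. c a (x /\<^sub>R aniso_norm a x) > 0) \<and>
        (\<forall>a :: nat \<Rightarrow> real.
           (\<forall>n\<ge>1. a n > 0) \<and> bounded (a ` {1..}) \<and>
           filterlim (\<lambda>n. a n * real n) at_top sequentially \<longrightarrow>
           (let R = (\<lambda>n x. c (a n) (x /\<^sub>R aniso_norm (a n) x)
                  * (mass CARD('n) (a n) powr ((real CARD('n) - 1 - 2 * q) / 2)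
                     / (real n * aniso_norm (a n) x) powr ((real CARD('n) + 1 - 2 * q) / 2))
                  * exp (- mass CARD('n) (a n) * real n * aniso_norm (a n) x))
            in (\<forall>x\<in>int_lattice - {0}.
                  (\<lambda>n. lattice_green (a n) q (real n *\<^sub>R x))
                    \<sim>[sequentially] (\<lambda>n. complex_of_real (R n x))) \<and>
               uniform_limit (int_lattice - {0})
                 (\<lambda>n x. lattice_green (a n) q (real n *\<^sub>R x) / complex_of_real (R n x))
                 (\<lambda>_. 1) sequentially)) \<and>
        (\<forall>x\<in>int_lattice - {0}.
           ((\<lambda>a. c a (x /\<^sub>R aniso_norm a x)) \<longlongrightarrow>
              real CARD('n) powr q / ((2 * pi) powr ((real CARD('n) - 1) / 2) * Gamma q))
           (at_right 0)))
     \<and>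
     (\<forall>s\<ge>0. (s = 0 \<longrightarrow> real CARD('n) > 2 * q) \<longrightarrow>
        (\<forall>x\<in>int_lattice - {0 :: real^'n}.
           (\<lambda>n. lattice_green (s / real n) q (real n *\<^sub>R x))
             \<sim>[sequentially]
           (\<lambda>n. complex_of_real (1 / real n powr (real CARD('n) - 2 * q) * continuum_green s q x))))"
proof (rule conjI, goal_cases)
  case 1
  show ?case
  proof (intro exI[of _ "oz_const q"] conjI allI impI ballI, goal_cases)
    case (1 a x)
    then show ?case using assms by (intro oz_const_pos) auto
  next
    case (2 a)
    then have a: "\<And>n. n \<ge> 1 \<Longrightarrow> a n > 0" "bounded (a ` {1..})"
      "filterlim (\<lambda>n. a n * real n) at_top sequentially" by blast+
    note u = ornstein_zernike_uniform[OF assms a, where 'n = 'n]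
    show ?case
      unfolding Let_def
    proof (intro conjI ballI, goal_cases)
      case (1 x)
      \<comment> \<open>The pointwise equivalence is the uniform convergence of the ratio read at a
        single \<open>x\<close>.\<close>
      show ?case by (rule asymp_equivI') (rule tendsto_uniform_limitI[OF u 1])
    next
      case 2
      show ?case by (rule u)
    qed
  next
    case (3 x)
    then show ?case using assms by (intro oz_const_tendsto) auto
  qed
next
  case 2
  show ?case
  proof (intro allI impI ballI, goal_cases)
    case (1 s x)
    then show ?case using assms by (intro lattice_green_critical) auto
  qed
qed

end
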